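(* Suppose that $A\in\mathbb{R}^{n\times n}$ is nonsingular and $SSR_k$ for all odd $k$ in the range $\{1,\dots,n\}$; for such $k$ let $\epsilon_k\in\{-1,1\}$ be the common sign of the minors of $A$ of order $k$. Let $\lambda_1,\dots,\lambda_n$ be the eigenvalues of $A$, ordered so that $|\lambda_1|\ge\dots\ge|\lambda_n|>0$ with complex conjugate eigenvalues appearing in consecutive pairs, and let $v^1,\dots,v^n\in\mathbb{C}^n$ be the corresponding eigenvectors. Then: (i) The eigenvalue $\lambda_1$ is simple, real, and $\epsilon_1\lambda_1>0$. (ii) The algebraic multiplicity of any eigenvalue of $A$ is not greater than $2$, and $|\lambda_1|>|\lambda_2|\ge|\lambda_3|>|\lambda_4|\ge|\lambda_5|>\cdots$. (iii) For every even $k$ in the range $\{2,\dots,n-1\}$, $\epsilon_{k-1}\epsilon_{k+1}\lambda_k\lambda_{k+1}>0$. (iv) If $n$ is even then $\lambda_n$ is real and $\epsilon_{n-1}\det(A)\lambda_n>0$. (v) For any $i$ (such that the indices that occur lie in $\{1,\dots,n\}$): if $v^{2i+1}$ is real then $s^+(v^{2i+1})\le 2i$, and if $v^{2i},v^{2i+1}$ is a complex conjugate pair then for any matching $c_1,c_2\in\mathbb{C}$, $s^+(c_1v^{2i}+c_2v^{2i+1})\le 2i$. Also, if $v^{2i}$ is real then $s^-(v^{2i})\ge 2i-1$, and if $v^{2i},v^{2i+1}$ is a complex conjugate pair then for any matching $c_1,c_2\in\mathbb{C}$, $s^-(c_1v^{2i}+c_2v^{2i+1})\ge 2i-1$. Furthermore,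 the vectors $u^1,\dots,u^p$, with $p$ the largest odd number satisfying $p\le n$, are linearly independent, where $u^1,\dots,u^n\in\mathbb{R}^n$ are the real vectors constructed from $v^1,\dots,v^n$ as described in the context.
   Context: A matrix is $SSR_k$ (strictly sign-regular of order $k$) if all its $k\times k$ minors are non-zero and have the same sign. For $y\in\mathbb{R}^n$, $s^-(y)$ is the number of sign variations in $y$ after deleting all its zero entries, and $s^+(y)$ is the maximal possible number of sign variations in $y$ after each zero entry is replaced by either $+1$ or $-1$. "Complex" for a number or vector means non-real. Conventions on eigenvectors: no $v^i$ is purely imaginary (otherwise it is replaced by its imaginary part); each $v^i$ is either real or belongs to a consecutive complex conjugate pair $v^i,\ v^{i+1}=\overline{v^i}$; for complex $v^i$ the real and imaginary parts are linearly independent. Matching: for a complex conjugate pair $v^{2i},v^{2i+1}$, numbers $c_1,c_2\in\mathbb{C}$ match the pair if they are not both zero and $c_2=\overline{c_1}$; then $c_1v^{2i}+c_2v^{2i+1}\in\mathbb{R}^n$. Construction of $u^1,\dots,u^n$: go through $v^1,v^2,\dots$ in order. If $v^1$ is real put $u^1:=v^1$ and proceed to $v^2$; if $v^1$ is complex (so $v^2=\overline{v^1}$) put $u^1:=\operatorname{Re}(v^1)$, $u^2:=\operatorname{Im}(v^1)$ and proceed to $v^3$; and so on.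
   Formalization: The linear independence of u^1,…,u^p is stated under the added assumption that eigenvectors v^i, v^j with i<j and λ_i=λ_j are linearly independent; without it the claim fails, e.g. for the defective matrix [[9,5,2],[3,7,6],[4,4,8]]. *)

theory Defs
  imports "Jordan_Normal_Form.Char_Poly" "Jordan_Normal_Form.VS_Connect"
    "Jordan_Normal_Form.DL_Submatrix" Complex_Main
begin

definition minors :: "nat \<Rightarrow> 'a :: comm_ring_1 mat \<Rightarrow> 'a set" where
  "minors k A = {det (submatrix A I J) | I J.
     I \<subseteq> {..<dim_row A} \<and> J \<subseteq> {..<dim_col A} \<and> card I = k \<and> card J = k}"

definition SSR :: "nat \<Rightarrow> real mat \<Rightarrow> bool" where
  "SSR k A \<longleftrightarrow> (\<forall>m \<in> minors k A. m \<noteq> 0) \<and> (\<forall>m \<in> minors k A. \<forall>m' \<in> minors k A. sgn m = sgn m')"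

text \<open>Sign variations of a list without zero entries; both \<open>s_minus\<close> and \<open>s_plus\<close>
  apply it to such lists only. In particular, \<open>s_minus\<close> of the zero vector is 0.\<close>

definition sign_variations :: "real list \<Rightarrow> nat" where
  "sign_variations xs = card {i. Suc i < length xs \<and> xs ! i * xs ! Suc i < 0}"

definition s_minus :: "real vec \<Rightarrow> nat" where
  "s_minus y = sign_variations (filter (\<lambda>x. x \<noteq> 0) (list_of_vec y))"

definition s_plus :: "real vec \<Rightarrow> nat" where
  "s_plus y = Max {sign_variations (list_of_vec z) | z. dim_vec z = dim_vec y \<and>
     (\<forall>i < dim_vec y. if y $ i = 0 then z $ i \<in> {-1, 1} else z $ i = y $ i)}"

abbreviation complex_mat :: "real mat \<Rightarrow> complex mat" where
  "complex_mat \<equiv> map_mat complex_of_real"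

definition real_vec :: "complex vec \<Rightarrow> bool" where
  "real_vec w \<longleftrightarrow> (\<forall>i < dim_vec w. w $ i \<in> \<real>)"

abbreviation Re_vec :: "complex vec \<Rightarrow> real vec" where
  "Re_vec \<equiv> map_vec Re"

abbreviation Im_vec :: "complex vec \<Rightarrow> real vec" where
  "Im_vec \<equiv> map_vec Im"

definition conj_pair :: "complex vec \<Rightarrow> complex vec \<Rightarrow> bool" where
  "conj_pair w w' \<longleftrightarrow> \<not> real_vec w \<and> w' = conjugate w"

definition matching :: "complex \<Rightarrow> complex \<Rightarrow> bool" where
  "matching c1 c2 \<longleftrightarrow> \<not> (c1 = 0 \<and> c2 = 0) \<and> c2 = cnj c1"

text \<open>For a conjugate pair and matching coefficients the combination has real entries,
  so that taking real parts only changes the type.\<close>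

definition real_comb :: "complex \<Rightarrow> complex vec \<Rightarrow> complex \<Rightarrow> complex vec \<Rightarrow> real vec" where
  "real_comb c1 w c2 w' = Re_vec (c1 \<cdot>\<^sub>v w + c2 \<cdot>\<^sub>v w')"

text \<open>Linear independence of a finite family, so repeated vectors are excluded. It also serves
  as a premise on eigenvectors of a repeated eigenvalue: without that premise one could
  list the same eigenvector twice, and the \<open>u\<^sup>i\<close> would be dependent.\<close>

definition lin_indpt_family :: "nat \<Rightarrow> 'a :: field vec list \<Rightarrow> bool" where
  "lin_indpt_family n ws \<longleftrightarrow> set ws \<subseteq> carrier_vec n \<and> distinct ws \<and>
     LinearCombinations.module.lin_indpt class_ring (module_vec TYPE('a) n) (set ws)"

text \<open>Passing from \<open>v\<^sup>1, \<dots>, v\<^sup>n\<close> to \<open>u\<^sup>1, \<dots>, u\<^sup>n\<close>. The second vector of a conjugate pair is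
  skipped. A trailing non-real vector without partner does not occur in the intended lists; the
  singleton equation merely makes the function total.\<close>

fun realify :: "complex vec list \<Rightarrow> real vec list" where
  "realify [] = []"
| "realify [w] = [Re_vec w]"
| "realify (w # w' # ws) =
     (if real_vec w then Re_vec w # realify (w' # ws) else Re_vec w # Im_vec w # realify ws)"

end

theory Submission
  imports Defs "Jordan_Normal_Form.Schur_Decomposition"
begin

text \<open>For odd \<open>k\<close> the \<open>k\<close>-th compound of \<open>A\<close>, the matrix of its minors of order \<open>k\<close>, is up to the sign
  \<open>\<epsilon>\<^sub>k\<close> entrywise positive, and its eigenvalues are the products of \<open>k\<close> of the \<open>\<lambda>\<^sub>i\<close>. Perron's theorem then
  makes \<open>\<epsilon>\<^sub>k \<lambda>\<^sub>1 \<cdots> \<lambda>\<^sub>k\<close> positive, gives the gap between \<open>\<lambda>\<^sub>k\<close> and \<open>\<lambda>\<^sub>k\<^sub>+\<^sub>1\<close>, and shows that the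
  minors of order \<open>k\<close> of a basis of the dominant invariant subspace, its Pluecker coordinates, all have
  the same phase; likewise for the transpose. A vector in a space of dimension \<open>k\<close> with such
  coordinates has at most \<open>k - 1\<close> weak sign variations, and a vector orthogonal to one has at least
  \<open>k\<close> strong ones.\<close>

section \<open>Minors and the Cauchy-Binet formula\<close>

text \<open>Only minors of odd order are controlled, so moduli are separated only behind odd
  positions. Eigenvalues can share a modulus only at positions \<open>2 * i\<close> and
  \<open>2 * i + 1\<close>; conjugate pairs sit there, and a cut behind an odd position never splits
  one. All parities in the claims come from this. The obstacle is that \<open>A\<close> need not be
  diagonalizable, so eigenvectors of its compounds cannot simply be assembled from those of
  \<open>A\<close>. Schur triangularisations of \<open>A\<close> and of its transpose take their
  place, and a coupling as in a Jordan block is removed inside \<open>spectral_gap\<close>.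
  Orthogonality is taken against the dominant subspace of the transpose, since eigenvectors of
  \<open>A\<close> need not be orthogonal to each other. The dominant subspace of \<open>A\<close>
  and the annihilator of that of the transpose meet only in zero, again because their Pluecker
  coordinates have constant phase; this yields the independence of the \<open>u\<close> vectors,
  block by block.\<close>

definition ksets :: "nat \<Rightarrow> nat \<Rightarrow> nat set set" where
  "ksets n k = {I. I \<subseteq> {..<n} \<and> card I = k}"

text \<open>Entries come from a function, so that transposes and blocks with only the columns
  \<open>{..<k}\<close> carry no dimension conditions; \<open>pick\<close> enumerates the two index
  sets increasingly.\<close>

definition minor :: "(nat \<Rightarrow> nat \<Rightarrow> 'a :: comm_ring_1) \<Rightarrow> nat set \<Rightarrow> nat set \<Rightarrow> 'a" where
  "minor F I J = det (mat (card I) (card J) (\<lambda>(i, j). F (pick I i) (pick J j)))"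

lemma ksetsD:
  assumes "I \<in> ksets n k"
  shows "I \<subseteq> {..<n}" "card I = k" "finite I"
  using assms finite_subset by (auto simp: ksets_def)

lemma finite_ksets [simp]: "finite (ksets n k)"
  by (simp add: ksets_def)

lemma pick_lessThan:
  "j < k \<Longrightarrow> pick {..<k} j = j"
  using pick_card_in_set[of j "{..<k}"]
  by (simp add: Collect_conj_eq lessThan_def[symmetric] Int_absorb2)
     (metis Int_absorb2 card_lessThan lessThan_def lessThan_subset_iff nat_less_le Int_commute)

lemma pick_bij_betw:
  assumes "finite I"
  shows "bij_betw (pick I) {0..<card I} I"
proof -
  have "inj_on (pick I) {0..<card I}"
    by (rule linorder_inj_onI) (use pick_mono[of _ I] in \<open>auto simp: order_less_le\<close>)
  moreover have "pick I ` {0..<card I} \<subseteq> I"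
    using pick_in_set[of _ I] by auto
  ultimately show ?thesis
    by (metis assms bij_betw_def card_atLeastLessThan card_image card_subset_eq diff_zero)
qed

lemma submatrix_minor:
  assumes "I \<subseteq> {..<dim_row A}" "J \<subseteq> {..<dim_col A}"
  shows "det (submatrix A I J) = minor (\<lambda>i j. A $$ (i, j)) I J"
proof -
  have "{i. i < dim_row A \<and> i \<in> I} = I" "{i. i < dim_col A \<and> i \<in> J} = J"
    using assms by auto
  then show ?thesis by (simp add: submatrix_def minor_def)
qed

lemma minor_cong:
  assumes "I \<in> ksets m k" "J \<in> ksets n l" "\<And>i j. i < m \<Longrightarrow> j < n \<Longrightarrow> F i j = G i j"
  shows "minor F I J = minor G I J"
proof -
  have "F (pick I i) (pick J j) = G (pick I i) (pick J j)" if "i < card I" "j < card J" for i j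
    using that assms pick_in_set[of i I] pick_in_set[of j J] by (auto simp: ksets_def)
  then show ?thesis
    unfolding minor_def by (intro arg_cong[where f = det] eq_matI) auto
qed

lemma minor_transpose:
  assumes "card I = card J"
  shows "minor (\<lambda>i j. F j i) I J = minor F J I"
proof -
  let ?M = "mat (card J) (card I) (\<lambda>(i, j). F (pick J i) (pick I j))"
  have "det (transpose_mat ?M) = det ?M"
    by (rule det_transpose[of _ "card I"]) (simp add: assms)
  moreover have "transpose_mat ?M = mat (card I) (card J) (\<lambda>(i, j). F (pick J j) (pick I i))"
    by (rule eq_matI) auto
  ultimately show ?thesis by (simp add: minor_def)
qed

lemma minor_of_real:
  "minor (\<lambda>i j. complex_of_real (F i j)) I J = complex_of_real (minor F I J)"
proof -
  have "mat (card I) (card J) (\<lambda>(i, j). complex_of_real (F (pick I i) (pick J j))) =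
    complex_mat (mat (card I) (card J) (\<lambda>(i, j). F (pick I i) (pick J j)))"
    by (rule eq_matI) auto
  then show ?thesis by (simp add: minor_def of_real_hom.hom_det)
qed

text \<open>Composing a permutation with the increasing enumeration of \<open>J\<close> gives each
  injection onto \<open>J\<close> exactly once. The restriction makes the images agree with members
  of \<open>PiE\<close>, which are \<open>undefined\<close> off their domain.\<close>

lemma bij_betw_permutations_injections:
  assumes J: "J \<in> ksets n k"
  shows "bij_betw (\<lambda>q. \<lambda>i\<in>{0..<k}. pick J (q i)) {q. q permutes {0..<k}}
    {g \<in> PiE {0..<k} (\<lambda>_. {..<n}). inj_on g {0..<k} \<and> g ` {0..<k} = J}"
proof (rule bij_betwI')
  note bij = pick_bij_betw[OF ksetsD(3)[OF J], unfolded ksetsD(2)[OF J]]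
  fix q assume q: "q \<in> {q. q permutes {0..<k}}"
  have 1: "bij_betw (pick J \<circ> q) {0..<k} J"
    using bij q permutes_imp_bij bij_betw_trans by blast
  show "(\<lambda>i\<in>{0..<k}. pick J (q i)) \<in> {g \<in> PiE {0..<k} (\<lambda>_. {..<n}). inj_on g {0..<k} \<and> g ` {0..<k} = J}"
    using 1 ksetsD(1)[OF J] by (auto simp: bij_betw_def inj_on_def)
  fix r assume r: "r \<in> {q. q permutes {0..<k}}"
  show "((\<lambda>i\<in>{0..<k}. pick J (q i)) = (\<lambda>i\<in>{0..<k}. pick J (r i))) = (q = r)"
  proof
    assume eq: "(\<lambda>i\<in>{0..<k}. pick J (q i)) = (\<lambda>i\<in>{0..<k}. pick J (r i))"
    show "q = r"
    proof
      fix i show "q i = r i"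
      proof (cases "i \<in> {0..<k}")
        case True
        then have "pick J (q i) = pick J (r i)" using fun_cong[OF eq, of i] by simp
        moreover have "q i \<in> {0..<k}" "r i \<in> {0..<k}" using True q r permutes_in_image by fastforce+
        ultimately show ?thesis using bij by (auto simp: bij_betw_def inj_on_def)
      next
        case False
        then show ?thesis using q r by (simp add: permutes_def)
      qed
    qed
  qed simp
next
  note bij = pick_bij_betw[OF ksetsD(3)[OF J], unfolded ksetsD(2)[OF J]]
  fix g assume g: "g \<in> {g \<in> PiE {0..<k} (\<lambda>_. {..<n}). inj_on g {0..<k} \<and> g ` {0..<k} = J}"
  define q where "q i = (if i \<in> {0..<k} then inv_into {0..<k} (pick J) (g i) else i)" for i
  have "bij_betw (inv_into {0..<k} (pick J) \<circ> g) {0..<k} {0..<k}"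
    using g bij by (intro bij_betw_trans[of g _ J] bij_betw_inv_into) (auto simp: bij_betw_def)
  then have "bij_betw q {0..<k} {0..<k}"
    by (rule bij_betw_cong[THEN iffD1, rotated]) (simp add: q_def)
  then have "q permutes {0..<k}"
    by (rule bij_imp_permutes) (auto simp: q_def)
  moreover have "g = (\<lambda>i\<in>{0..<k}. pick J (q i))"
  proof
    fix i show "g i = (\<lambda>i\<in>{0..<k}. pick J (q i)) i"
    proof (cases "i \<in> {0..<k}")
      case True
      then have "g i \<in> J" using g by auto
      then show ?thesis using True bij by (simp add: q_def bij_betw_def f_inv_into_f)
    next
      case False
      then show ?thesis using g by (auto simp: PiE_def extensional_def)
    qed
  qed
  ultimately show "\<exists>q\<in>{q. q permutes {0..<k}}. g = (\<lambda>i\<in>{0..<k}. pick J (q i))" by blast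
qed

text \<open>Expanding every row of the product by multilinearity leaves a sum over choice functions
  \<open>g\<close>, one inner index per row. A \<open>g\<close> with a repeated value contributes a
  determinant with two equal rows; the others are grouped by their image \<open>J\<close>. The inner
  range \<open>n\<close> is independent of \<open>I\<close> and \<open>K\<close>, so rectangular
  factors are covered.\<close>

lemma cauchy_binet:
  assumes I: "card I = k" and K: "card K = k"
  shows "minor (\<lambda>i j. \<Sum>l<n. X i l * Y l j) I K = (\<Sum>J\<in>ksets n k. minor X I J * minor Y J K)"
proof -
  let ?U = "{0..<k}" and ?P = "{q. q permutes {0..<k}}"
  let ?G = "PiE ?U (\<lambda>_. {..<n})"
  define a where "a i l = X (pick I i) l" for i l
  define b where "b l j = Y l (pick K j)" for l j
  define D where "D g = det (mat k k (\<lambda>(i, j). b (g i) j))" for g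
  have D: "D g = (\<Sum>p\<in>?P. signof p * (\<Prod>i\<in>?U. b (g i) (p i)))" for g
    unfolding D_def by (subst det_def'[of _ k]) (auto intro!: sum.cong prod.cong)
  have "minor (\<lambda>i j. \<Sum>l<n. X i l * Y l j) I K
      = (\<Sum>p\<in>?P. signof p * (\<Prod>i\<in>?U. \<Sum>l<n. a i l * b l (p i)))"
    unfolding minor_def I K by (subst det_def'[of _ k]) (auto simp: a_def b_def intro!: sum.cong prod.cong)
  also have "\<dots> = (\<Sum>p\<in>?P. \<Sum>g\<in>?G. (\<Prod>i\<in>?U. a i (g i)) * (signof p * (\<Prod>i\<in>?U. b (g i) (p i))))"
    by (subst prod_sum_PiE) (auto simp: prod.distrib sum_distrib_left ac_simps intro!: sum.cong)
  also have "\<dots> = (\<Sum>g\<in>?G. (\<Prod>i\<in>?U. a i (g i)) * D g)"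
    by (subst sum.swap) (simp add: D sum_distrib_left)
  also have "\<dots> = (\<Sum>g\<in>{g \<in> ?G. inj_on g ?U}. (\<Prod>i\<in>?U. a i (g i)) * D g)"
  proof (rule sum.mono_neutral_right)
    show "\<forall>g\<in>?G - {g \<in> ?G. inj_on g ?U}. (\<Prod>i\<in>?U. a i (g i)) * D g = 0"
    proof
      fix g assume "g \<in> ?G - {g \<in> ?G. inj_on g ?U}"
      then obtain i j where "i < k" "j < k" "i \<noteq> j" "g i = g j" by (auto simp: inj_on_def)
      then have "D g = 0"
        unfolding D_def by (intro det_identical_rows[of _ k i j]) (auto intro!: eq_vecI)
      then show "(\<Prod>i\<in>?U. a i (g i)) * D g = 0" by simp
    qed
  qed (auto intro!: finite_PiE)
  also have "\<dots> = (\<Sum>J\<in>ksets n k. \<Sum>g\<in>{g \<in> {g \<in> ?G. inj_on g ?U}. g ` ?U = J}. (\<Prod>i\<in>?U. a i (g i)) * D g)"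
    by (rule sum.group[symmetric]) (auto intro!: finite_PiE simp: ksets_def card_image)
  also have "\<dots> = (\<Sum>J\<in>ksets n k. minor X I J * minor Y J K)"
  proof (rule sum.cong[OF refl])
    fix J assume J: "J \<in> ksets n k"
    have "(\<Sum>g\<in>{g \<in> {g \<in> ?G. inj_on g ?U}. g ` ?U = J}. (\<Prod>i\<in>?U. a i (g i)) * D g)
       = (\<Sum>q\<in>?P. (\<Prod>i\<in>?U. a i ((\<lambda>i\<in>?U. pick J (q i)) i)) * D (\<lambda>i\<in>?U. pick J (q i)))"
      using sum.reindex_bij_betw[OF bij_betw_permutations_injections[OF J],
        of "\<lambda>g. (\<Prod>i\<in>?U. a i (g i)) * D g"] by (simp add: conj_assoc)
    also have "\<dots> = (\<Sum>q\<in>?P. signof q * (\<Prod>i\<in>?U. X (pick I i) (pick J (q i))) * minor Y J K)"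
    proof (rule sum.cong[OF refl])
      fix q assume q: "q \<in> ?P"
      let ?M = "mat k k (\<lambda>(i, j). Y (pick J i) (pick K j))"
      \<comment> \<open>The chosen rows are those of \<open>minor Y J K\<close> permuted by
        \<open>q\<close>; the sign that this costs is the one in the Leibniz formula for
        \<open>minor X I J\<close>.\<close>
      have "D (\<lambda>i\<in>?U. pick J (q i)) = det (mat k k (\<lambda>(i, j). ?M $$ (q i, j)))"
        unfolding D_def b_def
      proof (intro arg_cong[where f = det] eq_matI)
        fix i j assume "i < dim_row (mat k k (\<lambda>(i, j). ?M $$ (q i, j)))"
          "j < dim_col (mat k k (\<lambda>(i, j). ?M $$ (q i, j)))"
        moreover from this have "q i < k" using q permutes_in_image[of q ?U i] by auto
        ultimately show "mat k k (\<lambda>(i, j). Y ((\<lambda>i\<in>?U. pick J (q i)) i) (pick K j)) $$ (i, j)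
          = mat k k (\<lambda>(i, j). ?M $$ (q i, j)) $$ (i, j)" by simp
      qed auto
      also have "\<dots> = signof q * det ?M"
        by (rule det_permute_rows) (use q in auto)
      also have "det ?M = minor Y J K"
        by (simp add: minor_def K ksetsD(2)[OF J])
      finally have "D (\<lambda>i\<in>?U. pick J (q i)) = signof q * minor Y J K" .
      moreover have "(\<Prod>i\<in>?U. a i ((\<lambda>i\<in>?U. pick J (q i)) i)) = (\<Prod>i\<in>?U. X (pick I i) (pick J (q i)))"
        by (rule prod.cong) (simp_all add: a_def)
      ultimately show "(\<Prod>i\<in>?U. a i ((\<lambda>i\<in>?U. pick J (q i)) i)) * D (\<lambda>i\<in>?U. pick J (q i))
        = signof q * (\<Prod>i\<in>?U. X (pick I i) (pick J (q i))) * minor Y J K"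
        by (simp only: mult_ac)
    qed
    also have "\<dots> = minor X I J * minor Y J K"
    proof -
      have "minor X I J = (\<Sum>q\<in>?P. signof q * (\<Prod>i\<in>?U. X (pick I i) (pick J (q i))))"
        unfolding minor_def I ksetsD(2)[OF J]
        by (subst det_def'[of _ k]) (auto intro!: sum.cong prod.cong)
      then show ?thesis by (simp add: sum_distrib_right)
    qed
    finally show "(\<Sum>g\<in>{g \<in> {g \<in> ?G. inj_on g ?U}. g ` ?U = J}. (\<Prod>i\<in>?U. a i (g i)) * D g)
      = minor X I J * minor Y J K" .
  qed
  finally show ?thesis .
qed

section \<open>Index sets ordered by element sum, and minors of triangular matrices\<close>

lemma sum_pick:
  assumes "I \<in> ksets n k"
  shows "(\<Sum>i\<in>{0..<k}. f (pick I i)) = sum f I"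
  using sum.reindex_bij_betw[OF pick_bij_betw[OF ksetsD(3)[OF assms]], of f] ksetsD(2)[OF assms]
  by simp

lemma prod_pick:
  assumes "I \<in> ksets n k"
  shows "(\<Prod>i\<in>{0..<k}. f (pick I i)) = prod f I"
  using prod.reindex_bij_betw[OF pick_bij_betw[OF ksetsD(3)[OF assms]], of f] ksetsD(2)[OF assms]
  by simp

lemma pick_image:
  assumes "I \<in> ksets n k"
  shows "pick I ` {0..<k} = I"
  using pick_bij_betw[OF ksetsD(3)[OF assms]] ksetsD(2)[OF assms] by (simp add: bij_betw_def)

lemma pick_ge:
  "i < card I \<Longrightarrow> i \<le> pick I i"
proof (induction i)
  case (Suc i)
  then show ?case using pick_mono[of "Suc i" I i] by simp
qed simp

lemma lessThan_kset: "k \<le> n \<Longrightarrow> {..<k} \<in> ksets n k"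
  by (auto simp: ksets_def)

lemma sum_kset_ge:
  assumes "I \<in> ksets n k"
  shows "\<Sum>{..<k} \<le> \<Sum>I"
proof -
  have "(\<Sum>i\<in>{0..<k}. i) \<le> (\<Sum>i\<in>{0..<k}. pick I i)"
    by (rule sum_mono) (use pick_ge ksetsD(2)[OF assms] in auto)
  then show ?thesis using sum_pick[OF assms, of "\<lambda>x. x"] by (simp add: lessThan_atLeast0)
qed

text \<open>Since \<open>i \<le> pick I i\<close> for every \<open>i\<close>, equal sums force
  equality throughout. So \<open>{..<k}\<close> is the only minimum of the order by element sums,
  and its column in the compound of an upper triangular matrix vanishes off the diagonal.\<close>

lemma sum_kset_eq:
  assumes "I \<in> ksets n k" "\<Sum>I \<le> \<Sum>{..<k}"
  shows "I = {..<k}"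
proof -
  have "(\<Sum>i\<in>{0..<k}. i) = (\<Sum>i\<in>{0..<k}. pick I i)"
    using sum_pick[OF assms(1), of "\<lambda>x. x"] sum_kset_ge[OF assms(1)] assms(2)
    by (simp add: lessThan_atLeast0)
  then have "i = pick I i" if "i \<in> {0..<k}" for i
    using sum_mono_inv[of "\<lambda>i. i" "{0..<k}" "pick I" i] that pick_ge ksetsD(2)[OF assms(1)] by auto
  then have "pick I ` {0..<k} = {0..<k}" by force
  then show ?thesis using pick_image[OF assms(1)] by (simp add: lessThan_atLeast0)
qed

text \<open>The element sum of the index set serves as a linear order making the compound of a
  triangular matrix triangular.\<close>

lemma minor_triangular:
  fixes B :: "nat \<Rightarrow> nat \<Rightarrow> 'a :: idom"
  assumes ut: "\<And>i j. j < i \<Longrightarrow> i < n \<Longrightarrow> B i j = 0"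
    and I: "I \<in> ksets n k" and J: "J \<in> ksets n k"
    and nz: "minor B I J \<noteq> 0"
  shows "\<Sum>I < \<Sum>J \<or> I = J"
proof -
  let ?U = "{0..<k}" and ?P = "{q. q permutes {0..<k}}"
  have "minor B I J = (\<Sum>p\<in>?P. signof p * (\<Prod>i\<in>?U. B (pick I i) (pick J (p i))))"
    unfolding minor_def ksetsD(2)[OF I] ksetsD(2)[OF J]
    by (subst det_def'[of _ k]) (auto intro!: sum.cong prod.cong)
  \<comment> \<open>A nonzero term of the Leibniz formula supplies a permutation along which every
    entry lies on or above the diagonal.\<close>
  then obtain p where p: "p permutes ?U" and "(\<Prod>i\<in>?U. B (pick I i) (pick J (p i))) \<noteq> 0"
    using nz by (auto elim!: sum.not_neutral_contains_not_neutral)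
  then have B: "B (pick I i) (pick J (p i)) \<noteq> 0" if "i \<in> ?U" for i
    using that by auto
  have le: "pick I i \<le> pick J (p i)" if "i \<in> ?U" for i
  proof -
    have "pick I i \<in> I" using that pick_in_set[of i I] ksetsD(2)[OF I] by auto
    then have "pick I i < n" using ksetsD(1)[OF I] by auto
    then show ?thesis using B[OF that] ut[of "pick J (p i)" "pick I i"] by force
  qed
  have J': "(\<Sum>i\<in>?U. pick J (p i)) = \<Sum>J"
    using sum.permute[OF p, of "pick J"] sum_pick[OF J, of "\<lambda>x. x"] by (simp add: o_def)
  have I': "(\<Sum>i\<in>?U. pick I i) = \<Sum>I"
    using sum_pick[OF I, of "\<lambda>x. x"] by simp
  have IJ: "\<Sum>I \<le> \<Sum>J"
    using sum_mono[of ?U "pick I" "\<lambda>i. pick J (p i)"] le I' J' by simp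
  show ?thesis
  proof (cases "\<Sum>I = \<Sum>J")
    case True
    then have "pick I i = pick J (p i)" if "i \<in> ?U" for i
      using sum_mono_inv[of "pick I" ?U "\<lambda>i. pick J (p i)" i] that le I' J' by auto
    then have "pick I ` ?U = (pick J \<circ> p) ` ?U" by auto
    also have "\<dots> = pick J ` ?U" using permutes_image[OF p] by (metis image_comp)
    finally show ?thesis using pick_image[OF I] pick_image[OF J] by simp
  qed (use IJ in simp)
qed

lemma minor_triangular_diag:
  fixes B :: "nat \<Rightarrow> nat \<Rightarrow> 'a :: idom"
  assumes ut: "\<And>i j. j < i \<Longrightarrow> i < n \<Longrightarrow> B i j = 0"
    and J: "J \<in> ksets n k"
  shows "minor B J J = (\<Prod>j\<in>J. B j j)"
proof -
  let ?M = "mat k k (\<lambda>(i, j). B (pick J i) (pick J j))"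
  have "upper_triangular ?M"
  proof
    fix i j assume "j < i" "i < dim_row ?M"
    moreover from this have "pick J j < pick J i" "pick J i \<in> J"
      using ksetsD(2)[OF J] pick_mono[of i J j] pick_in_set[of i J] by auto
    ultimately show "?M $$ (i, j) = 0" using ut ksetsD(1)[OF J] by auto
  qed
  then have "det ?M = prod_list (diag_mat ?M)"
    by (rule det_upper_triangular[of _ k]) simp
  also have "\<dots> = (\<Prod>i\<in>{0..<k}. B (pick J i) (pick J i))"
    unfolding diag_mat_def by (simp add: prod.distinct_set_conv_list[symmetric])
  finally show ?thesis
    using prod_pick[OF J, of "\<lambda>j. B j j"] by (simp add: minor_def ksetsD(2)[OF J])
qed

text \<open>The identity is both triangular and symmetric, so a nonzero minor with
  \<open>I \<noteq> J\<close> would give \<open>\<Sum>I < \<Sum>J\<close> together with its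
  reverse.\<close>

lemma minor_id:
  assumes I: "I \<in> ksets n k" and J: "J \<in> ksets n k"
  shows "minor (\<lambda>i j. if i = j then 1 else 0 :: 'a :: idom) I J = (if I = J then 1 else 0)"
proof (cases "I = J")
  case True
  then show ?thesis using minor_triangular_diag[OF _ J, of "\<lambda>i j. if i = j then 1 else 0 :: 'a"] by simp
next
  case False
  let ?E = "\<lambda>i j. if i = j then 1 else 0 :: 'a"
  have E: "(\<lambda>i j. if j = i then 1 else 0 :: 'a) = ?E" by (intro ext) auto
  have sym: "minor ?E I J = minor ?E J I"
    using minor_transpose[of I J ?E] ksetsD(2)[OF I] ksetsD(2)[OF J] unfolding E by simp
  have "minor ?E I J = 0"
  proof (rule ccontr)
    assume "minor ?E I J \<noteq> 0"
    then have "\<Sum>I < \<Sum>J" "\<Sum>J < \<Sum>I"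
      using minor_triangular[of n ?E I k J] minor_triangular[of n ?E J k I] I J False sym by auto
    then show False by simp
  qed
  then show ?thesis using False by simp
qed

section \<open>Perron theory of positive matrices\<close>

text \<open>Monotone subsequences are extracted one coordinate after another, and passing to a
  further subsequence keeps the earlier limits. This is the compactness behind the maximum in
  Perron's theorem.\<close>

lemma convergent_subseq_finite:
  fixes x :: "nat \<Rightarrow> 'a \<Rightarrow> real"
  assumes "finite S" "\<And>m i. i \<in> S \<Longrightarrow> \<bar>x m i\<bar> \<le> C"
  shows "\<exists>r. strict_mono (r :: nat \<Rightarrow> nat) \<and> (\<forall>i\<in>S. convergent (\<lambda>m. x (r m) i))"
  using assms
proof (induction S)
  case empty
  then show ?case by (auto intro: strict_mono_id)
next
  case (insert a S)
  then obtain r where r: "strict_mono (r :: nat \<Rightarrow> nat)" "\<forall>i\<in>S. convergent (\<lambda>m. x (r m) i)" by auto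
  obtain g where g: "strict_mono (g :: nat \<Rightarrow> nat)" "monoseq (\<lambda>m. x (r (g m)) a)"
    using seq_monosub[of "\<lambda>m. x (r m) a"] by auto
  have "convergent (\<lambda>m. x (r (g m)) a)"
    using g(2) insert.prems by (intro Bseq_monoseq_convergent BseqI'[of _ C]) auto
  moreover have "convergent (\<lambda>m. x (r (g m)) i)" if "i \<in> S" for i
    using convergent_subseq_convergent[OF r(2)[rule_format, OF that] g(1)] by (simp add: o_def)
  ultimately show ?case
    using strict_mono_o[OF r(1) g(1)] by (intro exI[of _ "r \<circ> g"]) (simp add: o_def)
qed

text \<open>Collatz--Wielandt: maximise \<open>r\<close> over all \<open>x\<close> in the simplex with \<open>M x \<ge> r x\<close>; if a maximiser
  were not an eigenvector, then applying \<open>M\<close> once more would increase \<open>r\<close>.\<close>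

lemma perron_exists:
  fixes M :: "'a \<Rightarrow> 'a \<Rightarrow> real"
  assumes S: "finite S" "S \<noteq> {}" and pos: "\<And>i j. i \<in> S \<Longrightarrow> j \<in> S \<Longrightarrow> M i j > 0"
  shows "\<exists>\<rho> x. \<rho> > 0 \<and> (\<forall>i\<in>S. x i > 0) \<and> (\<forall>i\<in>S. (\<Sum>j\<in>S. M i j * x j) = \<rho> * x i)"
proof -
  define simplex where "simplex x \<longleftrightarrow> (\<forall>i\<in>S. x i \<ge> 0) \<and> sum x S = (1 :: real)" for x
  define R where "R = {r. \<exists>x. simplex x \<and> (\<forall>i\<in>S. r * x i \<le> (\<Sum>j\<in>S. M i j * x j))}"
  have le1: "x i \<le> 1" if "simplex x" "i \<in> S" for x i
    using that member_le_sum[of i S x] S by (auto simp: simplex_def)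
  have Mpos: "(\<Sum>j\<in>S. M i j * x j) > 0" if "simplex x" "i \<in> S" for x i
  proof -
    have "\<not> (\<forall>j\<in>S. x j \<le> 0)"
      using that(1) sum_nonpos[of S x] by (auto simp: simplex_def)
    then obtain j where "j \<in> S" "x j > 0" by force
    then show ?thesis
      using that S pos by (intro sum_pos2[of _ j]) (auto simp: simplex_def less_imp_le)
  qed
  have bdd: "bdd_above R"
  proof (rule bdd_aboveI)
    fix r assume "r \<in> R"
    then obtain x where x: "simplex x" "\<forall>i\<in>S. r * x i \<le> (\<Sum>j\<in>S. M i j * x j)" by (auto simp: R_def)
    have "r = (\<Sum>i\<in>S. r * x i)" using x(1) by (simp add: simplex_def sum_distrib_left[symmetric])
    also have "\<dots> \<le> (\<Sum>i\<in>S. \<Sum>j\<in>S. M i j * x j)" using x(2) by (intro sum_mono) auto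
    also have "\<dots> \<le> (\<Sum>i\<in>S. \<Sum>j\<in>S. M i j * 1)"
      using pos x(1) le1 by (intro sum_mono mult_left_mono) (auto simp: less_imp_le)
    finally show "r \<le> (\<Sum>i\<in>S. \<Sum>j\<in>S. M i j * 1)" .
  qed
  \<comment> \<open>The smallest quotient of an entry of \<open>M y\<close> by that of
    \<open>y\<close> exceeds \<open>r\<close>; scaled to sum 1, \<open>y\<close> shows that this
    quotient belongs to \<open>R\<close>.\<close>
  have grow: "\<exists>r'\<in>R. r < r'" if "\<forall>i\<in>S. y i > 0" "\<forall>i\<in>S. r * y i < (\<Sum>j\<in>S. M i j * y j)" for r y
  proof -
    define s where "s = sum y S"
    have s: "s > 0" unfolding s_def using that(1) S by (intro sum_pos) auto
    define q where "q i = (\<Sum>j\<in>S. M i j * y j) / y i" for i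
    define r' where "r' = Min (q ` S)"
    have "r < r'" unfolding r'_def q_def using S that by (auto simp: field_simps)
    moreover have "r' * y i \<le> (\<Sum>j\<in>S. M i j * y j)" if "i \<in> S" for i
    proof -
      have "r' \<le> q i" unfolding r'_def using S that by simp
      then show ?thesis using \<open>\<forall>i\<in>S. y i > 0\<close> that by (auto simp: q_def field_simps)
    qed
    then have "r' \<in> R"
      unfolding R_def simplex_def using s that(1)
      by (intro CollectI exI[of _ "\<lambda>i. y i / s"])
        (auto simp: sum_divide_distrib[symmetric] divide_simps s_def less_imp_le)
    ultimately show ?thesis by blast
  qed
  obtain \<rho>1 where \<rho>1: "\<rho>1 \<in> R" "\<rho>1 > 0"
    using grow[of "\<lambda>_. 1" 0] pos S by (auto intro: sum_pos)
  define \<rho> where "\<rho> = Sup R"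
  have \<rho>: "\<rho> > 0" unfolding \<rho>_def using \<rho>1 bdd by (meson cSup_upper less_le_trans)
  have "\<exists>r\<in>R. \<rho> - 1 / Suc m < r" for m
    using less_cSup_iff[OF _ bdd, of "\<rho> - 1 / Suc m"] \<rho>1 unfolding \<rho>_def by auto
  then obtain x r where x: "\<And>m. simplex (x m)"
    "\<And>m i. i \<in> S \<Longrightarrow> r m * x m i \<le> (\<Sum>j\<in>S. M i j * x m j)" "\<And>m :: nat. \<rho> - 1 / Suc m < r m"
    unfolding R_def by (simp add: Bex_def) metis
  have "\<bar>x m i\<bar> \<le> 1" if "i \<in> S" for m i
    using le1[OF x(1) that] x(1)[of m] that by (auto simp: simplex_def)
  then have "\<exists>f. strict_mono (f :: nat \<Rightarrow> nat) \<and> (\<forall>i\<in>S. convergent (\<lambda>m. x (f m) i))"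
    using S(1) by (intro convergent_subseq_finite)
  then obtain f where f: "strict_mono (f :: nat \<Rightarrow> nat)" "\<forall>i\<in>S. convergent (\<lambda>m. x (f m) i)"
    by (elim exE conjE)
  define z where "z i = lim (\<lambda>m. x (f m) i)" for i
  have z: "(\<lambda>m. x (f m) i) \<longlonglongrightarrow> z i" if "i \<in> S" for i
    using f(2) that by (simp add: z_def convergent_LIMSEQ_iff)
  have zs: "simplex z"
    unfolding simplex_def
  proof (intro conjI ballI)
    fix i assume "i \<in> S"
    then show "z i \<ge> 0"
      using LIMSEQ_le_const[OF z] x(1) by (auto simp: simplex_def)
  next
    have "(\<lambda>m. sum (x (f m)) S) \<longlonglongrightarrow> sum z S" by (intro tendsto_sum z)
    then show "sum z S = 1" using x(1) by (simp add: simplex_def LIMSEQ_const_iff)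
  qed
  have zle: "\<rho> * z i \<le> (\<Sum>j\<in>S. M i j * z j)" if "i \<in> S" for i
  proof (rule LIMSEQ_le)
    have "(\<lambda>m. \<rho> - 1 / real (Suc m)) \<longlonglongrightarrow> \<rho> - 0"
      by (intro tendsto_diff tendsto_const LIMSEQ_Suc[OF lim_1_over_n])
    then have "(\<lambda>m. \<rho> - 1 / real (Suc (f m))) \<longlonglongrightarrow> \<rho>"
      using LIMSEQ_subseq_LIMSEQ[OF _ f(1), of "\<lambda>m. \<rho> - 1 / real (Suc m)"] by (simp add: o_def)
    then show "(\<lambda>m. (\<rho> - 1 / real (Suc (f m))) * x (f m) i) \<longlonglongrightarrow> \<rho> * z i"
      using z[OF that] by (rule tendsto_mult)
    show "(\<lambda>m. \<Sum>j\<in>S. M i j * x (f m) j) \<longlonglongrightarrow> (\<Sum>j\<in>S. M i j * z j)"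
      by (intro tendsto_sum tendsto_mult tendsto_const z)
    have "(\<rho> - 1 / real (Suc (f m))) * x (f m) i \<le> (\<Sum>j\<in>S. M i j * x (f m) j)" for m
      using mult_right_mono[OF less_imp_le[OF x(3)[of "f m"]], of "x (f m) i"] x(1)[of "f m"] x(2)[OF that, of "f m"] that
      by (simp add: simplex_def)
    then show "\<exists>N. \<forall>m\<ge>N. (\<rho> - 1 / real (Suc (f m))) * x (f m) i \<le> (\<Sum>j\<in>S. M i j * x (f m) j)"
      by blast
  qed
  define y where "y i = (\<Sum>j\<in>S. M i j * z j)" for i
  have ypos: "\<forall>i\<in>S. y i > 0" using Mpos[OF zs] by (simp add: y_def)
  have eq: "y i = \<rho> * z i" if i: "i \<in> S" for i
  proof (rule ccontr)
    assume "y i \<noteq> \<rho> * z i"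
    then have lt: "\<rho> * z i < y i" using zle[OF i] by (simp add: y_def)
    have "\<rho> * y l < (\<Sum>j\<in>S. M l j * y j)" if l: "l \<in> S" for l
    proof -
      have "\<rho> * y l = (\<Sum>j\<in>S. M l j * (\<rho> * z j))" by (simp add: y_def sum_distrib_left mult_ac)
      also have "\<dots> < (\<Sum>j\<in>S. M l j * y j)"
      proof (rule sum_strict_mono_ex1)
        show "\<forall>j\<in>S. M l j * (\<rho> * z j) \<le> M l j * y j"
          using pos l zle by (auto simp: y_def less_imp_le intro!: mult_left_mono)
        show "\<exists>j\<in>S. M l j * (\<rho> * z j) < M l j * y j"
          using pos l lt i by (intro bexI[of _ i]) auto
      qed (rule S)
      finally show ?thesis .
    qed
    then obtain r' where "r' \<in> R" "\<rho> < r'" using grow[OF ypos] by blast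
    then show False using cSup_upper[OF _ bdd] unfolding \<rho>_def by force
  qed
  then have "\<forall>i\<in>S. z i > 0" using ypos \<rho> by (metis zero_less_mult_pos)
  then show ?thesis using \<rho> eq by (auto simp: y_def)
qed


section \<open>Equality in the triangle inequality and peripheral eigenvectors\<close>

lemma complex_eq_norm:
  assumes "Re w = cmod w"
  shows "w = of_real (cmod w)"
proof -
  have "(Im w)\<^sup>2 = 0" using cmod_power2[of w] unfolding assms by simp
  then show ?thesis using assms by (simp add: complex_eq_iff)
qed

text \<open>After rotating the sum onto the positive axis, the real parts of the summands add up to
  the same total as their moduli; each is at most its modulus, so the two agree term by
  term.\<close>

lemma complex_same_phase:
  fixes z :: "'a \<Rightarrow> complex"
  assumes S: "finite S" and a: "cmod (sum z S) = (\<Sum>i\<in>S. cmod (z i))"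
    and nz: "sum z S \<noteq> 0"
  shows "\<forall>i\<in>S. z i = of_real (cmod (z i)) * sgn (sum z S)"
proof
  fix i assume i: "i \<in> S"
  define w where "w = sgn (sum z S)"
  have w: "cmod w = 1" using nz by (simp add: w_def norm_sgn)
  have ww: "w * cnj w = 1"
    using w by (simp add: complex_norm_square[symmetric])
  have "(\<Sum>i\<in>S. Re (cnj w * z i)) = Re (cnj w * sum z S)"
    by (simp only: sum_distrib_left Re_sum)
  also have "sum z S = of_real (cmod (sum z S)) * w"
    using nz by (simp add: w_def sgn_eq)
  also have "cnj w * (of_real (cmod (sum z S)) * w) = of_real (cmod (sum z S)) * (w * cnj w)"
    by (simp only: mult_ac)
  also have "Re \<dots> = (\<Sum>i\<in>S. cmod (cnj w * z i))"
    unfolding ww by (simp add: a norm_mult w)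
  finally have "Re (cnj w * z i) = cmod (cnj w * z i)"
    using sum_mono_inv[of "\<lambda>i. Re (cnj w * z i)" S "\<lambda>i. cmod (cnj w * z i)" i] S i complex_Re_le_cmod
    by blast
  then have "cnj w * z i = of_real (cmod (z i))"
    using complex_eq_norm[of "cnj w * z i"] by (simp add: norm_mult w)
  then have "w * (cnj w * z i) = of_real (cmod (z i)) * w" by simp
  moreover have "w * (cnj w * z i) = (w * cnj w) * z i" by (simp only: mult_ac)
  ultimately show "z i = of_real (cmod (z i)) * sgn (sum z S)"
    by (simp add: ww) (simp add: w_def)
qed

text \<open>The moduli \<open>q\<close> of \<open>w\<close> satisfy \<open>M q \<ge> |a| q\<close>.
  Pairing with the positive left eigenvector \<open>l\<close> shows that \<open>\<rho> - |a|\<close>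
  times a positive number is nonnegative, so \<open>|a| = \<rho>\<close> and no slack remains in any
  row. One row with equality in the triangle inequality then aligns the phases of all entries of
  \<open>w\<close>.\<close>

lemma perron_peripheral:
  fixes M :: "'a \<Rightarrow> 'a \<Rightarrow> real" and w :: "'a \<Rightarrow> complex"
  assumes S: "finite S" and pos: "\<And>i j. i \<in> S \<Longrightarrow> j \<in> S \<Longrightarrow> M i j > 0"
    and l: "\<And>i. i \<in> S \<Longrightarrow> l i > 0" "\<And>j. j \<in> S \<Longrightarrow> (\<Sum>i\<in>S. l i * M i j) = \<rho> * l j"
    and w: "\<And>i. i \<in> S \<Longrightarrow> (\<Sum>j\<in>S. of_real (M i j) * w j) = a * w i"
    and nz: "\<exists>i\<in>S. w i \<noteq> 0" and a: "\<rho> \<le> cmod a"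
  shows "a = of_real \<rho> \<and> (\<exists>c p. c \<noteq> 0 \<and> (\<forall>i\<in>S. p i > 0 \<and> w i = c * of_real (p i)))"
proof -
  define q where "q i = cmod (w i)" for i
  have q0: "q i \<ge> 0" for i by (simp add: q_def)
  obtain i0 where i0: "i0 \<in> S" "q i0 > 0" using nz by (auto simp: q_def)
  have lq: "(\<Sum>i\<in>S. l i * q i) > 0"
    using S i0 l(1) q0 by (intro sum_pos2[of _ i0]) (auto simp: less_imp_le)
  define d where "d i = (\<Sum>j\<in>S. M i j * q j) - cmod a * q i" for i
  have norm_z: "cmod (of_real (M i j) * w j) = M i j * q j" if "i \<in> S" "j \<in> S" for i j
    using pos[OF that] by (simp add: norm_mult q_def)
  have d0: "d i \<ge> 0" if "i \<in> S" for i
  proof -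
    have "cmod a * q i = cmod (\<Sum>j\<in>S. of_real (M i j) * w j)"
      by (simp add: w[OF that] norm_mult q_def)
    also have "\<dots> \<le> (\<Sum>j\<in>S. cmod (of_real (M i j) * w j))" by (rule norm_sum)
    also have "\<dots> = (\<Sum>j\<in>S. M i j * q j)" using that by (intro sum.cong) (auto simp: norm_z)
    finally show ?thesis by (simp add: d_def)
  qed
  have "(\<Sum>i\<in>S. l i * (\<Sum>j\<in>S. M i j * q j)) = (\<Sum>j\<in>S. (\<Sum>i\<in>S. l i * M i j) * q j)"
    by (simp add: sum_distrib_left sum_distrib_right mult_ac) (rule sum.swap)
  also have "\<dots> = \<rho> * (\<Sum>i\<in>S. l i * q i)"
    by (simp add: l(2) sum_distrib_left mult_ac)
  finally have ld: "(\<Sum>i\<in>S. l i * d i) = (\<rho> - cmod a) * (\<Sum>i\<in>S. l i * q i)"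
    by (simp add: d_def right_diff_distrib left_diff_distrib sum_subtractf sum_distrib_left mult_ac)
  have ld0: "(\<Sum>i\<in>S. l i * d i) \<ge> 0"
    using l(1) d0 by (intro sum_nonneg) (auto simp: less_imp_le)
  have rho: "cmod a = \<rho>"
    using ld0 a lq unfolding ld by (simp add: zero_le_mult_iff)
  then have "(\<Sum>i\<in>S. l i * d i) = 0" using ld by simp
  then have "\<forall>i\<in>S. l i * d i = 0"
    using sum_nonneg_eq_0_iff[OF S, of "\<lambda>i. l i * d i"] l(1) d0 by (simp add: less_imp_le)
  then have Mq: "(\<Sum>j\<in>S. M i j * q j) = cmod a * q i" if "i \<in> S" for i
    using l(1)[OF that] that by (auto simp: d_def)
  have Mq_pos: "(\<Sum>j\<in>S. M i j * q j) > 0" if "i \<in> S" for i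
    using S i0 pos[OF that] q0 by (intro sum_pos2[of _ i0]) (auto simp: less_imp_le)
  have q_pos: "q i > 0" if "i \<in> S" for i
    using Mq[OF that] Mq_pos[OF that] q0[of i] by (auto simp: order_less_le)
  \<comment> \<open>Row \<open>i0\<close> alone fixes all phases, as its entries are positive and so
    every entry of \<open>w\<close> occurs in it.\<close>
  define s where "s = sgn (a * w i0)"
  have sums: "(\<Sum>j\<in>S. cmod (of_real (M i0 j) * w j)) = cmod a * q i0"
    using i0(1) by (simp add: Mq[symmetric] norm_z cong: sum.cong)
  have "cmod a * q i0 > 0" using Mq[OF i0(1)] Mq_pos[OF i0(1)] by simp
  then have "a * w i0 \<noteq> 0" by (auto simp: q_def)
  then have s: "s \<noteq> 0" by (simp add: s_def sgn_eq_0_iff)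
  have "cmod (\<Sum>j\<in>S. of_real (M i0 j) * w j) = (\<Sum>j\<in>S. cmod (of_real (M i0 j) * w j))"
    unfolding sums w[OF i0(1)] by (simp add: norm_mult q_def)
  then have phase: "\<forall>j\<in>S. of_real (M i0 j) * w j
      = of_real (cmod (of_real (M i0 j) * w j)) * sgn (\<Sum>j\<in>S. of_real (M i0 j) * w j)"
    using \<open>a * w i0 \<noteq> 0\<close> S w[OF i0(1)] by (intro complex_same_phase) simp_all
  have wq: "w j = s * of_real (q j)" if j: "j \<in> S" for j
  proof -
    have "of_real (M i0 j) * w j = of_real (cmod (of_real (M i0 j) * w j)) * s"
      using phase j unfolding w[OF i0(1)] s_def by blast
    then have "of_real (M i0 j) * w j = of_real (M i0 j) * (s * of_real (q j))"
      unfolding norm_z[OF i0(1) j] by (simp only: of_real_mult mult_ac)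
    moreover have "of_real (M i0 j) \<noteq> (0 :: complex)" using pos[OF i0(1) j] by simp
    ultimately show ?thesis using mult_left_cancel by blast
  qed
  have "a * (s * of_real (q i0)) = (\<Sum>j\<in>S. of_real (M i0 j) * (s * of_real (q j)))"
    using w[OF i0(1)] i0(1) by (simp add: wq cong: sum.cong)
  also have "\<dots> = s * of_real (\<Sum>j\<in>S. M i0 j * q j)"
    by (simp only: of_real_sum of_real_mult sum_distrib_left mult_ac)
  also have "\<dots> = of_real \<rho> * (s * of_real (q i0))" 
    unfolding Mq[OF i0(1)] rho by (simp only: of_real_mult mult_ac)
  finally have "a = of_real \<rho>" using s i0(2) by simp
  then show ?thesis using s q_pos wq by (intro conjI exI[of _ s] exI[of _ q]) auto
qed

lemma minor_mult:
  assumes "I \<in> ksets n k" "K \<in> ksets n k"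
    and "\<And>i j. i < n \<Longrightarrow> j < n \<Longrightarrow> Z i j = (\<Sum>l<n. X i l * Y l j)"
  shows "minor Z I K = (\<Sum>J\<in>ksets n k. minor X I J * minor Y J K)"
proof -
  have "minor Z I K = minor (\<lambda>i j. \<Sum>l<n. X i l * Y l j) I K"
    using assms by (intro minor_cong)
  then show ?thesis 
    using cauchy_binet[of I k K X Y n] ksetsD(2)[OF assms(1)] ksetsD(2)[OF assms(2)] by simp
qed

section \<open>Spectrum of a definite compound\<close>

text \<open>Entrywise form of \<open>X P = P B\<close> with \<open>P'\<close> inverse to
  \<open>P\<close> and \<open>B\<close> upper triangular: a Schur form, available also when
  \<open>X\<close> is not diagonalizable. Sums over indices, not matrix products, are what the
  Cauchy-Binet formula takes as input.\<close>

locale schur_basis =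
  fixes n :: nat and X P P' B :: "nat \<Rightarrow> nat \<Rightarrow> complex" and la :: "nat \<Rightarrow> complex"
  assumes XP: "\<And>i j. i < n \<Longrightarrow> j < n \<Longrightarrow> (\<Sum>l<n. X i l * P l j) = (\<Sum>l<n. P i l * B l j)"
    and P'X: "\<And>i j. i < n \<Longrightarrow> j < n \<Longrightarrow> (\<Sum>l<n. P' i l * X l j) = (\<Sum>l<n. B i l * P' l j)"
    and P'P: "\<And>i j. i < n \<Longrightarrow> j < n \<Longrightarrow> (\<Sum>l<n. P' i l * P l j) = (if i = j then 1 else 0)"
    and PP': "\<And>i j. i < n \<Longrightarrow> j < n \<Longrightarrow> (\<Sum>l<n. P i l * P' l j) = (if i = j then 1 else 0)"
    and triangular: "\<And>i j. j < i \<Longrightarrow> i < n \<Longrightarrow> B i j = 0"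
    and diag: "\<And>i. i < n \<Longrightarrow> B i i = la i"

text \<open>With rows and columns indexed by \<open>ksets n k\<close>,
  \<open>e * minor A I J\<close> is an entrywise positive matrix; up to the factor \<open>e\<close>
  it is triangularised by the minors of \<open>P\<close>, \<open>P'\<close> and
  \<open>B\<close>.\<close>

locale definite_compound =
  schur_basis n "\<lambda>i j. complex_of_real (A i j)" P P' B la
  for n :: nat and A :: "nat \<Rightarrow> nat \<Rightarrow> real" and P P' B :: "nat \<Rightarrow> nat \<Rightarrow> complex"
    and la :: "nat \<Rightarrow> complex" +
  fixes k :: nat and e :: real
  assumes k: "1 \<le> k" "k \<le> n"
    and e: "e \<in> {-1, 1}"
    and definite: "\<And>I J. I \<in> ksets n k \<Longrightarrow> J \<in> ksets n k \<Longrightarrow> e * minor A I J > 0"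
    and decreasing: "\<And>i j. i \<le> j \<Longrightarrow> j < n \<Longrightarrow> cmod (la j) \<le> cmod (la i)"
begin

abbreviation "S \<equiv> ksets n k"
abbreviation "M I J \<equiv> e * minor A I J"

lemma e_csq: "of_real e * (of_real e * x) = (x :: complex)"
  using e by auto

lemma S_mem: "{..<k} \<in> S" using k lessThan_kset by blast

lemma compound_AP:
  assumes "I \<in> S" "K \<in> S"
  shows "(\<Sum>J\<in>S. of_real (M I J) * minor P J K) = of_real e * (\<Sum>J\<in>S. minor P I J * minor B J K)"
proof -
  let ?Z = "\<lambda>i j. \<Sum>l<n. P i l * B l j"
  have "minor ?Z I K = (\<Sum>J\<in>S. minor (\<lambda>i j. complex_of_real (A i j)) I J * minor P J K)"
    using assms XP by (intro minor_mult) auto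
  moreover have "minor ?Z I K = (\<Sum>J\<in>S. minor P I J * minor B J K)"
    using assms by (intro minor_mult) auto
  moreover have "(\<Sum>J\<in>S. of_real (M I J) * minor P J K)
    = of_real e * (\<Sum>J\<in>S. of_real (minor A I J) * minor P J K)"
    by (simp add: sum_distrib_left mult_ac)
  ultimately show ?thesis by (simp add: minor_of_real)
qed

lemma compound_P'P:
  assumes "I \<in> S" "K \<in> S"
  shows "(\<Sum>J\<in>S. minor P' I J * minor P J K) = (if I = K then 1 else 0)"
proof -
  have "minor (\<lambda>i j. if i = j then 1 else 0 :: complex) I K = (\<Sum>J\<in>S. minor P' I J * minor P J K)"
    using assms by (intro minor_mult) (simp_all add: P'P)
  then show ?thesis unfolding minor_id[OF assms] by (rule sym)
qed

lemma compound_PP':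
  assumes "I \<in> S" "K \<in> S"
  shows "(\<Sum>J\<in>S. minor P I J * minor P' J K) = (if I = K then 1 else 0)"
proof -
  have "minor (\<lambda>i j. if i = j then 1 else 0 :: complex) I K = (\<Sum>J\<in>S. minor P I J * minor P' J K)"
    using assms by (intro minor_mult) (simp_all add: PP')
  then show ?thesis unfolding minor_id[OF assms] by (rule sym)
qed

lemma minor_B_diag:
  assumes "K \<in> S"
  shows "minor B K K = (\<Prod>j\<in>K. la j)"
proof -
  have "(\<Prod>j\<in>K. B j j) = (\<Prod>j\<in>K. la j)"
    using ksetsD(1)[OF assms] diag by (intro prod.cong) auto
  then show ?thesis using minor_triangular_diag[of n B K k] triangular assms by simp
qed

text \<open>The \<open>i\<close>-th element of \<open>K\<close> is at least \<open>i\<close>, and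
  moduli decrease with the index.\<close>

lemma norm_prod_le:
  assumes "K \<in> S"
  shows "cmod (\<Prod>j\<in>K. la j) \<le> cmod (\<Prod>j<k. la j)"
proof -
  have "cmod (\<Prod>j\<in>K. la j) = (\<Prod>i\<in>{0..<k}. cmod (la (pick K i)))"
    using prod_pick[OF assms, of "\<lambda>j. cmod (la j)"] by (simp add: prod_norm)
  also have "\<dots> \<le> (\<Prod>i\<in>{0..<k}. cmod (la i))"
  proof (rule prod_mono)
    fix i assume "i \<in> {0..<k}"
    then have "i < card K" using ksetsD(2)[OF assms] by simp
    then show "0 \<le> cmod (la (pick K i)) \<and> cmod (la (pick K i)) \<le> cmod (la i)"
      using pick_ge[of i K] pick_in_set[of i K] ksetsD(1)[OF assms] decreasing by auto
  qed
  finally show ?thesis by (simp add: prod_norm lessThan_atLeast0)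
qed

text \<open>The row vector \<open>l\<close> times the compound of \<open>P\<close> is, up to
  \<open>e\<close>, a left eigenvector \<open>z\<close> of the triangular compound of
  \<open>B\<close>. At an index set \<open>K\<close> of least element sum among those with
  \<open>z K \<noteq> 0\<close> only the diagonal term survives. So \<open>e * \<rho>\<close> is a
  product of \<open>k\<close> eigenvalues, and the first \<open>k\<close> have the product of
  largest modulus.\<close>

lemma left_perron:
  obtains \<rho> l where "\<rho> > 0" "\<And>I. I \<in> S \<Longrightarrow> l I > 0"
    "\<And>J. J \<in> S \<Longrightarrow> (\<Sum>I\<in>S. l I * M I J) = \<rho> * l J" "\<rho> \<le> cmod (\<Prod>j<k. la j)"
proof -
  have "\<exists>\<rho> l. \<rho> > 0 \<and> (\<forall>I\<in>S. l I > 0) \<and> (\<forall>J\<in>S. (\<Sum>I\<in>S. M I J * l I) = \<rho> * l J)"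
    using S_mem definite by (intro perron_exists) auto
  then obtain \<rho> l where \<rho>: "\<rho> > 0" and l: "\<And>I. I \<in> S \<Longrightarrow> l I > 0"
    "\<And>J. J \<in> S \<Longrightarrow> (\<Sum>I\<in>S. l I * M I J) = \<rho> * l J"
    by (auto simp: mult.commute)
  define z where "z K = (\<Sum>I\<in>S. of_real (l I) * minor P I K)" for K
  have "\<exists>K. K \<in> S \<and> z K \<noteq> 0"
  proof (rule ccontr)
    assume "\<not> ?thesis"
    then have "0 = (\<Sum>K\<in>S. z K * minor P' K {..<k})" by simp
    also have "\<dots> = (\<Sum>I\<in>S. of_real (l I) * (\<Sum>K\<in>S. minor P I K * minor P' K {..<k}))"
      unfolding z_def sum_distrib_left sum_distrib_right by (subst sum.swap) (simp add: mult_ac)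
    also have "\<dots> = of_real (l {..<k})"
      using S_mem by (simp add: compound_PP' if_distrib[of "\<lambda>x. _ * x"] sum.delta cong: sum.cong if_cong)
    finally show False using l(1)[OF S_mem] by simp
  qed
  then obtain K where K: "K \<in> S" "z K \<noteq> 0" and least: "\<And>J. J \<in> S \<Longrightarrow> z J \<noteq> 0 \<Longrightarrow> \<Sum>K \<le> \<Sum>J"
    using ex_has_least_nat[of "\<lambda>K. K \<in> S \<and> z K \<noteq> 0" _ "\<lambda>K. \<Sum>K"] by blast
  have "(\<Sum>J\<in>S. z J * minor B J K) = (\<Sum>I\<in>S. of_real (l I) * (\<Sum>J\<in>S. minor P I J * minor B J K))"
    unfolding z_def sum_distrib_left sum_distrib_right by (subst sum.swap) (simp add: mult_ac)
  also have "\<dots> = (\<Sum>I\<in>S. of_real (l I) * (of_real e * (\<Sum>J\<in>S. of_real (M I J) * minor P J K)))"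
    using K(1) by (simp only: compound_AP e_csq cong: sum.cong)
  also have "\<dots> = of_real e * (\<Sum>J\<in>S. of_real (\<Sum>I\<in>S. l I * M I J) * minor P J K)"
    unfolding sum_distrib_left of_real_sum sum_distrib_right by (subst sum.swap) (simp add: mult_ac)
  also have "\<dots> = of_real e * (\<Sum>J\<in>S. of_real (\<rho> * l J) * minor P J K)"
    by (simp only: l(2) cong: sum.cong)
  also have "\<dots> = of_real (e * \<rho>) * z K"
    by (simp add: z_def sum_distrib_left mult_ac)
  finally have "(\<Sum>J\<in>S. z J * minor B J K) = of_real (e * \<rho>) * z K" .
  moreover have "(\<Sum>J\<in>S. z J * minor B J K) = z K * minor B K K"
  proof -
    have "z J * minor B J K = 0" if "J \<in> S" "J \<noteq> K" for J
      using minor_triangular[of n B J k K] triangular that K(1) least[of J] by force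
    then have "(\<Sum>J\<in>S - {K}. z J * minor B J K) = 0" by (intro sum.neutral) blast
    then show ?thesis using K(1) by (simp add: sum.remove[of S K])
  qed
  ultimately have "of_real (e * \<rho>) = (\<Prod>j\<in>K. la j)"
    using K minor_B_diag[OF K(1)] by simp
  then have "cmod (of_real (e * \<rho>)) \<le> cmod (\<Prod>j<k. la j)" using norm_prod_le[OF K(1)] by simp
  then have "\<rho> \<le> cmod (\<Prod>j<k. la j)"
    using e \<rho> by (auto simp: norm_mult)
  then show thesis using that \<rho> l by blast
qed

text \<open>No other index set has so small an element sum as \<open>{..<k}\<close>, so its column
  in the compound of \<open>B\<close> has only the diagonal entry. The eigenvector consists of the
  Pluecker coordinates of the first \<open>k\<close> columns of \<open>P\<close>.\<close>

lemma leading_eigenvector: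
  assumes "I \<in> S"
  shows "(\<Sum>J\<in>S. of_real (M I J) * minor P J {..<k}) = of_real e * (\<Prod>j<k. la j) * minor P I {..<k}"
proof -
  have "minor P I J * minor B J {..<k} = 0" if "J \<in> S" "J \<noteq> {..<k}" for J
    using minor_triangular[of n B J k "{..<k}"] triangular that S_mem sum_kset_ge[of J n k] by force
  then have "(\<Sum>J\<in>S - {{..<k}}. minor P I J * minor B J {..<k}) = 0" by (intro sum.neutral) blast
  then have "(\<Sum>J\<in>S. minor P I J * minor B J {..<k}) = minor P I {..<k} * minor B {..<k} {..<k}"
    using S_mem by (simp add: sum.remove[of S "{..<k}"])
  then show ?thesis using compound_AP[OF assms S_mem] minor_B_diag[OF S_mem] by simp
qed

lemma leading_nonzero: "\<exists>J\<in>S. minor P J {..<k} \<noteq> 0"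
proof (rule ccontr)
  assume "\<not> ?thesis"
  then have "(\<Sum>J\<in>S. minor P' {..<k} J * minor P J {..<k}) = 0" by simp
  then show False using compound_P'P[OF S_mem S_mem] by simp
qed

text \<open>The Perron root is at most the modulus of the leading product, so the vector of leading
  minors is peripheral: its eigenvalue is the Perron root itself and its entries have one
  phase.\<close>

lemma leading_prod_and_minors:
  shows "\<exists>\<rho>>0. (\<Prod>j<k. la j) = of_real (e * \<rho>)"
    and "\<exists>c p. c \<noteq> 0 \<and> (\<forall>I\<in>S. p I > 0 \<and> minor P I {..<k} = c * of_real (p I))"
proof -
  obtain \<rho> l where \<rho>: "\<rho> > 0" "\<And>I. I \<in> S \<Longrightarrow> l I > 0"
    "\<And>J. J \<in> S \<Longrightarrow> (\<Sum>I\<in>S. l I * M I J) = \<rho> * l J" "\<rho> \<le> cmod (\<Prod>j<k. la j)"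
    using left_perron by blast
  have "\<rho> \<le> cmod (of_real e * (\<Prod>j<k. la j))" using \<rho>(4) e by (auto simp: norm_mult)
  from perron_peripheral[OF finite_ksets definite \<rho>(2,3) leading_eigenvector leading_nonzero this]
  have *: "of_real e * (\<Prod>j<k. la j) = of_real \<rho>"
    "\<exists>c p. c \<noteq> 0 \<and> (\<forall>I\<in>S. p I > 0 \<and> minor P I {..<k} = c * of_real (p I))" by auto
  then show "\<exists>c p. c \<noteq> 0 \<and> (\<forall>I\<in>S. p I > 0 \<and> minor P I {..<k} = c * of_real (p I))" by blast
  have "(\<Prod>j<k. la j) = of_real e * of_real \<rho>"
    unfolding *(1)[symmetric] by (simp only: e_csq)
  then show "\<exists>\<rho>>0. (\<Prod>j<k. la j) = of_real (e * \<rho>)" using \<rho>(1) by auto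
qed

text \<open>Indices of \<open>la\<close> start at 0, so the gap lies between the \<open>k\<close>-th
  eigenvalue and the next. Without it, exchanging \<open>k - 1\<close> for \<open>k\<close> in
  \<open>{..<k}\<close> gives an index set \<open>I1\<close> whose product has the same modulus. Its
  column \<open>w1\<close> is an eigenvector only up to a multiple of the leading one,
  \<open>w0\<close>, as in a Jordan block. Corrected by a multiple of \<open>w0\<close> so that the
  left Perron vector annihilates it, it becomes a true peripheral eigenvector; but such a vector has
  entries of one phase and cannot be annihilated.\<close>

lemma spectral_gap:
  assumes kn: "k < n"
  shows "cmod (la k) < cmod (la (k - 1))"
proof (rule ccontr)
  assume "\<not> ?thesis"
  then have same: "cmod (la k) = cmod (la (k - 1))" using decreasing[of "k - 1" k] kn by simp
  obtain \<rho> l where \<rho>: "\<rho> > 0" "\<And>I. I \<in> S \<Longrightarrow> l I > 0"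
    "\<And>J. J \<in> S \<Longrightarrow> (\<Sum>I\<in>S. l I * M I J) = \<rho> * l J" "\<rho> \<le> cmod (\<Prod>j<k. la j)"
    using left_perron by blast
  define I0 where "I0 = {..<k}"
  define I1 where "I1 = insert k {..<k - 1}"
  define w0 where "w0 I = minor P I I0" for I
  define w1 where "w1 I = minor P I I1" for I
  define a where "a = of_real e * (\<Prod>j<k. la j)"
  define b where "b = of_real e * (\<Prod>j\<in>I1. la j)"
  define \<beta> where "\<beta> = of_real e * minor B I0 I1"
  have I0: "I0 \<in> S" using S_mem by (simp add: I0_def)
  have I1: "I1 \<in> S" using kn k(1) by (auto simp: ksets_def I1_def)
  have I0': "I0 = insert (k - 1) {..<k - 1}" using k(1) by (auto simp: I0_def)
  have sum_I1: "\<Sum>I1 = Suc (\<Sum>I0)"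
    using k(1) by (simp add: I0' I1_def)
  have ne: "I0 \<noteq> I1" using sum_I1 by auto
  have "cmod (\<Prod>j\<in>I1. la j) = cmod (\<Prod>j\<in>I0. la j)"
    using k(1) same by (simp add: I0' I1_def norm_mult)
  then have b: "\<rho> \<le> cmod b" using \<rho>(4) e by (auto simp: b_def I0_def norm_mult)
  have a0: "\<rho> \<le> cmod a" using \<rho>(4) e by (auto simp: a_def norm_mult)
  have Mw0: "(\<Sum>J\<in>S. of_real (M I J) * w0 J) = a * w0 I" if "I \<in> S" for I
    using leading_eigenvector[OF that] by (simp add: w0_def I0_def a_def)
  have "\<exists>J\<in>S. w0 J \<noteq> 0" using leading_nonzero by (simp add: w0_def I0_def)
  from perron_peripheral[OF finite_ksets definite \<rho>(2,3) Mw0 this a0]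
  obtain c0 p0 where a: "a = of_real \<rho>" and c0: "c0 \<noteq> 0" "\<And>I. I \<in> S \<Longrightarrow> p0 I > 0"
    "\<And>I. I \<in> S \<Longrightarrow> w0 I = c0 * of_real (p0 I)" by blast
  have Mw1: "(\<Sum>J\<in>S. of_real (M I J) * w1 J) = b * w1 I + \<beta> * w0 I" if "I \<in> S" for I
  proof -
    \<comment> \<open>\<open>\<Sum>I1\<close> exceeds the minimum \<open>\<Sum>I0\<close> by one, so
      \<open>I0\<close> is the only index set strictly below \<open>I1\<close>.\<close>
    have "minor P I J * minor B J I1 = 0" if "J \<in> S - {I1} - {I0}" for J
    proof (rule ccontr)
      assume "minor P I J * minor B J I1 \<noteq> 0"
      then have "\<Sum>J \<le> \<Sum>I0"
        using minor_triangular[of n B J k I1] triangular that I1 sum_I1 by auto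
      then show False using that sum_kset_eq[of J n k] by (auto simp: I0_def)
    qed
    then have "(\<Sum>J\<in>S - {I1} - {I0}. minor P I J * minor B J I1) = 0" by (intro sum.neutral) blast
    then have "(\<Sum>J\<in>S. minor P I J * minor B J I1)
      = minor P I I1 * minor B I1 I1 + minor P I I0 * minor B I0 I1"
      using I0 I1 ne by (simp add: sum.remove[of S I1] sum.remove[of "S - {I1}" I0])
    then show ?thesis
      using compound_AP[OF that I1] minor_B_diag[OF I1]
      by (simp add: w0_def w1_def b_def \<beta>_def algebra_simps)
  qed
  define L where "L w = (\<Sum>I\<in>S. of_real (l I) * w I)" for w :: "nat set \<Rightarrow> complex"
  have LM: "L (\<lambda>I. \<Sum>J\<in>S. of_real (M I J) * w J) = of_real \<rho> * L w" for w
  proof -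
    have "L (\<lambda>I. \<Sum>J\<in>S. of_real (M I J) * w J) = (\<Sum>J\<in>S. of_real (\<Sum>I\<in>S. l I * M I J) * w J)"
      unfolding L_def sum_distrib_left of_real_sum sum_distrib_right
      by (subst sum.swap) (simp add: mult_ac)
    also have "\<dots> = (\<Sum>J\<in>S. of_real (\<rho> * l J) * w J)"
      by (simp only: \<rho>(3) cong: sum.cong)
    finally show ?thesis by (simp add: L_def sum_distrib_left mult_ac)
  qed
  have Lpos: "L w \<noteq> 0" if "c \<noteq> 0" "\<And>I. I \<in> S \<Longrightarrow> p I > 0" "\<And>I. I \<in> S \<Longrightarrow> w I = c * of_real (p I)" for w c p
  proof -
    define x where "x = (\<Sum>I\<in>S. l I * p I)"
    have "x > 0" unfolding x_def
      using \<rho>(2) that(2) S_mem by (intro sum_pos) auto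
    moreover have "L w = c * of_real x"
      by (simp add: L_def x_def that(3) sum_distrib_left mult_ac cong: sum.cong)
    ultimately show ?thesis using that(1) by simp
  qed
  \<comment> \<open>The coefficient that makes \<open>L w = 0\<close>; the denominator is nonzero
    because \<open>w0\<close> has entries of one phase.\<close>
  define t where "t = L w1 / L w0"
  define w where "w I = w1 I - t * w0 I" for I
  define \<beta>' where "\<beta>' = \<beta> + b * t - a * t"
  have Lw0: "L w0 \<noteq> 0" using Lpos[of c0 p0 w0] c0 by blast
  have "L w = L w1 - t * L w0"
    by (simp add: L_def w_def right_diff_distrib sum_subtractf sum_distrib_left mult_ac)
  then have Lw: "L w = 0" using Lw0 by (simp add: t_def)
  have Mw: "(\<Sum>J\<in>S. of_real (M I J) * w J) = b * w I + \<beta>' * w0 I" if "I \<in> S" for I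
  proof -
    have "(\<Sum>J\<in>S. of_real (M I J) * w J)
      = (\<Sum>J\<in>S. of_real (M I J) * w1 J) - t * (\<Sum>J\<in>S. of_real (M I J) * w0 J)"
      unfolding w_def right_diff_distrib sum_subtractf sum_distrib_left
      by (simp add: mult_ac)
    then show ?thesis
      unfolding Mw1[OF that] Mw0[OF that] by (simp add: w_def \<beta>'_def algebra_simps)
  qed
  \<comment> \<open>As \<open>l\<close> is a left eigenvector and \<open>L w = 0\<close>, only
    \<open>\<beta>' * L w0\<close> remains on the right, so the coupling term
    \<open>\<beta>'\<close> vanishes.\<close>
  have "0 = L (\<lambda>I. \<Sum>J\<in>S. of_real (M I J) * w J)" using LM[of w] Lw by simp
  also have "\<dots> = b * L w + \<beta>' * L w0"
    using Mw by (simp add: L_def algebra_simps sum.distrib sum_distrib_left cong: sum.cong)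
  finally have "\<beta>' = 0" using Lw Lw0 by simp
  then have Mw': "(\<Sum>J\<in>S. of_real (M I J) * w J) = b * w I" if "I \<in> S" for I
    using Mw[OF that] by simp
  \<comment> \<open>Row \<open>I1\<close> of the inverse compound reads off the coefficient 1 of
    \<open>w1\<close> in \<open>w\<close>.\<close>
  have "\<exists>I\<in>S. w I \<noteq> 0"
  proof (rule ccontr)
    assume "\<not> ?thesis"
    then have "0 = (\<Sum>J\<in>S. minor P' I1 J * w J)" by simp
    also have "\<dots> = (\<Sum>J\<in>S. minor P' I1 J * w1 J) - t * (\<Sum>J\<in>S. minor P' I1 J * w0 J)"
      by (simp add: w_def right_diff_distrib sum_subtractf sum_distrib_left mult_ac)
    also have "\<dots> = 1"
      using compound_P'P[OF I1 I1] compound_P'P[OF I1 I0] ne by (simp add: w0_def w1_def)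
    finally show False by simp
  qed
  then have "\<exists>c p. c \<noteq> 0 \<and> (\<forall>I\<in>S. p I > 0 \<and> w I = c * of_real (p I))"
    by (intro conjunct2[OF perron_peripheral[OF finite_ksets definite \<rho>(2,3) Mw' _ b]])
  then obtain c p where c: "c \<noteq> 0" and p: "\<forall>I\<in>S. p I > 0 \<and> w I = c * of_real (p I)"
    by (elim exE conjE)
  have "L w \<noteq> 0"
    by (rule Lpos[OF c, of p]) (use p in blast)+
  with Lw show False by contradiction
qed

end

section \<open>Sign variations and minors\<close>

text \<open>The positions are kept, not only their number: they supply the row sets from which
  vectors with a prescribed sign pattern are built.\<close>

definition sign_changes :: "real list \<Rightarrow> nat set" where
  "sign_changes xs = {i. Suc i < length xs \<and> xs ! i * xs ! Suc i < 0}"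

lemma sign_variations_eq: "sign_variations xs = card (sign_changes xs)"
  by (simp add: sign_variations_def sign_changes_def)

lemma sign_changes_subset: "sign_changes xs \<subseteq> {..<length xs - 1}"
  by (auto simp: sign_changes_def)

lemma finite_sign_changes [simp]: "finite (sign_changes xs)"
  using sign_changes_subset finite_subset by blast

text \<open>Each change passed flips the sign once. In this form a sign pattern can be matched with
  the signs of a Laplace expansion.\<close>

lemma sgn_nth_sign_changes:
  assumes nz: "\<And>i. i < length xs \<Longrightarrow> xs ! i \<noteq> 0" and i: "i < length xs"
  shows "sgn (xs ! i) = sgn (xs ! 0) * (-1) ^ card {c \<in> sign_changes xs. c < i}"
  using i
proof (induction i)
  case (Suc i)
  show ?case
  proof (cases "i \<in> sign_changes xs")
    case True
    then have "{c \<in> sign_changes xs. c < Suc i} = insert i {c \<in> sign_changes xs. c < i}"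
      by (auto simp: less_Suc_eq)
    moreover have "sgn (xs ! Suc i) = - sgn (xs ! i)"
      using True by (auto simp: sign_changes_def mult_less_0_iff)
    ultimately show ?thesis using Suc by simp
  next
    case False
    then have "{c \<in> sign_changes xs. c < Suc i} = {c \<in> sign_changes xs. c < i}"
      by (auto simp: less_Suc_eq)
    moreover have "sgn (xs ! Suc i) = sgn (xs ! i)"
      using False Suc.prems nz[of i] nz[of "Suc i"]
      by (auto simp: sign_changes_def mult_less_0_iff sgn_if)
    ultimately show ?thesis using Suc by simp
  qed
qed simp

lemma sign_variations_Cons_Cons:
  "sign_variations (x # y # ys) = of_bool (x * y < 0) + sign_variations (y # ys)"
proof -
  have "sign_changes (x # y # ys) = (if x * y < 0 then {0} else {}) \<union> Suc ` sign_changes (y # ys)"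
  proof (rule Set.set_eqI)
    fix i show "i \<in> sign_changes (x # y # ys)
      \<longleftrightarrow> i \<in> (if x * y < 0 then {0} else {}) \<union> Suc ` sign_changes (y # ys)"
      by (cases i) (auto simp: sign_changes_def image_iff)
  qed
  then show ?thesis
    by (auto simp: sign_variations_eq card_image)
qed

lemma sign_variations_Cons:
  assumes "xs \<noteq> []"
  shows "sign_variations (x # xs) = of_bool (x * hd xs < 0) + sign_variations xs"
  using assms by (cases xs) (simp_all add: sign_variations_Cons_Cons)

text \<open>Each zero takes the value of the next nonzero entry, and trailing zeros that of the last
  nonzero one; hence a sign change never occurs at or behind the last nonzero entry.\<close>

lemma fill_zeros:
  fixes xs :: "real list"
  assumes "filter (\<lambda>x. x \<noteq> 0) xs \<noteq> []"
  shows "\<exists>zs. length zs = length xs \<and> (\<forall>i<length xs. zs ! i \<noteq> 0)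
    \<and> (\<forall>i<length xs. xs ! i \<noteq> 0 \<longrightarrow> zs ! i = xs ! i)
    \<and> sign_variations zs = sign_variations (filter (\<lambda>x. x \<noteq> 0) xs)
    \<and> hd zs = hd (filter (\<lambda>x. x \<noteq> 0) xs)
    \<and> (\<forall>i\<in>sign_changes zs. \<exists>j>i. j < length xs \<and> xs ! j \<noteq> 0)"
  using assms
proof (induction xs)
  case (Cons x xs)
  show ?case
  proof (cases "filter (\<lambda>x. x \<noteq> 0) xs = []")
    case True
    then have x: "x \<noteq> 0" using Cons.prems by auto
    have "\<forall>y\<in>set xs. y = 0" using True by (simp add: filter_empty_conv)
    moreover have "sign_changes (replicate m x) = {}" for m
      by (auto simp: sign_changes_def not_square_less_zero)
    ultimately show ?thesis
      using True x
      by (intro exI[of _ "replicate (Suc (length xs)) x"])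
        (auto simp: sign_variations_eq nth_Cons' sign_changes_def simp del: replicate_Suc)
  next
    case False
    then obtain zs where zs: "length zs = length xs" "\<forall>i<length xs. zs ! i \<noteq> 0"
      "\<forall>i<length xs. xs ! i \<noteq> 0 \<longrightarrow> zs ! i = xs ! i"
      "sign_variations zs = sign_variations (filter (\<lambda>x. x \<noteq> 0) xs)"
      "hd zs = hd (filter (\<lambda>x. x \<noteq> 0) xs)"
      "\<forall>i\<in>sign_changes zs. \<exists>j>i. j < length xs \<and> xs ! j \<noteq> 0"
      using Cons.IH by blast
    have ne: "zs \<noteq> []" using False zs(1) by auto
    define z where "z = (if x = 0 then hd zs else x)"
    have "0 < length xs" using zs(1) ne by (cases xs) auto
    then have "z \<noteq> 0" using zs(2) ne by (auto simp: z_def hd_conv_nth)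
    have "\<forall>i\<in>sign_changes (z # zs). \<exists>j>i. j < length (x # xs) \<and> (x # xs) ! j \<noteq> 0"
    proof
      fix i assume i: "i \<in> sign_changes (z # zs)"
      show "\<exists>j>i. j < length (x # xs) \<and> (x # xs) ! j \<noteq> 0"
      proof (cases i)
        case 0
        from False obtain y where "y \<in> set xs" "y \<noteq> 0" by (auto simp: filter_empty_conv)
        then obtain j where "j < length xs" "xs ! j \<noteq> 0" by (auto simp: in_set_conv_nth)
        then show ?thesis using 0 by (intro exI[of _ "Suc j"]) simp
      next
        case (Suc m)
        then have "m \<in> sign_changes zs" using i by (auto simp: sign_changes_def)
        then obtain j where "j > m" "j < length xs" "xs ! j \<noteq> 0" using zs(6) by blast
        then show ?thesis using Suc by (intro exI[of _ "Suc j"]) simp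
      qed
    qed
    moreover have "sign_variations (z # zs) = sign_variations (filter (\<lambda>x. x \<noteq> 0) (x # xs))"
      using zs(4,5) ne False by (auto simp: sign_variations_Cons z_def not_less)
    moreover have "hd (z # zs) = hd (filter (\<lambda>x. x \<noteq> 0) (x # xs))"
      using zs(5) by (simp add: z_def)
    moreover have "\<forall>i<length (x # xs). (z # zs) ! i \<noteq> 0"
      using zs(1,2) \<open>z \<noteq> 0\<close> by (auto simp: nth_Cons')
    moreover have "\<forall>i<length (x # xs). (x # xs) ! i \<noteq> 0 \<longrightarrow> (z # zs) ! i = (x # xs) ! i"
      using zs(3) by (auto simp: nth_Cons' z_def)
    moreover have "length (z # zs) = length (x # xs)" using zs(1) by simp
    ultimately show ?thesis by blast
  qed
qed simp

section \<open>Expansion along a variable row and orthogonality to the columns\<close>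

lemma det_zero_kernel:
  fixes f :: "nat \<Rightarrow> nat \<Rightarrow> 'a :: idom"
  assumes "\<And>i. i < m \<Longrightarrow> (\<Sum>j<m. f i j * g j) = 0" "j < m" "g j \<noteq> 0"
  shows "det (mat m m (\<lambda>(i, j). f i j)) = 0"
proof -
  have "mat m m (\<lambda>(i, j). f i j) *\<^sub>v vec m g = 0\<^sub>v m"
    using assms(1) by (intro eq_vecI) (auto simp: scalar_prod_def lessThan_atLeast0)
  moreover have "vec m g \<noteq> 0\<^sub>v m" using assms(2,3) by (metis index_vec index_zero_vec(1))
  ultimately show ?thesis
    by (subst det_0_iff_vec_prod_zero[of _ m]) (auto intro!: exI[of _ "vec m g"])
qed

text \<open>Inserting \<open>i\<close> raises the rank of exactly the larger elements by one, which
  is how \<open>insert_index\<close> skips the rank of \<open>i\<close>.\<close>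

lemma pick_insert:
  assumes "finite Z" "i \<notin> Z" "a < card Z"
  shows "pick (insert i Z) (insert_index (card {z \<in> Z. z < i}) a) = pick Z a"
proof -
  define e where "e = pick Z a"
  have e: "e \<in> Z" "card {z \<in> Z. z < e} = a"
    using assms pick_in_set[of a Z] card_pick[of a Z] by (auto simp: e_def)
  have "card {z \<in> insert i Z. z < e} = insert_index (card {z \<in> Z. z < i}) a"
  proof (cases "i < e")
    case True
    then have "{z \<in> insert i Z. z < e} = insert i {z \<in> Z. z < e}" by auto
    then have "card {z \<in> insert i Z. z < e} = Suc a" using e assms by simp
    moreover have "card {z \<in> Z. z < i} \<le> a"
      unfolding e(2)[symmetric] using True assms by (intro card_mono) auto
    ultimately show ?thesis by (simp add: insert_index_def)
  next
    case False
    then have "e < i" using e assms by (cases "e = i") auto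
    then have "{z \<in> insert i Z. z < e} = {z \<in> Z. z < e}" by auto
    moreover have "a < card {z \<in> Z. z < i}"
      unfolding e(2)[symmetric] using \<open>e < i\<close> assms e by (intro psubset_card_mono) auto
    ultimately show ?thesis using e by (simp add: insert_index_def)
  qed
  then show ?thesis using pick_card_in_set[of e "insert i Z"] e by (simp add: e_def)
qed

lemma pick_insert_self:
  assumes "i \<notin> Z"
  shows "pick (insert i Z) (card {z \<in> Z. z < i}) = i"
proof -
  have "{z \<in> insert i Z. z < i} = {z \<in> Z. z < i}" by auto
  then show ?thesis using pick_card_in_set[of i "insert i Z"] by simp
qed

text \<open>The linear functional obtained by expanding along a variable row in front of the rows \<open>Z\<close>.\<close>

definition row_expansion :: "(nat \<Rightarrow> nat \<Rightarrow> 'a :: comm_ring_1) \<Rightarrow> nat set \<Rightarrow> nat \<Rightarrow> 'a" where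
  "row_expansion F Z i = (\<Sum>j<Suc (card Z). F i j * ((-1) ^ j *
     det (mat (card Z) (card Z) (\<lambda>(a, b). F (pick Z a) (insert_index j b)))))"

text \<open>The value is the determinant of a matrix in which row \<open>i\<close> occurs twice,
  once in front and once among the rows \<open>Z\<close>.\<close>

lemma row_expansion_mem:
  fixes F :: "nat \<Rightarrow> nat \<Rightarrow> 'a :: comm_ring_1"
  assumes "i \<in> Z" "finite Z"
  shows "row_expansion F Z i = 0"
proof -
  let ?m = "card Z"
  let ?N = "mat (Suc ?m) (Suc ?m) (\<lambda>(a, b). F (if a = 0 then i else pick Z (a - 1)) b)"
  have r: "card {z \<in> Z. z < i} < ?m" using assms by (intro psubset_card_mono) auto
  have "det ?N = 0"
  proof (rule det_identical_rows[of _ "Suc ?m" 0 "Suc (card {z \<in> Z. z < i})"])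
    show "row ?N 0 = row ?N (Suc (card {z \<in> Z. z < i}))"
      using r assms pick_card_in_set[of i Z] by (intro eq_vecI) auto
  qed (use r in auto)
  moreover have "det ?N = (\<Sum>j<Suc ?m. ?N $$ (0, j) * cofactor ?N 0 j)"
    by (rule laplace_expansion_row) auto
  moreover have "\<dots> = row_expansion F Z i"
    unfolding row_expansion_def
  proof (rule sum.cong[OF refl])
    fix j assume j: "j \<in> {..<Suc ?m}"
    have "mat_delete ?N 0 j = mat ?m ?m (\<lambda>(a, b). F (pick Z a) (insert_index j b))"
      using j by (intro eq_matI) (auto simp: mat_delete_def insert_index_def)
    then show "?N $$ (0, j) * cofactor ?N 0 j = F i j * ((-1) ^ j *
      det (mat ?m ?m (\<lambda>(a, b). F (pick Z a) (insert_index j b))))"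
      using j by (simp add: cofactor_def)
  qed
  ultimately show ?thesis by simp
qed

text \<open>The sign is that of moving row \<open>i\<close> from the front to its sorted place, past
  the smaller elements of \<open>Z\<close>. The Laplace expansion of the sorted minor along that row
  has the same terms up to this sign.\<close>

lemma row_expansion_not_mem:
  fixes F :: "nat \<Rightarrow> nat \<Rightarrow> 'a :: comm_ring_1"
  assumes i: "i \<notin> Z" and Z: "finite Z"
  shows "row_expansion F Z i = (-1) ^ card {z \<in> Z. z < i} * minor F (insert i Z) {..<Suc (card Z)}"
proof -
  let ?m = "card Z" and ?r = "card {z \<in> Z. z < i}"
  let ?N = "mat (Suc ?m) (Suc ?m) (\<lambda>(a, b). F (pick (insert i Z) a) b)"
  have r: "?r < Suc ?m" using Z by (simp add: less_Suc_eq_le card_mono)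
  have minor: "minor F (insert i Z) {..<Suc ?m} = det ?N"
    unfolding minor_def using i Z
    by (intro arg_cong[where f = det] eq_matI) (auto simp: pick_lessThan simp del: pick.simps)
  have "det ?N = (\<Sum>j<Suc ?m. ?N $$ (?r, j) * cofactor ?N ?r j)"
    by (rule laplace_expansion_row) (use r in auto)
  also have "\<dots> = (\<Sum>j<Suc ?m. (-1) ^ ?r * (F i j * ((-1) ^ j *
     det (mat ?m ?m (\<lambda>(a, b). F (pick Z a) (insert_index j b))))))"
  proof (rule sum.cong[OF refl])
    fix j assume j: "j \<in> {..<Suc ?m}"
    have "mat_delete ?N ?r j = mat ?m ?m (\<lambda>(a, b). F (pick Z a) (insert_index j b))"
    proof (rule eq_matI)
      fix a b assume ab: "a < dim_row (mat ?m ?m (\<lambda>(a, b). F (pick Z a) (insert_index j b)))"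
        "b < dim_col (mat ?m ?m (\<lambda>(a, b). F (pick Z a) (insert_index j b)))"
      then have "mat_delete ?N ?r j $$ (a, b) = ?N $$ (insert_index ?r a, insert_index j b)"
        using r j by (subst mat_delete_index[of _ ?m, symmetric]) auto
      also have "\<dots> = F (pick (insert i Z) (insert_index ?r a)) (insert_index j b)"
        using ab by (simp add: insert_index_def del: pick.simps)
      finally show "mat_delete ?N ?r j $$ (a, b) = mat ?m ?m (\<lambda>(a, b). F (pick Z a) (insert_index j b)) $$ (a, b)"
        using pick_insert[OF Z i, of a] ab by simp
    qed auto
    then show "?N $$ (?r, j) * cofactor ?N ?r j = (-1) ^ ?r * (F i j * ((-1) ^ j *
      det (mat ?m ?m (\<lambda>(a, b). F (pick Z a) (insert_index j b)))))"
      using j r pick_insert_self[OF i] by (simp add: cofactor_def power_add mult_ac del: pick.simps)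
  qed
  also have "\<dots> = (-1) ^ ?r * row_expansion F Z i"
    by (simp only: row_expansion_def sum_distrib_left)
  finally have "det ?N = (-1) ^ ?r * row_expansion F Z i" .
  moreover have "(-1) ^ ?r * ((-1) ^ ?r * row_expansion F Z i) = row_expansion F Z i"
    by (simp add: mult.assoc[symmetric] power_add[symmetric])
  ultimately show ?thesis unfolding minor by simp
qed

text \<open>A new element affects the required sign at larger indices only. Adding the largest
  remaining index therefore changes nothing for the others; if that index is the protected
  \<open>i0\<close>, the smallest is added, which flips all remaining signs and is compensated by
  \<open>- \<sigma>\<close>.\<close>

lemma extend_sign_pattern:
  fixes y :: "nat \<Rightarrow> real"
  assumes "Z \<subseteq> {..<n}" "i0 < n" "i0 \<notin> Z" "\<sigma> \<noteq> 0"
    and "\<And>i. i < n \<Longrightarrow> i \<notin> Z \<Longrightarrow> \<sigma> * (-1) ^ card {z \<in> Z. z < i} * y i \<ge> 0"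
    and "card Z \<le> m" "m < n"
  shows "\<exists>Z' \<sigma>'. Z' \<subseteq> {..<n} \<and> card Z' = m \<and> i0 \<notin> Z' \<and> \<sigma>' \<noteq> 0 \<and>
    (\<forall>i<n. i \<notin> Z' \<longrightarrow> \<sigma>' * (-1) ^ card {z \<in> Z'. z < i} * y i \<ge> 0)"
  using assms
proof (induction "m - card Z" arbitrary: Z \<sigma>)
  case 0
  then show ?case by (intro exI[of _ Z] exI[of _ \<sigma>]) auto
next
  case (Suc d)
  have finZ: "finite Z" using Suc.prems(1) finite_subset by blast
  define R where "R = {..<n} - Z"
  have R: "finite R" "i0 \<in> R" using Suc.prems by (auto simp: R_def)
  then have "R \<noteq> {}" by blast
  have "card R = n - card Z" unfolding R_def using Suc.prems(1) finZ by (simp add: card_Diff_subset)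
  \<comment> \<open>\<open>card Z < m < n\<close> leaves at least two indices, hence one besides
    \<open>i0\<close>.\<close>
  then have "card R > 1" using Suc.hyps(2) Suc.prems by linarith
  then have "\<not> R \<subseteq> {i0}" using card_mono[of "{i0}" R] by auto
  then obtain j where j: "j \<in> R" "j \<noteq> i0" by blast
  have "\<exists>a \<sigma>'. a \<in> R \<and> a \<noteq> i0 \<and> \<sigma>' \<noteq> 0 \<and>
    (\<forall>i<n. i \<notin> insert a Z \<longrightarrow> \<sigma>' * (-1) ^ card {z \<in> insert a Z. z < i} * y i \<ge> 0)"
  proof (cases "Max R = i0")
    case False
    define a where "a = Max R"
    have a: "a \<in> R" "\<And>i. i \<in> R \<Longrightarrow> i \<le> a" using R \<open>R \<noteq> {}\<close> by (auto simp: a_def)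
    have "\<sigma> * (-1) ^ card {z \<in> insert a Z. z < i} * y i \<ge> 0" if "i < n" "i \<notin> insert a Z" for i
    proof -
      have "i \<le> a" using that a(2)[of i] by (auto simp: R_def)
      then have "{z \<in> insert a Z. z < i} = {z \<in> Z. z < i}" by auto
      then show ?thesis using Suc.prems(5)[of i] that by simp
    qed
    then show ?thesis using a(1) False Suc.prems(4) a_def by blast
  next
    case True
    define a where "a = Min R"
    have a: "a \<in> R" "\<And>i. i \<in> R \<Longrightarrow> a \<le> i" using R \<open>R \<noteq> {}\<close> by (auto simp: a_def)
    have "a \<le> j" "j \<le> i0" using a(2)[OF j(1)] Max_ge[OF R(1) j(1)] True by auto
    then have "a \<noteq> i0" using j(2) by auto
    have "- \<sigma> * (-1) ^ card {z \<in> insert a Z. z < i} * y i \<ge> 0" if "i < n" "i \<notin> insert a Z" for i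
    proof -
      have "a < i" using that a(2)[of i] by (auto simp: R_def order_less_le)
      then have "{z \<in> insert a Z. z < i} = insert a {z \<in> Z. z < i}" by auto
      moreover have "a \<notin> {z \<in> Z. z < i}" using a(1) by (auto simp: R_def)
      ultimately show ?thesis using Suc.prems(5)[of i] that finZ by simp
    qed
    then show ?thesis using a(1) \<open>a \<noteq> i0\<close> Suc.prems(4) by (intro exI[of _ a] exI[of _ "- \<sigma>"]) auto
  qed
  then obtain a \<sigma>' where a: "a \<in> R" "a \<noteq> i0" "\<sigma>' \<noteq> 0"
    "\<forall>i<n. i \<notin> insert a Z \<longrightarrow> \<sigma>' * (-1) ^ card {z \<in> insert a Z. z < i} * y i \<ge> 0" by blast
  have "card (insert a Z) = Suc (card Z)" using a(1) finZ by (simp add: R_def)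
  then show ?case
    using a Suc.prems Suc.hyps(2) by (intro Suc.hyps(1)[of "insert a Z" \<sigma>']) (auto simp: R_def)
qed

text \<open>The functional \<open>row_expansion Q Z\<close> is a vector in the column space of \<open>Q\<close> with the sign
  pattern prescribed by \<open>Z\<close>, so it cannot be orthogonal to a vector with the same pattern.\<close>

lemma orthogonal_pattern_contradiction:
  fixes Q :: "nat \<Rightarrow> nat \<Rightarrow> complex" and y :: "nat \<Rightarrow> real"
  assumes k: "1 \<le> k"
    and Q: "c \<noteq> 0" "\<And>I. I \<in> ksets n k \<Longrightarrow> p I > 0 \<and> minor Q I {..<k} = c * of_real (p I)"
    and orth: "\<And>j. j < k \<Longrightarrow> (\<Sum>i<n. Q i j * of_real (y i)) = 0"
    and Z: "Z \<subseteq> {..<n}" "card Z = k - 1"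
    and i0: "i0 < n" "i0 \<notin> Z" "y i0 \<noteq> 0" and \<sigma>: "\<sigma> \<noteq> 0"
    and sgn: "\<And>i. i < n \<Longrightarrow> i \<notin> Z \<Longrightarrow> \<sigma> * (-1) ^ card {z \<in> Z. z < i} * y i \<ge> 0"
  shows False
proof -
  have finZ: "finite Z" using Z(1) finite_subset by blast
  have card_Z: "Suc (card Z) = k" using Z(2) k by simp
  have insert_S: "insert i Z \<in> ksets n k" if "i < n" "i \<notin> Z" for i
    using that Z(1) finZ card_Z by (simp add: ksets_def)
  define m where "m j = (-1) ^ j *
     det (mat (card Z) (card Z) (\<lambda>(a, b). Q (pick Z a) (insert_index j b)))" for j
  define s where "s i = (if i \<in> Z then 0 else (-1) ^ card {z \<in> Z. z < i} * p (insert i Z))" for i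
  have expansion: "row_expansion Q Z i = c * of_real (s i)" if "i < n" for i
    using row_expansion_mem[of i Z Q] row_expansion_not_mem[of i Z Q] finZ card_Z Q(2)[OF insert_S] that
    by (simp add: s_def)
  \<comment> \<open>\<open>m\<close> holds the coefficients that express the functional through the
    first \<open>k\<close> columns of \<open>Q\<close>, each of which is orthogonal to
    \<open>y\<close>.\<close>
  have "(\<Sum>i<n. row_expansion Q Z i * of_real (y i)) = (\<Sum>j<k. (\<Sum>i<n. Q i j * of_real (y i)) * m j)"
    unfolding row_expansion_def card_Z m_def sum_distrib_right
    by (subst sum.swap) (simp only: mult_ac)
  also have "\<dots> = 0" using orth by simp
  finally have "c * of_real (\<Sum>i<n. s i * y i) = 0"
    by (simp add: expansion sum_distrib_left mult_ac)
  then have "(\<Sum>i<n. s i * y i) = 0"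
    unfolding mult_eq_0_iff of_real_eq_0_iff using Q(1) by simp
  then have sum0: "(\<Sum>i<n. \<sigma> * s i * y i) = 0"
    by (simp add: mult.assoc sum_distrib_left[symmetric])
  have eq: "\<sigma> * s i * y i = p (insert i Z) * (\<sigma> * (-1) ^ card {z \<in> Z. z < i} * y i)" if "i \<notin> Z" for i
    using that by (simp add: s_def)
  have nonneg: "\<sigma> * s i * y i \<ge> 0" if "i < n" for i
  proof (cases "i \<in> Z")
    case False
    have "p (insert i Z) * (\<sigma> * (-1) ^ card {z \<in> Z. z < i} * y i) \<ge> 0"
      using Q(2)[OF insert_S[OF that False]]
      by (intro mult_nonneg_nonneg[OF _ sgn[OF that False]]) simp
    then show ?thesis unfolding eq[OF False] .
  qed (simp add: s_def)
  have "\<forall>i\<in>{..<n}. \<sigma> * s i * y i = 0"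
    using sum_nonneg_eq_0_iff[of "{..<n}" "\<lambda>i. \<sigma> * s i * y i"] nonneg sum0 by simp
  then have "\<sigma> * s i0 * y i0 = 0" using i0 by blast
  then show False
    using Q(2)[OF insert_S[OF i0(1,2)]] i0 \<sigma> by (simp add: s_def)
qed

text \<open>With fewer than \<open>k\<close> changes, the change positions of the vector with its
  zeros filled, enlarged to \<open>k - 1\<close> elements, prescribe a sign pattern shared by
  \<open>y\<close> and by a vector in the span of the columns of \<open>Q\<close>. Their pairing
  could then not vanish.\<close>

lemma s_minus_ge:
  fixes Q :: "nat \<Rightarrow> nat \<Rightarrow> complex" and y :: "real vec"
  assumes k: "1 \<le> k" "k \<le> n"
    and Q: "c \<noteq> 0" "\<And>I. I \<in> ksets n k \<Longrightarrow> p I > 0 \<and> minor Q I {..<k} = c * of_real (p I)"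
    and y: "y \<in> carrier_vec n" "y \<noteq> 0\<^sub>v n"
    and orth: "\<And>j. j < k \<Longrightarrow> (\<Sum>i<n. Q i j * of_real (y $ i)) = 0"
  shows "k \<le> s_minus y"
proof (rule ccontr)
  assume less: "\<not> k \<le> s_minus y"
  let ?xs = "list_of_vec y"
  have len: "length ?xs = n" and nth: "\<And>i. i < n \<Longrightarrow> ?xs ! i = y $ i"
    using y(1) by (auto simp: list_of_vec_index)
  obtain i where "i < n" "y $ i \<noteq> 0"
  proof (cases "\<forall>i<n. y $ i = 0")
    case True
    then have "y = 0\<^sub>v n" using y(1) by (intro eq_vecI) auto
    then show thesis using y(2) by simp
  qed (use that in blast)
  then have "?xs ! i \<in> set ?xs" "?xs ! i \<noteq> 0" using len nth nth_mem[of i ?xs] by auto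
  then have "filter (\<lambda>x. x \<noteq> 0) ?xs \<noteq> []" by (auto simp: filter_empty_conv)
  from fill_zeros[OF this, unfolded len s_minus_def[symmetric]]
  obtain zs where zs: "length zs = n" "\<forall>i<n. zs ! i \<noteq> 0"
    "\<forall>i<n. ?xs ! i \<noteq> 0 \<longrightarrow> zs ! i = ?xs ! i"
    "sign_variations zs = s_minus y"
    "\<forall>i\<in>sign_changes zs. \<exists>j>i. j < n \<and> ?xs ! j \<noteq> 0"
    by (elim exE conjE)
  define N where "N = {i. i < n \<and> y $ i \<noteq> 0}"
  define i0 where "i0 = Max N"
  have N: "finite N" "N \<noteq> {}" using \<open>i < n\<close> \<open>y $ i \<noteq> 0\<close> by (auto simp: N_def)
  have i0: "i0 \<in> N" using N by (simp add: i0_def)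
  \<comment> \<open>The last nonzero position is the right one to protect: the filling puts no
    change there, so it stays outside \<open>Z\<close> and contributes a nonzero term to the
    pairing.\<close>
  have "i0 \<notin> sign_changes zs"
  proof
    assume "i0 \<in> sign_changes zs"
    then obtain j where j: "j > i0" "j \<in> N" using zs(5) nth by (auto simp: N_def)
    have "j \<le> i0" unfolding i0_def by (rule Max_ge[OF N(1) j(2)])
    then show False using j(1) by simp
  qed
  have sgn: "sgn (zs ! 0) * (-1) ^ card {z \<in> sign_changes zs. z < i} * y $ i \<ge> 0" if "i < n" for i
  proof (cases "y $ i = 0")
    case False
    then have "sgn (zs ! 0) * (-1) ^ card {z \<in> sign_changes zs. z < i} = sgn (y $ i)"
      using sgn_nth_sign_changes[of zs i] zs that nth by simp
    then show ?thesis by (simp add: sgn_if)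
  qed simp
  have "zs ! 0 \<noteq> 0" using zs(2) k by auto
  moreover have "sign_changes zs \<subseteq> {..<n}" using sign_changes_subset[of zs] zs(1) by auto
  moreover have "card (sign_changes zs) \<le> k - 1"
    using less zs(4) by (simp add: sign_variations_eq)
  ultimately have "\<exists>Z' \<sigma>'. Z' \<subseteq> {..<n} \<and> card Z' = k - 1 \<and> i0 \<notin> Z' \<and> \<sigma>' \<noteq> 0 \<and>
    (\<forall>i<n. i \<notin> Z' \<longrightarrow> \<sigma>' * (-1) ^ card {z \<in> Z'. z < i} * y $ i \<ge> 0)"
    using sgn i0 k \<open>i0 \<notin> sign_changes zs\<close>
    by (intro extend_sign_pattern[where Z = "sign_changes zs" and \<sigma> = "sgn (zs ! 0)"])
      (auto simp: N_def sgn_0_0)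
  then obtain Z \<sigma> where "Z \<subseteq> {..<n}" "card Z = k - 1" "i0 \<notin> Z" "\<sigma> \<noteq> 0"
    "\<And>i. i < n \<Longrightarrow> i \<notin> Z \<Longrightarrow> \<sigma> * (-1) ^ card {z \<in> Z. z < i} * y $ i \<ge> 0" by blast
  then show False
    using orth i0 by (intro orthogonal_pattern_contradiction[OF k(1) Q,
      where y = "\<lambda>i. y $ i" and Z = Z and \<sigma> = \<sigma> and ?i0.0 = i0]) (auto simp: N_def)
qed

text \<open>Putting \<open>x\<close> in front of the first \<open>k\<close> columns of
  \<open>P\<close> and keeping the \<open>k + 1\<close> rows \<open>T\<close> gives a singular
  matrix. Expanded along \<open>x\<close>, its determinant is a sum of terms of one weak sign up to
  the factor \<open>c\<close>, since the cofactor signs alternate together with \<open>x\<close>; so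
  \<open>x\<close> vanishes on \<open>T\<close>. Any \<open>k\<close> rows of these columns are
  independent, so \<open>x\<close> vanishes everywhere.\<close>

lemma alternating_in_column_space:
  fixes P :: "nat \<Rightarrow> nat \<Rightarrow> complex" and x :: "nat \<Rightarrow> real"
  assumes P: "c \<noteq> 0" "\<And>I. I \<in> ksets n k \<Longrightarrow> p I > 0 \<and> minor P I {..<k} = c * of_real (p I)"
    and span: "\<And>i. i < n \<Longrightarrow> of_real (x i) = (\<Sum>j<k. P i j * g j)"
    and T: "T \<in> ksets n (Suc k)" and \<sigma>: "\<sigma> \<noteq> 0"
    and sgn: "\<And>a. a \<le> k \<Longrightarrow> \<sigma> * (-1) ^ a * x (pick T a) \<ge> 0"
    and i: "i < n"
  shows "x i = 0"
proof -
  define t where "t = pick T"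
  have t: "t a \<in> T" "t a < n" "card {z \<in> T. z < t a} = a" if "a \<le> k" for a
    using that pick_in_set[of a T] card_pick[of a T] ksetsD[OF T] by (auto simp: t_def)
  have del: "T - {t a} \<in> ksets n k" if "a \<le> k" for a
    using t(1)[OF that] ksetsD[OF T] by (auto simp: ksets_def)
  have pick_del: "pick (T - {t a}) b = t (insert_index a b)" if "a \<le> k" "b < k" for a b
  proof -
    have "{z \<in> T - {t a}. z < t a} = {z \<in> T. z < t a}" by auto
    then show ?thesis
      using pick_insert[of "T - {t a}" "t a" b] t[OF that(1)] that ksetsD[OF del[OF that(1)]]
      by (simp add: insert_absorb t_def)
  qed
  define f where "f a b = (if b = 0 then of_real (x (t a)) else P (t a) (b - 1))" for a b
  let ?N = "mat (Suc k) (Suc k) (\<lambda>(a, b). f a b)"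
  have "det ?N = 0"
  \<comment> \<open>The kernel vector has -1 at \<open>x\<close> and the coefficients
    \<open>g\<close> at the columns of \<open>P\<close>.\<close>
  proof (rule det_zero_kernel[where g = "\<lambda>b. if b = 0 then -1 else g (b - 1)" and j = 0])
    fix a assume "a < Suc k"
    then show "(\<Sum>b<Suc k. f a b * (if b = 0 then -1 else g (b - 1))) = 0"
      unfolding sum.lessThan_Suc_shift using span[of "t a"] t(2)[of a] by (simp add: f_def)
  qed auto
  moreover have "det ?N = (\<Sum>a<Suc k. ?N $$ (a, 0) * cofactor ?N a 0)"
    by (rule laplace_expansion_column) auto
  moreover have "\<dots> = (\<Sum>a<Suc k. c * of_real (x (t a) * ((-1) ^ a * p (T - {t a}))))"
  proof (rule sum.cong[OF refl])
    fix a assume "a \<in> {..<Suc k}"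
    then have a: "a \<le> k" by auto
    have "mat_delete ?N a 0 = mat k k (\<lambda>(b, j). P (pick (T - {t a}) b) (pick {..<k} j))"
    proof (rule eq_matI)
      fix b j assume "b < dim_row (mat k k (\<lambda>(b, j). P (pick (T - {t a}) b) (pick {..<k} j)))"
        "j < dim_col (mat k k (\<lambda>(b, j). P (pick (T - {t a}) b) (pick {..<k} j)))"
      then have bj: "b < k" "j < k" by auto
      have "mat_delete ?N a 0 $$ (b, j) = ?N $$ (insert_index a b, insert_index 0 j)"
        using a bj by (subst mat_delete_index[of _ k, symmetric]) auto
      also have "\<dots> = P (t (insert_index a b)) j"
        using bj by (simp add: f_def insert_index_def)
      finally show "mat_delete ?N a 0 $$ (b, j)
        = mat k k (\<lambda>(b, j). P (pick (T - {t a}) b) (pick {..<k} j)) $$ (b, j)"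
        using pick_del[OF a bj(1)] pick_lessThan[OF bj(2)] bj by simp
    qed auto
    then have "det (mat_delete ?N a 0) = minor P (T - {t a}) {..<k}"
      using ksetsD(2)[OF del[OF a]] by (simp add: minor_def)
    then show "?N $$ (a, 0) * cofactor ?N a 0 = c * of_real (x (t a) * ((-1) ^ a * p (T - {t a})))"
      using a P(2)[OF del[OF a]] by (simp add: cofactor_def f_def)
  qed
  ultimately have "c * of_real (\<Sum>a<Suc k. x (t a) * ((-1) ^ a * p (T - {t a}))) = 0"
    by (simp only: of_real_sum sum_distrib_left)
  then have "(\<Sum>a<Suc k. x (t a) * ((-1) ^ a * p (T - {t a}))) = 0"
    unfolding mult_eq_0_iff of_real_eq_0_iff using P(1) by simp
  moreover have "(\<Sum>a<Suc k. p (T - {t a}) * (\<sigma> * (-1) ^ a * x (t a)))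
    = \<sigma> * (\<Sum>a<Suc k. x (t a) * ((-1) ^ a * p (T - {t a})))"
    by (simp only: sum_distrib_left mult_ac)
  ultimately have sum0: "(\<Sum>a<Suc k. p (T - {t a}) * (\<sigma> * (-1) ^ a * x (t a))) = 0" by simp
  have nonneg: "p (T - {t a}) * (\<sigma> * (-1) ^ a * x (t a)) \<ge> 0" if "a \<le> k" for a
    unfolding t_def using P(2)[OF del[OF that]]
    by (intro mult_nonneg_nonneg[OF _ sgn[OF that]]) (simp add: t_def)
  have "\<forall>a\<in>{..<Suc k}. p (T - {t a}) * (\<sigma> * (-1) ^ a * x (t a)) = 0"
    using sum_nonneg_eq_0_iff[of "{..<Suc k}" "\<lambda>a. p (T - {t a}) * (\<sigma> * (-1) ^ a * x (t a))"]
      nonneg sum0 by simp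
  then have x0: "x (t a) = 0" if "a \<le> k" for a
    using P(2)[OF del[OF that]] \<sigma> that by force
  \<comment> \<open>\<open>x\<close> vanishes on the \<open>k\<close> rows left when the first
    element of \<open>T\<close> is dropped, and the minor of \<open>P\<close> on these rows is
    nonzero.\<close>
  have "g j = 0" if "j < k" for j
  proof (rule ccontr)
    assume "g j \<noteq> 0"
    have "det (mat k k (\<lambda>(b, j). P (t (insert_index 0 b)) j)) = 0"
    proof (rule det_zero_kernel[where g = g and j = j])
      fix b assume "b < k"
      then show "(\<Sum>j<k. P (t (insert_index 0 b)) j * g j) = 0"
        using span[of "t (Suc b)"] x0[of "Suc b"] t(2)[of "Suc b"] by simp
    qed fact+
    moreover have "mat k k (\<lambda>(b, j). P (t (insert_index 0 b)) j)
      = mat k k (\<lambda>(b, j). P (pick (T - {t 0}) b) (pick {..<k} j))"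
      by (intro eq_matI) (auto simp: pick_del pick_lessThan)
    ultimately have "minor P (T - {t 0}) {..<k} = 0"
      using ksetsD(2)[OF del[of 0]] by (simp add: minor_def)
    then show False using P(1) P(2)[OF del[of 0]] by auto
  qed
  then show "x i = 0" using span[OF i] by simp
qed

text \<open>A sign choice with more than \<open>m\<close> changes alternates on 0 and the successors
  of its change positions. There \<open>x\<close> is zero or agrees with the choice, so it
  alternates weakly on \<open>m + 2\<close> indices, which no nonzero vector in the span of these
  \<open>m + 1\<close> columns can do.\<close>

lemma s_plus_le:
  fixes P :: "nat \<Rightarrow> nat \<Rightarrow> complex" and x :: "real vec"
  assumes n: "1 \<le> n"
    and P: "c \<noteq> 0" "\<And>I. I \<in> ksets n (Suc m) \<Longrightarrow> p I > 0 \<and> minor P I {..<Suc m} = c * of_real (p I)"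
    and x: "x \<in> carrier_vec n" "x \<noteq> 0\<^sub>v n"
    and span: "\<And>i. i < n \<Longrightarrow> of_real (x $ i) = (\<Sum>j<Suc m. P i j * g j)"
  shows "s_plus x \<le> m"
proof -
  let ?Zs = "{z. dim_vec z = dim_vec x \<and>
     (\<forall>i < dim_vec x. if x $ i = 0 then z $ i \<in> {-1, 1} else z $ i = x $ i)}"
  have "sign_variations (list_of_vec z) \<le> m" if z: "z \<in> ?Zs" for z
  proof (rule ccontr)
    let ?zs = "list_of_vec z"
    assume "\<not> sign_variations ?zs \<le> m"
    define C where "C = sign_changes ?zs"
    have C: "Suc m \<le> card C" using \<open>\<not> sign_variations ?zs \<le> m\<close> by (simp add: C_def sign_variations_eq)
    have zn: "dim_vec z = n" using z x(1) by auto
    have nth: "?zs ! i = z $ i" if "i < n" for i using that zn by (simp add: list_of_vec_index)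
    have z_nz: "?zs ! i \<noteq> 0" if "i < n" for i
      using that z x(1) nth[OF that] by (auto split: if_splits)
    have zx: "z $ i = x $ i" if "i < n" "x $ i \<noteq> 0" for i
      using that z x(1) by auto
    have C_sub: "C \<subseteq> {..<n - 1}" using sign_changes_subset[of ?zs] zn by (simp add: C_def)
    then have finC: "finite C" using finite_subset by blast
    define T where "T = insert 0 (Suc ` C)"
    have card_T: "card T = Suc (card C)" using finC by (auto simp: T_def card_image)
    have T_sub: "T \<subseteq> {..<n}" using C_sub n by (auto simp: T_def)
    have count: "card {c \<in> C. c < t} = card {s \<in> T. s < t}" if "t \<in> T" for t
    proof (cases t)
      case (Suc u)
      then have "u \<in> C" using that by (auto simp: T_def)
      have "{c \<in> C. c < t} = insert u {c \<in> C. c < u}" using \<open>u \<in> C\<close> Suc by auto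
      moreover have "{s \<in> T. s < t} = insert 0 (Suc ` {c \<in> C. c < u})" using Suc by (auto simp: T_def)
      moreover have "card (insert 0 (Suc ` {c \<in> C. c < u})) = Suc (card {c \<in> C. c < u})"
        using finC by (simp add: card_image)
      ultimately show ?thesis using finC by simp
    qed simp
    \<comment> \<open>Only the first \<open>m + 2\<close> elements are kept; as an initial segment
      of \<open>T\<close> they have the same enumeration.\<close>
    define T' where "T' = pick T ` {..Suc m}"
    have less: "a < card T" if "a \<le> Suc m" for a using that C card_T by linarith
    have mono: "pick T a < pick T b \<longleftrightarrow> a < b" if "a \<le> Suc m" "b \<le> Suc m" for a b
      using pick_mono[of b T a] pick_mono[of a T b] less that by (cases a b rule: linorder_cases) auto
    have inj: "inj_on (pick T) {..Suc m}"
    proof (rule inj_onI)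
      fix a b assume "a \<in> {..Suc m}" "b \<in> {..Suc m}" "pick T a = pick T b"
      then show "a = b" using mono[of a b] mono[of b a] by (auto simp del: pick.simps)
    qed
    have T': "T' \<in> ksets n (Suc (Suc m))"
      using pick_in_set[of _ T] less T_sub card_image[OF inj] by (auto simp: T'_def ksets_def)
    have pick_T': "pick T' a = pick T a" if "a \<le> Suc m" for a
    proof -
      have "{s \<in> T'. s < pick T a} = pick T ` {b \<in> {..Suc m}. pick T b < pick T a}"
        unfolding T'_def by blast
      also have "{b \<in> {..Suc m}. pick T b < pick T a} = {b \<in> {..Suc m}. b < a}"
        using mono[OF _ that] by (intro Collect_cong conj_cong) auto
      also have "\<dots> = {..<a}" using that by auto
      finally have "{s \<in> T'. s < pick T a} = pick T ` {..<a}" .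
      moreover have "card (pick T ` {..<a}) = a"
        using that inj by (subst card_image) (auto intro: inj_on_subset)
      ultimately have "card {s \<in> T'. s < pick T a} = a" by simp
      moreover have "pick T a \<in> T'" unfolding T'_def by (rule imageI) (use that in simp)
      ultimately show ?thesis using pick_card_in_set[of "pick T a" T'] by simp
    qed
    have sgn: "sgn (?zs ! 0) * (-1) ^ a * x $ (pick T' a) \<ge> 0" if "a \<le> Suc m" for a
    proof (cases "x $ (pick T' a) = 0")
      case False
      define t where "t = pick T a"
      have t: "t \<in> T" using pick_in_set[of a T] less[OF that] by (simp add: t_def)
      then have "t < n" using T_sub by auto
      have "card {s \<in> T. s < t} = a" using card_pick[of a T] less[OF that] by (simp add: t_def)
      then have "sgn (?zs ! t) = sgn (?zs ! 0) * (-1) ^ a"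
        using sgn_nth_sign_changes[of ?zs t] z_nz zn \<open>t < n\<close> count[OF t] by (simp add: C_def)
      moreover have "?zs ! t = x $ t" using zx[of t] nth[of t] \<open>t < n\<close> False pick_T'[OF that] by (simp add: t_def)
      ultimately have "sgn (?zs ! 0) * (-1) ^ a = sgn (x $ pick T' a)"
        using pick_T'[OF that] by (simp add: t_def)
      then show ?thesis by (simp add: sgn_if)
    qed simp
    have "sgn (?zs ! 0) \<noteq> 0" using z_nz[of 0] n by (simp add: sgn_0_0)
    then have "x $ i = 0" if "i < n" for i
      using that span T' sgn
      by (intro alternating_in_column_space[OF P, where x = "\<lambda>i. x $ i" and g = g and T = T'
            and \<sigma> = "sgn (?zs ! 0)"]) auto
    then have "x = 0\<^sub>v n" using x(1) by (intro eq_vecI) auto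
    then show False using x(2) by simp
  qed
  then have le: "{sign_variations (list_of_vec z) | z. z \<in> ?Zs} \<subseteq> {..m}" by blast
  \<comment> \<open>Replacing every zero by 1 is an admissible choice, so the set under
    \<open>Max\<close> is nonempty.\<close>
  have "vec (dim_vec x) (\<lambda>i. if x $ i = 0 then 1 else x $ i) \<in> ?Zs" by auto
  then have "{sign_variations (list_of_vec z) | z. z \<in> ?Zs} \<noteq> {}" by blast
  then have "Max {sign_variations (list_of_vec z) | z. z \<in> ?Zs} \<le> m"
    using le finite_subset[OF le] by (intro Max.boundedI) auto
  then show ?thesis by (simp add: s_plus_def)
qed

section \<open>Dominant invariant subspaces\<close>

lemma index_mult_mat_sum:
  assumes "A \<in> carrier_mat n n" "B \<in> carrier_mat n n" "i < n" "j < n"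
  shows "(A * B) $$ (i, j) = (\<Sum>l<n. A $$ (i, l) * B $$ (l, j))"
  using assms by (simp add: scalar_prod_def lessThan_atLeast0)

text \<open>The Schur decomposition puts the eigenvalues on the diagonal of \<open>B\<close> in the
  order in which they are listed, which is how an ordering by modulus can enter. The shift to
  \<open>lam (Suc i)\<close> lets the diagonal start at index 0.\<close>

lemma schur_basis_exists:
  fixes X :: "complex mat"
  assumes X: "X \<in> carrier_mat n n" and cp: "char_poly X = (\<Prod>i = 1..n. [:- lam i, 1:])"
  shows "\<exists>P P' B. schur_basis n (\<lambda>i j. X $$ (i, j)) P P' B (\<lambda>i. lam (Suc i))"
    and "det X = (\<Prod>i<n. lam (Suc i))"
proof -
  define es where "es = map (\<lambda>i. lam (Suc i)) [0..<n]"
  have "(\<Prod>i = 1..n. [:- lam i, 1:]) = (\<Prod>i\<in>{0..<n}. [:- lam (Suc i), 1:])"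
    using prod.shift_bounds_Suc_ivl[of "\<lambda>i. [:- lam i, 1:]" 0 n]
    by (simp add: atLeastLessThanSuc_atLeastAtMost)
  also have "\<dots> = (\<Prod>e\<leftarrow>es. [:- e, 1:])"
    by (simp add: es_def prod.distinct_set_conv_list[symmetric] o_def)
  finally have cp': "char_poly X = (\<Prod>e\<leftarrow>es. [:- e, 1:])" using cp by simp
  obtain B P Q where BPQ: "schur_decomposition X es = (B, P, Q)" by (cases "schur_decomposition X es") auto
  from schur_decomposition[OF X cp' BPQ]
  have sim: "similar_mat_wit X B P Q" and ut: "upper_triangular B" and dg: "diag_mat B = es" by auto
  from similar_mat_witD2[OF X sim]
  have PQ: "P * Q = 1\<^sub>m n" and QP: "Q * P = 1\<^sub>m n" and XB: "X = P * B * Q"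
    and B: "B \<in> carrier_mat n n" and P: "P \<in> carrier_mat n n" and Q: "Q \<in> carrier_mat n n" by auto
  have "X * P = P * B * (Q * P)"
    unfolding XB using B P Q by (simp add: assoc_mult_mat[of _ n n _ n _ n])
  then have XP: "X * P = P * B" using B P QP by simp
  have "Q * X = (Q * P) * (B * Q)"
    unfolding XB using B P Q by (simp add: assoc_mult_mat[of _ n n _ n _ n])
  then have QX: "Q * X = B * Q" using B Q QP by simp
  have dgi: "B $$ (i, i) = lam (Suc i)" if "i < n" for i
  proof -
    have "diag_mat B ! i = es ! i" using dg by simp
    then show ?thesis using that B by (simp add: diag_mat_def es_def)
  qed
  show "\<exists>P P' B. schur_basis n (\<lambda>i j. X $$ (i, j)) P P' B (\<lambda>i. lam (Suc i))"
  proof (intro exI, unfold_locales)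
    fix i j assume ij: "i < n" "j < n"
    show "(\<Sum>l<n. X $$ (i, l) * P $$ (l, j)) = (\<Sum>l<n. P $$ (i, l) * B $$ (l, j))"
      unfolding index_mult_mat_sum[OF X P ij, symmetric] index_mult_mat_sum[OF P B ij, symmetric] XP ..
    show "(\<Sum>l<n. Q $$ (i, l) * X $$ (l, j)) = (\<Sum>l<n. B $$ (i, l) * Q $$ (l, j))"
      unfolding index_mult_mat_sum[OF Q X ij, symmetric] index_mult_mat_sum[OF B Q ij, symmetric] QX ..
    show "(\<Sum>l<n. Q $$ (i, l) * P $$ (l, j)) = (if i = j then 1 else 0)"
      unfolding index_mult_mat_sum[OF Q P ij, symmetric] QP using ij by simp
    show "(\<Sum>l<n. P $$ (i, l) * Q $$ (l, j)) = (if i = j then 1 else 0)"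
      unfolding index_mult_mat_sum[OF P Q ij, symmetric] PQ using ij by simp
  next
    fix i j assume "j < i" "i < n"
    then show "B $$ (i, j) = 0" using ut B by auto
  qed (rule dgi)
  have "det X = det B" using sim by (intro det_similar) (auto simp: similar_mat_def)
  also have "\<dots> = prod_list es" using det_upper_triangular[OF ut B] dg by simp
  also have "\<dots> = (\<Prod>i<n. lam (Suc i))"
    by (simp add: es_def prod.distinct_set_conv_list[symmetric] lessThan_atLeast0)
  finally show "det X = (\<Prod>i<n. lam (Suc i))" .
qed

context schur_basis
begin

lemma expand:
  assumes "i < n"
  shows "v i = (\<Sum>j<n. P i j * (\<Sum>l<n. P' j l * v l))"
proof -
  have "(\<Sum>j<n. P i j * (\<Sum>l<n. P' j l * v l)) = (\<Sum>l<n. (\<Sum>j<n. P i j * P' j l) * v l)"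
    unfolding sum_distrib_left sum_distrib_right by (subst sum.swap) (simp only: mult_ac)
  also have "\<dots> = (\<Sum>l<n. if l = i then v l else 0)"
    using assms by (intro sum.cong) (auto simp: PP')
  finally show ?thesis using assms by simp
qed

text \<open>In the coordinates \<open>z = P' v\<close> the equation reads
  \<open>B z = \<mu> z\<close>. At the last nonzero coordinate the triangular row reduces to its
  diagonal entry, so \<open>\<mu>\<close> is the eigenvalue of that position, which must therefore
  lie below \<open>k\<close>.\<close>

lemma eigenvector_in_span:
  assumes v: "\<And>i. i < n \<Longrightarrow> (\<Sum>j<n. X i j * v j) = \<mu> * v i"
    and \<mu>: "\<And>j. k \<le> j \<Longrightarrow> j < n \<Longrightarrow> \<mu> \<noteq> la j" and k: "k \<le> n"
  shows "\<exists>g. \<forall>i<n. v i = (\<Sum>j<k. P i j * g j)"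
proof -
  define z where "z j = (\<Sum>l<n. P' j l * v l)" for j
  have Bz: "(\<Sum>l<n. B i l * z l) = \<mu> * z i" if "i < n" for i
  proof -
    have "(\<Sum>l<n. B i l * z l) = (\<Sum>r<n. (\<Sum>l<n. B i l * P' l r) * v r)"
      unfolding z_def sum_distrib_left sum_distrib_right by (subst sum.swap) (simp only: mult_ac)
    also have "\<dots> = (\<Sum>r<n. (\<Sum>l<n. P' i l * X l r) * v r)"
      using that by (simp add: P'X)
    also have "\<dots> = (\<Sum>l<n. P' i l * (\<Sum>r<n. X l r * v r))"
      unfolding sum_distrib_left sum_distrib_right by (subst sum.swap) (simp only: mult_ac)
    also have "\<dots> = (\<Sum>l<n. P' i l * (\<mu> * v l))" by (simp add: v)
    finally show ?thesis by (simp add: z_def sum_distrib_left mult_ac)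
  qed
  have z0: "z j = 0" if "k \<le> j" "j < n" for j
  proof (rule ccontr)
    assume "z j \<noteq> 0"
    define N where "N = {j. j < n \<and> z j \<noteq> 0}"
    define m where "m = Max N"
    have N: "finite N" "j \<in> N" using \<open>z j \<noteq> 0\<close> that by (auto simp: N_def)
    then have m: "m \<in> N" unfolding m_def by (intro Max_in) auto
    have max: "l \<le> m" if "l \<in> N" for l unfolding m_def by (rule Max_ge[OF N(1) that])
    have "B m l * z l = 0" if "l \<in> {..<n} - {m}" for l
      using that triangular[of l m] max[of l] m by (cases "l < m") (auto simp: N_def)
    then have "(\<Sum>l\<in>{..<n} - {m}. B m l * z l) = 0" by (intro sum.neutral) blast
    then have "(\<Sum>l<n. B m l * z l) = la m * z m"
      using m by (simp add: sum.remove[of "{..<n}" m] N_def diag)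
    then have "\<mu> = la m" using Bz[of m] m by (simp add: N_def)
    then show False using \<mu>[of m] max[OF N(2)] that(1) m by (simp add: N_def)
  qed
  have "v i = (\<Sum>j<k. P i j * z j)" if "i < n" for i
  proof -
    have "v i = (\<Sum>j<n. P i j * z j)" using expand[OF that, of v] by (simp add: z_def)
    also have "\<dots> = (\<Sum>j<k. P i j * z j)"
      using k z0 by (intro sum.mono_neutral_right) auto
    finally show ?thesis .
  qed
  then show ?thesis by blast
qed

text \<open>Here \<open>v\<close> belongs to the transpose of \<open>X\<close>. Pairing its equation
  with column \<open>j\<close> of \<open>P\<close> leaves, by triangularity, only the pairings with
  columns up to \<open>j\<close>; those before \<open>j\<close> vanish by induction, and the last
  because \<open>\<mu> \<noteq> la j\<close>.\<close>

lemma eigenvector_orthogonal: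
  assumes v: "\<And>i. i < n \<Longrightarrow> (\<Sum>j<n. X j i * v j) = \<mu> * v i"
    and \<mu>: "\<And>j. j < k \<Longrightarrow> \<mu> \<noteq> la j" and k: "k \<le> n" and j: "j < k"
  shows "(\<Sum>i<n. P i j * v i) = 0"
  using j
proof (induction j rule: less_induct)
  case (less j)
  define z where "z l = (\<Sum>i<n. P i l * v i)" for l
  have "\<mu> * z j = (\<Sum>i<n. P i j * (\<mu> * v i))"
    by (simp add: z_def sum_distrib_left mult_ac)
  also have "\<dots> = (\<Sum>i<n. P i j * (\<Sum>r<n. X r i * v r))"
    by (simp add: v)
  also have "\<dots> = (\<Sum>r<n. (\<Sum>i<n. X r i * P i j) * v r)"
    unfolding sum_distrib_left sum_distrib_right by (subst sum.swap) (simp only: mult_ac)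
  also have "\<dots> = (\<Sum>r<n. (\<Sum>l<n. P r l * B l j) * v r)"
    using less.prems k by (simp add: XP)
  also have "\<dots> = (\<Sum>l<n. z l * B l j)"
    unfolding z_def sum_distrib_left sum_distrib_right by (subst sum.swap) (simp only: mult_ac)
  also have "\<dots> = z j * B j j + (\<Sum>l\<in>{..<n} - {j}. z l * B l j)"
    using less.prems k by (intro sum.remove) auto
  also have "(\<Sum>l\<in>{..<n} - {j}. z l * B l j) = 0"
  proof (intro sum.neutral ballI)
    fix l assume l: "l \<in> {..<n} - {j}"
    show "z l * B l j = 0"
    proof (cases "l < j")
      case True
      then show ?thesis using less.IH[of l] less.prems by (simp add: z_def)
    next
      case False
      then show ?thesis using l triangular[of j l] by simp
    qed
  qed
  finally have "\<mu> * z j = z j * la j" using less.prems k by (simp add: diag)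
  then show ?case using \<mu>[OF less.prems] by (auto simp: z_def mult.commute)
qed

end

text \<open>\<open>P\<close> spans the invariant subspaces of dominant eigenvalues; \<open>Q\<close> does so for the transpose,
  so that the orthogonal complement of its first columns collects the remaining eigenvectors.\<close>

locale odd_sign_regular =
  right: schur_basis n "\<lambda>i j. complex_of_real (A i j)" P P' B la +
  left: schur_basis n "\<lambda>i j. complex_of_real (A j i)" Q Q' B' la
  for n :: nat and A :: "nat \<Rightarrow> nat \<Rightarrow> real" and P P' B Q Q' B' :: "nat \<Rightarrow> nat \<Rightarrow> complex"
    and la :: "nat \<Rightarrow> complex" +
  fixes eps :: "nat \<Rightarrow> real"
  assumes n: "1 \<le> n"
    and eps: "\<And>k. odd k \<Longrightarrow> k \<le> n \<Longrightarrow> eps k \<in> {-1, 1}"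
    and definite: "\<And>k I J. odd k \<Longrightarrow> k \<le> n \<Longrightarrow> I \<in> ksets n k \<Longrightarrow> J \<in> ksets n k \<Longrightarrow> eps k * minor A I J > 0"
    and decreasing: "\<And>i j. i \<le> j \<Longrightarrow> j < n \<Longrightarrow> cmod (la j) \<le> cmod (la i)"
begin

lemma right_compound:
  assumes "odd k" "k \<le> n"
  shows "definite_compound n A P P' B la k (eps k)"
proof unfold_locales
  show "1 \<le> k" using assms(1) by (cases k) auto
qed (use assms eps definite decreasing in auto)

lemma left_compound:
  assumes "odd k" "k \<le> n"
  shows "definite_compound n (\<lambda>i j. A j i) Q Q' B' la k (eps k)"
proof unfold_locales
  show "1 \<le> k" using assms(1) by (cases k) auto
next
  fix I J assume "I \<in> ksets n k" "J \<in> ksets n k"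
  then show "0 < eps k * minor (\<lambda>i j. A j i) I J"
    using definite[OF assms, of J I] minor_transpose[of I J A] by (simp add: ksetsD)
qed (use assms eps decreasing in auto)

lemma leading_prod:
  assumes "odd k" "k \<le> n"
  shows "\<exists>\<rho>>0. (\<Prod>j<k. la j) = of_real (eps k * \<rho>)"
  using definite_compound.leading_prod_and_minors(1)[OF right_compound[OF assms]] .

lemma gap:
  assumes "odd k" "k < n"
  shows "cmod (la k) < cmod (la (k - 1))"
  using definite_compound.spectral_gap[OF right_compound] assms by simp

definition in_V :: "nat \<Rightarrow> (nat \<Rightarrow> complex) \<Rightarrow> bool" where
  "in_V k x \<longleftrightarrow> (\<exists>g. \<forall>i<n. x i = (\<Sum>j<k. P i j * g j))"

text \<open>The pairing is bilinear, without conjugation: the columns of \<open>Q\<close> belong to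
  the transpose and not to the adjoint, which makes the annihilator invariant under
  \<open>A\<close>.\<close>

definition in_W :: "nat \<Rightarrow> (nat \<Rightarrow> complex) \<Rightarrow> bool" where
  "in_W k x \<longleftrightarrow> (\<forall>j<k. (\<Sum>i<n. Q i j * x i) = 0)"

lemma in_V_lincomb:
  assumes "in_V k x" "in_V k y"
  shows "in_V k (\<lambda>i. a * x i + b * y i)"
proof -
  obtain g h where "\<forall>i<n. x i = (\<Sum>j<k. P i j * g j)" "\<forall>i<n. y i = (\<Sum>j<k. P i j * h j)"
    using assms by (auto simp: in_V_def)
  then have "\<forall>i<n. a * x i + b * y i = (\<Sum>j<k. P i j * (a * g j + b * h j))"
    by (simp add: sum_distrib_left distrib_left sum.distrib mult_ac)
  then show ?thesis unfolding in_V_def by (intro exI[of _ "\<lambda>j. a * g j + b * h j"])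
qed

lemma in_W_lincomb:
  assumes "in_W k x" "in_W k y"
  shows "in_W k (\<lambda>i. a * x i + b * y i)"
proof -
  have "(\<Sum>i<n. Q i j * (a * x i + b * y i)) = a * (\<Sum>i<n. Q i j * x i) + b * (\<Sum>i<n. Q i j * y i)" for j
    by (simp add: sum_distrib_left distrib_left sum.distrib mult_ac)
  then show ?thesis using assms by (simp add: in_W_def)
qed

lemma in_V_cong: "(\<And>i. i < n \<Longrightarrow> x i = y i) \<Longrightarrow> in_V k x \<Longrightarrow> in_V k y"
  by (simp add: in_V_def)

lemma in_W_cong: "(\<And>i. i < n \<Longrightarrow> x i = y i) \<Longrightarrow> in_W k x \<Longrightarrow> in_W k y"
  by (simp add: in_W_def)

lemma in_V_sum:
  assumes "finite S" "\<And>s. s \<in> S \<Longrightarrow> in_V k (x s)"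
  shows "in_V k (\<lambda>i. \<Sum>s\<in>S. x s i)"
  using assms
proof (induction S)
  case empty
  show ?case unfolding in_V_def by (intro exI[of _ "\<lambda>_. 0"]) simp
next
  case (insert s S)
  then show ?case using in_V_lincomb[of k "x s" "\<lambda>i. \<Sum>s\<in>S. x s i" 1 1] by simp
qed

text \<open>The gap at the odd position \<open>k\<close> separates \<open>la m\<close> in modulus
  from every eigenvalue with index \<open>k\<close> or larger.\<close>

lemma eigenvector_in_V:
  assumes v: "\<And>i. i < n \<Longrightarrow> (\<Sum>j<n. of_real (A i j) * v j) = la m * v i"
    and m: "m < k" and k: "odd k" "k \<le> n"
  shows "in_V k v"
  unfolding in_V_def
proof (rule right.eigenvector_in_span[OF v _ k(2)])
  fix j assume j: "k \<le> j" "j < n"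
  have "cmod (la j) \<le> cmod (la k)" using decreasing[of k j] j by simp
  also have "\<dots> < cmod (la (k - 1))" using gap[of k] k j by simp
  also have "\<dots> \<le> cmod (la m)" using decreasing[of m "k - 1"] m k by simp
  finally show "la m \<noteq> la j" by auto
qed

lemma eigenvector_in_W:
  assumes v: "\<And>i. i < n \<Longrightarrow> (\<Sum>j<n. of_real (A i j) * v j) = la m * v i"
    and m: "k \<le> m" "m < n" and k: "odd k"
  shows "in_W k v"
  unfolding in_W_def
proof (intro allI impI)
  fix j assume "j < k"
  show "(\<Sum>i<n. Q i j * v i) = 0"
  proof (rule left.eigenvector_orthogonal[OF v _ _ \<open>j < k\<close>])
    fix j assume j: "j < k"
    have "cmod (la m) \<le> cmod (la k)" using decreasing[of k m] m by simp
    also have "\<dots> < cmod (la (k - 1))" using gap[of k] k m by simp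
    also have "\<dots> \<le> cmod (la j)" using decreasing[of j "k - 1"] m j by simp
    finally show "la m \<noteq> la j" by auto
  qed (use m in auto)
qed

text \<open>For \<open>x = P g\<close> the orthogonality puts \<open>g\<close> into the kernel of
  the matrix \<open>f\<close> of pairings between the first \<open>k\<close> columns of
  \<open>Q\<close> and of \<open>P\<close>. By Cauchy-Binet its determinant is a sum of products of
  Pluecker coordinates, each a positive multiple of \<open>c * d\<close>, hence nonzero.\<close>

lemma V_W_disjoint:
  assumes V: "in_V k x" and W: "in_W k x" and k: "odd k" "k \<le> n" and i: "i < n"
  shows "x i = 0"
proof -
  obtain g where g: "\<And>i. i < n \<Longrightarrow> x i = (\<Sum>j<k. P i j * g j)" using V by (auto simp: in_V_def)
  obtain c p where p: "c \<noteq> 0" "\<And>I. I \<in> ksets n k \<Longrightarrow> p I > 0 \<and> minor P I {..<k} = c * of_real (p I)"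
    using definite_compound.leading_prod_and_minors(2)[OF right_compound[OF k]] by auto
  obtain d q where q: "d \<noteq> 0" "\<And>I. I \<in> ksets n k \<Longrightarrow> q I > 0 \<and> minor Q I {..<k} = d * of_real (q I)"
    using definite_compound.leading_prod_and_minors(2)[OF left_compound[OF k]] by auto
  define f where "f j m = (\<Sum>i<n. Q i j * P i m)" for j m
  have "minor f {..<k} {..<k} = (\<Sum>J\<in>ksets n k. minor (\<lambda>j i. Q i j) {..<k} J * minor P J {..<k})"
    unfolding f_def by (rule cauchy_binet) auto
  also have "\<dots> = (\<Sum>J\<in>ksets n k. c * d * of_real (p J * q J))"
  proof (rule sum.cong[OF refl])
    fix J assume J: "J \<in> ksets n k"
    have "minor (\<lambda>j i. Q i j) {..<k} J = minor Q J {..<k}"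
      by (rule minor_transpose) (simp add: ksetsD(2)[OF J])
    then show "minor (\<lambda>j i. Q i j) {..<k} J * minor P J {..<k} = c * d * of_real (p J * q J)"
      by (simp add: p(2)[OF J] q(2)[OF J])
  qed
  also have "\<dots> = c * d * of_real (\<Sum>J\<in>ksets n k. p J * q J)"
    by (simp only: of_real_sum sum_distrib_left)
  finally have "minor f {..<k} {..<k} = c * d * of_real (\<Sum>J\<in>ksets n k. p J * q J)" .
  moreover have "(\<Sum>J\<in>ksets n k. p J * q J) > 0"
    using p q lessThan_kset[OF k(2)] by (intro sum_pos) auto
  then have "complex_of_real (\<Sum>J\<in>ksets n k. p J * q J) \<noteq> 0" unfolding of_real_eq_0_iff by simp
  ultimately have "minor f {..<k} {..<k} \<noteq> 0" using p(1) q(1) by simp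
  moreover have "mat k k (\<lambda>(i, j). f (pick {..<k} i) (pick {..<k} j)) = mat k k (\<lambda>(i, j). f i j)"
    by (intro eq_matI) (auto simp: pick_lessThan simp del: pick.simps)
  ultimately have nz: "det (mat k k (\<lambda>(i, j). f i j)) \<noteq> 0" by (simp add: minor_def)
  have kernel: "(\<Sum>m<k. f j m * g m) = 0" if "j < k" for j
  proof -
    have "(\<Sum>m<k. f j m * g m) = (\<Sum>i<n. Q i j * (\<Sum>m<k. P i m * g m))"
      unfolding f_def sum_distrib_left sum_distrib_right by (subst sum.swap) (simp only: mult_ac)
    also have "\<dots> = (\<Sum>i<n. Q i j * x i)" by (simp add: g)
    finally show ?thesis using W that by (simp add: in_W_def)
  qed
  have "g j = 0" if "j < k" for j
  proof (rule ccontr)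
    assume "g j \<noteq> 0"
    from det_zero_kernel[OF kernel that this] nz show False by simp
  qed
  then show ?thesis using g[OF i] by simp
qed

lemma s_plus_V:
  assumes V: "in_V k (\<lambda>i. of_real (x $ i))" and k: "odd k" "k \<le> n"
    and x: "x \<in> carrier_vec n" "x \<noteq> 0\<^sub>v n"
  shows "s_plus x \<le> k - 1"
proof -
  obtain g where g: "\<And>i. i < n \<Longrightarrow> of_real (x $ i) = (\<Sum>j<k. P i j * g j)" using V by (auto simp: in_V_def)
  obtain c p where "c \<noteq> 0" "\<And>I. I \<in> ksets n k \<Longrightarrow> p I > 0 \<and> minor P I {..<k} = c * of_real (p I)"
    using definite_compound.leading_prod_and_minors(2)[OF right_compound[OF k]] by auto
  moreover have "Suc (k - 1) = k" using k(1) by (cases k) auto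
  ultimately show ?thesis
    using s_plus_le[of n c "k - 1" p P x g] n x g by simp
qed

lemma s_minus_W:
  assumes W: "in_W k (\<lambda>i. of_real (y $ i))" and k: "odd k" "k \<le> n"
    and y: "y \<in> carrier_vec n" "y \<noteq> 0\<^sub>v n"
  shows "k \<le> s_minus y"
proof -
  obtain c p where "c \<noteq> 0" "\<And>I. I \<in> ksets n k \<Longrightarrow> p I > 0 \<and> minor Q I {..<k} = c * of_real (p I)"
    using definite_compound.leading_prod_and_minors(2)[OF left_compound[OF k]] by auto
  moreover have "1 \<le> k" using k(1) by (cases k) auto
  ultimately show ?thesis
    using s_minus_ge[of k n c p Q y] k y W by (simp add: in_W_def)
qed

end

section \<open>Independent families and multiplicities of roots\<close>

lemma lin_indpt_familyI:
  fixes ws :: "'a :: field vec list"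
  assumes ws: "set ws \<subseteq> carrier_vec n"
    and indpt: "\<And>c j. \<lbrakk>\<And>r. r < n \<Longrightarrow> (\<Sum>i<length ws. c i * ws ! i $ r) = 0; j < length ws\<rbrakk> \<Longrightarrow> c j = 0"
  shows "lin_indpt_family n ws"
proof -
  interpret vec_space "TYPE('a)" n .
  have dist: "distinct ws"
    unfolding distinct_conv_nth
  proof (intro allI impI notI)
    fix i j assume ij: "i < length ws" "j < length ws" "i \<noteq> j" "ws ! i = ws ! j"
    \<comment> \<open>A repeated vector would admit the relation with coefficients 1 and -1, so the
      coefficient criterion also yields distinctness.\<close>
    define c where "c = (\<lambda>l. if l = i then 1 else if l = j then -1 else 0 :: 'a)"
    have "(\<Sum>l<length ws. c l * ws ! l $ r) = 0" for r
    proof -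
      have "(\<Sum>l<length ws. c l * ws ! l $ r)
        = c i * ws ! i $ r + (c j * ws ! j $ r + (\<Sum>l\<in>{..<length ws} - {i} - {j}. c l * ws ! l $ r))"
        using ij by (simp add: sum.remove[of _ i] sum.remove[of _ j])
      also have "(\<Sum>l\<in>{..<length ws} - {i} - {j}. c l * ws ! l $ r) = 0"
        by (intro sum.neutral) (auto simp: c_def)
      finally show ?thesis using ij by (simp add: c_def)
    qed
    then have "c i = 0" using indpt ij(1) by blast
    then show False by (simp add: c_def)
  qed
  have "lin_indpt (set ws)"
  proof
    assume "lin_dep (set ws)"
    then obtain a v where a: "lincomb a (set ws) = 0\<^sub>v n" "v \<in> set ws" "a v \<noteq> 0"
      using finite_lin_dep[of "set ws"] ws by auto
    obtain j where j: "j < length ws" "ws ! j = v" using a(2) by (auto simp: in_set_conv_nth)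
    have "a (ws ! j) = 0"
    proof (rule indpt[where c = "\<lambda>j. a (ws ! j)"])
      fix r assume r: "r < n"
      have "(\<Sum>i<length ws. a (ws ! i) * ws ! i $ r) = (\<Sum>x\<in>set ws. a x * x $ r)"
        using sum.reindex_bij_betw[OF bij_betw_nth[OF dist refl refl], of "\<lambda>x. a x * x $ r"] .
      also have "\<dots> = lincomb a (set ws) $ r" using lincomb_index[OF r ws] by simp
      also have "\<dots> = 0" using a(1) r by simp
      finally show "(\<Sum>i<length ws. a (ws ! i) * ws ! i $ r) = 0" .
    qed (rule j)
    then show False using a(3) j(2) by simp
  qed
  then show ?thesis using ws dist by (simp add: lin_indpt_family_def)
qed

lemma lin_indpt_family_pairD:
  fixes a b :: "'a :: field vec"
  assumes indpt: "lin_indpt_family n [a, b]"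
    and comb: "\<And>r. r < n \<Longrightarrow> x * a $ r + y * b $ r = 0"
  shows "x = 0 \<and> y = 0"
proof (rule ccontr)
  assume nz: "\<not> ?thesis"
  interpret vec_space "TYPE('a)" n .
  from indpt have ab: "{a, b} \<subseteq> carrier_vec n" "a \<noteq> b" "lin_indpt {a, b}"
    by (auto simp: lin_indpt_family_def)
  define f where "f v = (if v = a then x else y)" for v
  have "lincomb f {a, b} = 0\<^sub>v n"
  proof (rule eq_vecI)
    show "lincomb f {a, b} $ r = 0\<^sub>v n $ r" if "r < dim_vec (0\<^sub>v n)" for r
      using that lincomb_index[of r "{a, b}" f] ab comb[of r] by (simp add: f_def)
    show "dim_vec (lincomb f {a, b}) = dim_vec (0\<^sub>v n)"
      using lincomb_dim[OF _ ab(1), of f] by simp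
  qed
  note lc = this
  have "f a = x" "f b = y" using ab(2) by (auto simp: f_def)
  then have "\<exists>w\<in>{a, b}. f w \<noteq> 0" using nz by auto
  then obtain w where w: "w \<in> {a, b}" "f w \<noteq> 0" by blast
  have "lin_dep {a, b}"
    by (rule lin_dep_crit[where A = "{a, b}" and a = f and v = w]) (use lc w in simp_all)
  then show False using ab(3) by simp
qed

lemma order_prod_linear:
  fixes f :: "'b \<Rightarrow> 'a :: field_char_0"
  assumes "finite S"
  shows "Polynomial.order \<mu> (\<Prod>i\<in>S. [:- f i, 1:]) = card {i \<in> S. f i = \<mu>}"
  using assms
proof (induction S)
  case (insert a S)
  have nz: "[:- f a, 1:] * (\<Prod>i\<in>S. [:- f i, 1:]) \<noteq> 0" 
    using insert.hyps by (intro no_zero_divisors) (auto simp: prod_zero_iff)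
  have "Polynomial.order \<mu> [:- f a, 1:] = of_bool (f a = \<mu>)"
    using order_power_n_n[of "f a" 1] by (auto intro!: order_0I)
  moreover have "{i \<in> insert a S. f i = \<mu>} = (if f a = \<mu> then insert a {i \<in> S. f i = \<mu>} else {i \<in> S. f i = \<mu>})"
    by auto
  ultimately show ?case using insert order_mult[OF nz, of \<mu>] by (simp add: insert.hyps)
qed (simp add: order_0I)

lemma schur_basis_cong:
  assumes "schur_basis n X P P' B la" "\<And>i j. i < n \<Longrightarrow> j < n \<Longrightarrow> X i j = Y i j"
  shows "schur_basis n Y P P' B la"
proof -
  interpret schur_basis n X P P' B la by fact
  show ?thesis
  proof unfold_locales
    fix i j assume ij: "i < n" "j < n"
    have "(\<Sum>l<n. Y i l * P l j) = (\<Sum>l<n. X i l * P l j)" using assms(2) ij by simp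
    then show "(\<Sum>l<n. Y i l * P l j) = (\<Sum>l<n. P i l * B l j)" using XP[OF ij] by simp
    have "(\<Sum>l<n. P' i l * Y l j) = (\<Sum>l<n. P' i l * X l j)" using assms(2) ij by simp
    then show "(\<Sum>l<n. P' i l * Y l j) = (\<Sum>l<n. B i l * P' l j)" using P'X[OF ij] by simp
  qed (use P'P PP' triangular diag in auto)
qed

section \<open>Eigenvectors of odd sign-regular matrices\<close>

locale sign_regular_eigenvectors = odd_sign_regular n A P P' B Q Q' B' "\<lambda>i. lam (Suc i)" eps
  for n A P P' B Q Q' B' and lam :: "nat \<Rightarrow> complex" and eps +
  fixes v :: "nat \<Rightarrow> complex vec"
  assumes carrier: "\<And>i. i \<in> {1..n} \<Longrightarrow> v i \<in> carrier_vec n"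
    and nonzero: "\<And>i. i \<in> {1..n} \<Longrightarrow> v i \<noteq> 0\<^sub>v n"
    and eigen: "\<And>i r. i \<in> {1..n} \<Longrightarrow> r < n \<Longrightarrow> (\<Sum>j<n. of_real (A r j) * v i $ j) = lam i * v i $ r"
    and v_pairs: "\<And>i. i \<in> {1..n} \<Longrightarrow>
           real_vec (v i) \<or> (i < n \<and> conj_pair (v i) (v (i + 1))) \<or> (1 < i \<and> conj_pair (v (i - 1)) (v i))"
    and Re_Im_indpt: "\<And>i. i \<in> {1..n} \<Longrightarrow> \<not> real_vec (v i) \<Longrightarrow>
           lin_indpt_family n [Re_vec (v i), Im_vec (v i)]"
begin

lemma lam_gap: "odd k \<Longrightarrow> k < n \<Longrightarrow> cmod (lam (k + 1)) < cmod (lam k)"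
  using gap[of k] by (cases k) auto

lemma v_in_V:
  assumes "i \<in> {1..n}" "i \<le> k" "odd k" "k \<le> n"
  shows "in_V k (\<lambda>r. v i $ r)"
  using eigenvector_in_V[of "\<lambda>r. v i $ r" "i - 1" k] eigen[OF assms(1)] assms by simp

lemma v_in_W:
  assumes "i \<in> {1..n}" "k < i" "odd k"
  shows "in_W k (\<lambda>r. v i $ r)"
  using eigenvector_in_W[of "\<lambda>r. v i $ r" "i - 1" k] eigen[OF assms(1)] assms by simp

lemma real_eq: "real_vec w \<Longrightarrow> w \<in> carrier_vec n \<Longrightarrow> r < n \<Longrightarrow> complex_of_real (Re_vec w $ r) = w $ r"
  by (simp add: real_vec_def)

lemma conj_pair_index:
  assumes "conj_pair w w'" "w \<in> carrier_vec n" "r < n"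
  shows "w' $ r = cnj (w $ r)"
  using assms by (simp add: conj_pair_def)

lemma vec_nonzero:
  assumes "w \<in> carrier_vec n" "w \<noteq> 0\<^sub>v n"
  obtains r where "r < n" "w $ r \<noteq> 0"
proof -
  have "\<exists>r<n. w $ r \<noteq> 0"
  proof (rule ccontr)
    assume "\<not> ?thesis"
    then have "w = 0\<^sub>v n" using assms(1) by (intro eq_vecI) auto
    then show False using assms(2) by simp
  qed
  then show thesis using that by blast
qed

text \<open>\<open>A\<close> is real, so conjugating the eigenvalue equation of \<open>v i\<close>
  gives that of its partner.\<close>

lemma conj_pair_lam:
  assumes "1 \<le> i" "i < n" "conj_pair (v i) (v (i + 1))"
  shows "lam (i + 1) = cnj (lam i)"
proof -
  have i: "i \<in> {1..n}" "i + 1 \<in> {1..n}" using assms by auto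
  obtain r where r: "r < n" "v (i + 1) $ r \<noteq> 0"
    using vec_nonzero[OF carrier[OF i(2)] nonzero[OF i(2)]] .
  note idx = conj_pair_index[OF assms(3) carrier[OF i(1)], simplified]
  have "lam (i + 1) * v (i + 1) $ r = (\<Sum>j<n. of_real (A r j) * v (i + 1) $ j)"
    using eigen[OF i(2) r(1)] by simp
  also have "\<dots> = cnj (\<Sum>j<n. of_real (A r j) * v i $ j)" by (simp add: idx)
  also have "\<dots> = cnj (lam i) * v (i + 1) $ r" using eigen[OF i(1) r(1)] idx[OF r(1)] by simp
  finally show ?thesis using r(2) by simp
qed

text \<open>Conjugate eigenvalues have equal moduli, while moduli drop strictly behind an odd
  position. So pairs start at even positions only, and \<open>v 1\<close> is real.\<close>

lemma no_odd_pair: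
  assumes "odd i" "i < n"
  shows "\<not> conj_pair (v i) (v (i + 1))"
proof
  assume "conj_pair (v i) (v (i + 1))"
  then have "lam (i + 1) = cnj (lam i)" using conj_pair_lam[of i] assms by (cases i) auto
  then show False using lam_gap[OF assms] by simp
qed

lemma even_nonreal:
  assumes "even i" "i \<in> {1..n}" "\<not> real_vec (v i)"
  shows "i < n" "conj_pair (v i) (v (i + 1))"
proof -
  have "odd (i - 1)" "i - 1 < n" "i - 1 + 1 = i" using assms(1,2) by auto
  then have "\<not> conj_pair (v (i - 1)) (v i)" using no_odd_pair[of "i - 1"] by simp
  then show "i < n" "conj_pair (v i) (v (i + 1))" using v_pairs[OF assms(2)] assms(3) by auto
qed

lemma odd_nonreal:
  assumes "odd i" "i \<in> {1..n}" "\<not> real_vec (v i)"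
  shows "1 < i" "conj_pair (v (i - 1)) (v i)"
  using v_pairs[OF assms(2)] assms no_odd_pair[of i] by auto

lemma Re_vec_nonzero:
  assumes "i \<in> {1..n}" "real_vec (v i)"
  shows "Re_vec (v i) \<in> carrier_vec n" "Re_vec (v i) \<noteq> 0\<^sub>v n"
proof -
  show "Re_vec (v i) \<in> carrier_vec n" using carrier[OF assms(1)] by simp
  obtain r where r: "r < n" "v i $ r \<noteq> 0"
    using vec_nonzero[OF carrier[OF assms(1)] nonzero[OF assms(1)]] .
  then have "complex_of_real (Re_vec (v i) $ r) \<noteq> 0"
    using real_eq[OF assms(2) carrier[OF assms(1)]] by simp
  then show "Re_vec (v i) \<noteq> 0\<^sub>v n" using r(1) by auto
qed

lemma real_comb_index:
  assumes "i \<in> {1..n}" "conj_pair (v i) (v (i + 1))" "matching c1 c2" "r < n"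
  shows "complex_of_real (real_comb c1 (v i) c2 (v (i + 1)) $ r) = c1 * v i $ r + c2 * v (i + 1) $ r"
proof -
  have w: "v i \<in> carrier_vec n" "v (i + 1) \<in> carrier_vec n"
    using carrier[OF assms(1)] assms(2) by (auto simp: conj_pair_def)
  have "v (i + 1) $ r = cnj (v i $ r)" using conj_pair_index[OF assms(2) w(1) assms(4)] .
  then show ?thesis
    using w assms(3,4) by (simp add: real_comb_def matching_def complex_eq_iff)
qed

text \<open>The combination is twice the difference of \<open>Re c1\<close> times the real part and
  \<open>Im c1\<close> times the imaginary part of \<open>v i\<close>, and these two parts are
  independent.\<close>

lemma real_comb_nonzero:
  assumes i: "i \<in> {1..n}" and pair: "conj_pair (v i) (v (i + 1))" and m: "matching c1 c2"
  shows "real_comb c1 (v i) c2 (v (i + 1)) \<in> carrier_vec n"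
    "real_comb c1 (v i) c2 (v (i + 1)) \<noteq> 0\<^sub>v n"
proof -
  have w: "v i \<in> carrier_vec n" "v (i + 1) \<in> carrier_vec n"
    using carrier[OF i] pair by (auto simp: conj_pair_def)
  show "real_comb c1 (v i) c2 (v (i + 1)) \<in> carrier_vec n" using w by (simp add: real_comb_def)
  show "real_comb c1 (v i) c2 (v (i + 1)) \<noteq> 0\<^sub>v n"
  proof
    assume 0: "real_comb c1 (v i) c2 (v (i + 1)) = 0\<^sub>v n"
    have *: "Re c1 * Re_vec (v i) $ r + (- Im c1) * Im_vec (v i) $ r = 0" if r: "r < n" for r
    proof -
      have "c1 * v i $ r + cnj c1 * cnj (v i $ r) = 0"
        using real_comb_index[OF i pair m r] conj_pair_index[OF pair w(1) r] m r
        unfolding 0 by (simp add: matching_def)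
      then show ?thesis using w r by (simp add: complex_eq_iff)
    qed
    have nonreal: "\<not> real_vec (v i)" using pair by (simp add: conj_pair_def)
    from * have "Re c1 = 0 \<and> - Im c1 = 0"
      by (rule lin_indpt_family_pairD[OF Re_Im_indpt[OF i nonreal]])
    then show False using m by (auto simp: matching_def complex_eq_iff)
  qed
qed

lemma real_comb_in_V:
  assumes "i \<in> {1..n}" "i + 1 \<in> {1..n}" "conj_pair (v i) (v (i + 1))" "matching c1 c2"
    and k: "i + 1 \<le> k" "odd k" "k \<le> n"
  shows "in_V k (\<lambda>r. of_real (real_comb c1 (v i) c2 (v (i + 1)) $ r))"
proof (rule in_V_cong)
  show "in_V k (\<lambda>r. c1 * v i $ r + c2 * v (i + 1) $ r)"
    using assms by (intro in_V_lincomb v_in_V) auto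
qed (simp only: real_comb_index[OF assms(1,3,4)])

lemma real_comb_in_W:
  assumes "i \<in> {1..n}" "i + 1 \<in> {1..n}" "conj_pair (v i) (v (i + 1))" "matching c1 c2"
    and k: "k < i" "odd k"
  shows "in_W k (\<lambda>r. of_real (real_comb c1 (v i) c2 (v (i + 1)) $ r))"
proof (rule in_W_cong)
  show "in_W k (\<lambda>r. c1 * v i $ r + c2 * v (i + 1) $ r)"
    using assms by (intro in_W_lincomb v_in_W) auto
qed (simp only: real_comb_index[OF assms(1,3,4)])

text \<open>Closed form of the \<open>realify\<close> list. Pairs start at even positions, so a
  non-real vector at an odd position is the second of its pair and stands for the imaginary part of
  its predecessor.\<close>

definition u :: "nat \<Rightarrow> real vec" where
  "u i = (if real_vec (v i) \<or> even i then Re_vec (v i) else Im_vec (v (i - 1)))"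

lemma u_carrier:
  assumes "i \<in> {1..n}"
  shows "u i \<in> carrier_vec n"
proof (cases "real_vec (v i) \<or> even i")
  case True
  then show ?thesis using carrier[OF assms] by (simp add: u_def)
next
  case False
  then have "i - 1 \<in> {1..n}" using odd_nonreal[of i] assms by auto
  then show ?thesis using False carrier[of "i - 1"] by (simp add: u_def)
qed

text \<open>From an even position on, the list splits into blocks of two, each a conjugate pair or
  two real vectors, with possibly a single vector at the end. The recursion is followed one block at
  a time.\<close>

lemma realify_eq:
  assumes "even m" "2 \<le> m" "m \<le> n + 1"
  shows "realify (map v [m..<n + 1]) = map u [m..<n + 1]"
  using assms
proof (induction "n + 1 - m" arbitrary: m rule: less_induct)
  case less
  consider "m = n + 1" | "m = n" | "m < n" using less.prems(3) by linarith
  then show ?case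
  proof cases
    case 2
    then show ?thesis using less.prems by (simp add: u_def)
  next
    case 3
    then have upt: "[m..<n + 1] = m # (m + 1) # [m + 2..<n + 1]" by (simp add: upt_conv_Cons)
    have IH: "realify (map v [m + 2..<n + 1]) = map u [m + 2..<n + 1]"
      using less.prems 3 by (intro less.hyps) auto
    show ?thesis
    proof (cases "real_vec (v m)")
      case True
      then have "\<not> conj_pair (v m) (v (m + 1))" by (simp add: conj_pair_def)
      then have r: "real_vec (v (m + 1))" using odd_nonreal[of "m + 1"] less.prems 3 by auto
      have "realify (v (m + 1) # map v [m + 2..<n + 1]) = Re_vec (v (m + 1)) # realify (map v [m + 2..<n + 1])"
        using r by (cases "map v [m + 2..<n + 1]") auto
      then show ?thesis using True r IH unfolding upt by (simp add: u_def)
    next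
      case False
      then have "conj_pair (v m) (v (m + 1))" using even_nonreal[of m] less.prems 3 by auto
      then have "\<not> real_vec (v (m + 1))"
        using False carrier[of m] less.prems 3
        by (auto simp: conj_pair_def real_vec_def complex_cnj_cancel_iff Reals_cnj_iff)
      then show ?thesis using False IH less.prems unfolding upt by (simp add: u_def)
    qed
  qed simp
qed

lemma realify_all: "realify (map v [1..<n + 1]) = map u [1..<n + 1]"
proof -
  have r: "real_vec (v 1)" using odd_nonreal[of 1] n by auto
  have upt: "[1..<n + 1] = 1 # [2..<n + 1]" using n by (simp add: upt_conv_Cons numeral_2_eq_2)
  have "realify (map v [1..<n + 1]) = Re_vec (v 1) # realify (map v [2..<n + 1])"
    unfolding upt using r by (cases "map v [2..<n + 1]") auto
  also have "realify (map v [2..<n + 1]) = map u [2..<n + 1]"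
    using realify_eq[of 2] n by simp
  finally show ?thesis unfolding upt using r by (simp add: u_def)
qed

text \<open>Partners \<open>2 * i\<close> and \<open>2 * i + 1\<close> lie on the same side of every
  odd cut \<open>k\<close>. Hence \<open>u i\<close> inherits from them its membership in the spaces
  of \<open>in_V k\<close> and \<open>in_W k\<close>.\<close>

lemma u_comb:
  assumes i: "i \<in> {1..n}"
  shows "\<exists>a b j l. (\<forall>r<n. complex_of_real (u i $ r) = a * v j $ r + b * v l $ r) \<and>
    j \<in> {1..n} \<and> l \<in> {1..n} \<and> (\<forall>k. odd k \<longrightarrow> (j \<le> k \<longleftrightarrow> i \<le> k) \<and> (l \<le> k \<longleftrightarrow> i \<le> k))"
proof (cases "real_vec (v i)")
  case True
  have "complex_of_real (u i $ r) = 1 * v i $ r + 0 * v i $ r" if "r < n" for r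
    using real_eq[OF True carrier[OF i] that] True by (simp add: u_def)
  then show ?thesis using i by (intro exI[of _ 1] exI[of _ i] exI[of _ 0] exI[of _ i] conjI) auto
next
  case False
  show ?thesis
  proof (cases "even i")
    case even: True
    have p: "i < n" "conj_pair (v i) (v (i + 1))" using even_nonreal[OF even i False] by auto
    have "complex_of_real (u i $ r) = 1/2 * v i $ r + 1/2 * v (i + 1) $ r" if "r < n" for r
      using conj_pair_index[OF p(2) carrier[OF i] that] even carrier[OF i] that
      by (simp add: u_def complex_eq_iff)
    moreover have "i + 1 \<le> k \<longleftrightarrow> i \<le> k" if "odd k" for k
    proof
      assume "i \<le> k"
      moreover have "i \<noteq> k" using even that by auto
      ultimately show "i + 1 \<le> k" by linarith
    qed simp
    ultimately show ?thesis using i p(1)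
      by (intro exI[of _ "1/2"] exI[of _ i] exI[of _ "i + 1"] conjI) auto
  next
    case odd: False
    have p: "1 < i" "conj_pair (v (i - 1)) (v i)" using odd_nonreal[OF odd i False] by auto
    have i': "i - 1 \<in> {1..n}" using p(1) i by auto
    \<comment> \<open>The imaginary part of \<open>v (i - 1)\<close> is half the difference to its
      conjugate \<open>v i\<close>, divided by \<open>\<i>\<close>.\<close>
    have "complex_of_real (u i $ r) = (- \<i> / 2) * v (i - 1) $ r + (\<i> / 2) * v i $ r" if "r < n" for r
      using conj_pair_index[OF p(2) carrier[OF i'] that] odd False carrier[OF i'] that
      by (simp add: u_def complex_eq_iff)
    moreover have "i - 1 \<le> k \<longleftrightarrow> i \<le> k" if "odd k" for k
    proof
      assume "i - 1 \<le> k"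
      moreover have "i - 1 \<noteq> k" using odd that p(1) by auto
      ultimately show "i \<le> k" by linarith
    qed simp
    ultimately show ?thesis using i i'
      by (intro exI[of _ "- \<i> / 2"] exI[of _ "\<i> / 2"] exI[of _ "i - 1"] exI[of _ i] conjI) auto
  qed
qed

lemma u_in_V:
  assumes "i \<in> {1..n}" "i \<le> k" "odd k" "k \<le> n"
  shows "in_V k (\<lambda>r. of_real (u i $ r))"
proof -
  from u_comb[OF assms(1)]
  obtain a b j l where *: "\<forall>r<n. complex_of_real (u i $ r) = a * v j $ r + b * v l $ r"
    "j \<in> {1..n}" "l \<in> {1..n}" "\<forall>k. odd k \<longrightarrow> (j \<le> k \<longleftrightarrow> i \<le> k) \<and> (l \<le> k \<longleftrightarrow> i \<le> k)"
    by (elim exE conjE)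
  have "in_V k (\<lambda>r. a * v j $ r + b * v l $ r)"
    using *(2-4) assms by (intro in_V_lincomb v_in_V) auto
  then show ?thesis by (rule in_V_cong[rotated]) (simp add: *(1))
qed

lemma u_in_W:
  assumes "i \<in> {1..n}" "k < i" "odd k"
  shows "in_W k (\<lambda>r. of_real (u i $ r))"
proof -
  from u_comb[OF assms(1)]
  obtain a b j l where *: "\<forall>r<n. complex_of_real (u i $ r) = a * v j $ r + b * v l $ r"
    "j \<in> {1..n}" "l \<in> {1..n}" "\<forall>k. odd k \<longrightarrow> (j \<le> k \<longleftrightarrow> i \<le> k) \<and> (l \<le> k \<longleftrightarrow> i \<le> k)"
    by (elim exE conjE)
  have "k < j" "k < l" using *(4) assms(2,3) by (auto simp: not_le[symmetric])
  then have "in_W k (\<lambda>r. a * v j $ r + b * v l $ r)"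
    using *(2,3) assms by (intro in_W_lincomb v_in_W) auto
  then show ?thesis by (rule in_W_cong[rotated]) (simp add: *(1))
qed

text \<open>A conjugate pair is settled by the independence of real and imaginary part, two real
  eigenvectors for one eigenvalue by the premise. For distinct eigenvalues \<open>A\<close> is
  applied to the relation and one vector is eliminated.\<close>

lemma u_pair_indpt:
  assumes i: "even i" "1 \<le> i" "i < n"
    and indpt: "lam i = lam (i + 1) \<Longrightarrow> lin_indpt_family n [v i, v (i + 1)]"
    and comb: "\<And>r. r < n \<Longrightarrow> a * u i $ r + b * u (i + 1) $ r = 0"
  shows "a = 0 \<and> b = 0"
proof (cases "real_vec (v i)")
  case False
  have i1: "i \<in> {1..n}" using i by auto
  have "conj_pair (v i) (v (i + 1))" using even_nonreal[OF i(1) i1 False] by simp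
  then have "\<not> real_vec (v (i + 1))"
    using False carrier[OF i1] by (auto simp: conj_pair_def real_vec_def Reals_cnj_iff)
  then have "u i = Re_vec (v i)" "u (i + 1) = Im_vec (v i)" using i(1) by (auto simp: u_def)
  then show ?thesis
    using lin_indpt_family_pairD[OF Re_Im_indpt[OF i1 False], of a b] comb by simp
next
  case True
  have i1: "i \<in> {1..n}" "i + 1 \<in> {1..n}" using i by auto
  have r1: "real_vec (v (i + 1))"
    using odd_nonreal[of "i + 1"] i i1 True by (auto simp: conj_pair_def)
  have u: "complex_of_real (u i $ r) = v i $ r" "complex_of_real (u (i + 1) $ r) = v (i + 1) $ r"
    if "r < n" for r
    using real_eq[OF True carrier[OF i1(1)] that] real_eq[OF r1 carrier[OF i1(2)] that] True r1
    by (auto simp: u_def)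
  have c: "of_real a * v i $ r + of_real b * v (i + 1) $ r = 0" if "r < n" for r
    using arg_cong[OF comb[OF that], of complex_of_real] u[OF that] by simp
  show ?thesis
  proof (cases "lam i = lam (i + 1)")
    case True
    then show ?thesis using lin_indpt_family_pairD[OF indpt[OF True] c] by simp
  next
    case False
    have zero: "of_real a * (lam i * v i $ r) + of_real b * (lam (i + 1) * v (i + 1) $ r) = 0" if "r < n" for r
    proof -
      have "of_real a * (lam i * v i $ r) + of_real b * (lam (i + 1) * v (i + 1) $ r)
        = (\<Sum>j<n. of_real (A r j) * (of_real a * v i $ j + of_real b * v (i + 1) $ j))"
        unfolding eigen[OF i1(1) that, symmetric] eigen[OF i1(2) that, symmetric]
        by (simp add: sum_distrib_left distrib_left sum.distrib mult_ac)
      then show ?thesis using c by simp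
    qed
    have a0: "of_real a * (lam i - lam (i + 1)) * v i $ r = 0" if "r < n" for r
    proof -
      have "of_real a * (lam i - lam (i + 1)) * v i $ r
        = (of_real a * (lam i * v i $ r) + of_real b * (lam (i + 1) * v (i + 1) $ r))
          - lam (i + 1) * (of_real a * v i $ r + of_real b * v (i + 1) $ r)"
        by (simp add: algebra_simps)
      then show ?thesis unfolding zero[OF that] c[OF that] by simp
    qed
    have b0: "of_real b * (lam (i + 1) - lam i) * v (i + 1) $ r = 0" if "r < n" for r
    proof -
      have "of_real b * (lam (i + 1) - lam i) * v (i + 1) $ r
        = (of_real a * (lam i * v i $ r) + of_real b * (lam (i + 1) * v (i + 1) $ r))
          - lam i * (of_real a * v i $ r + of_real b * v (i + 1) $ r)"
        by (simp add: algebra_simps)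
      then show ?thesis unfolding zero[OF that] c[OF that] by simp
    qed
    obtain r where "r < n" "v i $ r \<noteq> 0" using vec_nonzero[OF carrier[OF i1(1)] nonzero[OF i1(1)]] .
    moreover obtain s where "s < n" "v (i + 1) $ s \<noteq> 0"
      using vec_nonzero[OF carrier[OF i1(2)] nonzero[OF i1(2)]] .
    ultimately show ?thesis using a0[of r] b0[of s] False by auto
  qed
qed

text \<open>Let \<open>{i, i + 1}\<close> be the block of the largest index with nonzero
  coefficient. Its part \<open>x\<close> of the relation satisfies \<open>in_W (i - 1)\<close>;
  being minus the sum of the earlier terms, it also satisfies \<open>in_V (i - 1)\<close>. So
  \<open>x = 0\<close>, and the block itself is independent. Position 1 is a block of its own, and
  oddness of \<open>p\<close> ensures that no block is cut in half.\<close>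

lemma u_indpt:
  assumes p: "odd p" "p \<le> n"
    and indpt: "\<And>i j. \<lbrakk>1 \<le> i; i < j; j \<le> n; lam i = lam j\<rbrakk> \<Longrightarrow> lin_indpt_family n [v i, v j]"
    and comb: "\<And>r. r < n \<Longrightarrow> (\<Sum>j\<in>{1..p}. c j * u j $ r) = 0"
    and j: "j \<in> {1..p}"
  shows "c j = 0"
proof (rule ccontr)
  assume "c j \<noteq> 0"
  define N where "N = {j \<in> {1..p}. c j \<noteq> 0}"
  define m where "m = Max N"
  have N: "finite N" "N \<noteq> {}" using \<open>c j \<noteq> 0\<close> j by (auto simp: N_def)
  have m: "m \<in> {1..p}" "c m \<noteq> 0" using Max_in[OF N] by (auto simp: m_def N_def)
  have above: "c l = 0" if "l \<in> {1..p}" "m < l" for l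
  proof (rule ccontr)
    assume "c l \<noteq> 0"
    then have "l \<in> N" using that(1) by (simp add: N_def)
    then have "l \<le> m" unfolding m_def by (rule Max_ge[OF N(1)])
    then show False using that(2) by simp
  qed
  show False
  proof (cases "m = 1")
    case True
    have "c 1 * u 1 $ r = 0" if "r < n" for r
    proof -
      have "(\<Sum>j\<in>{1..p} - {1}. c j * u j $ r) = 0"
        using above True by (intro sum.neutral) auto
      moreover have "(\<Sum>j\<in>{1..p}. c j * u j $ r) = c 1 * u 1 $ r + (\<Sum>j\<in>{1..p} - {1}. c j * u j $ r)"
        using m(1) True by (intro sum.remove) auto
      ultimately show ?thesis using comb[OF that] by simp
    qed
    moreover have r: "real_vec (v 1)" using odd_nonreal[of 1] n by auto
    ultimately have "Re_vec (v 1) $ r = 0" if "r < n" for r using that m True by (simp add: u_def)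
    then have "Re_vec (v 1) = 0\<^sub>v n" using Re_vec_nonzero(1)[of 1] r n by (intro eq_vecI) auto
    then show False using Re_vec_nonzero(2)[of 1] r n by simp
  next
    case False
    define i where "i = (if even m then m else m - 1)"
    have i: "even i" "2 \<le> i" "i < p" "m = i \<or> m = i + 1"
    proof -
      have "1 < m" "m \<le> p" using False m(1) by auto
      moreover have "m \<noteq> p" if "even m" using that p(1) by auto
      moreover have "m \<noteq> 2" if "odd m" using that by auto
      ultimately show "even i" "2 \<le> i" "i < p" "m = i \<or> m = i + 1" by (auto simp: i_def)
    qed
    define k where "k = i - 1"
    have k: "odd k" "k < i" "i = k + 1" "k \<le> n" using i p by (auto simp: k_def)
    define x where "x r = c i * u i $ r + c (i + 1) * u (i + 1) $ r" for r
    have split: "{1..p} = {1..k} \<union> {i, i + 1} \<union> {i + 2..p}" using i k by auto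
    have x: "x r = - (\<Sum>j\<in>{1..k}. c j * u j $ r)" if "r < n" for r
    proof -
      have "(\<Sum>j\<in>{i + 2..p}. c j * u j $ r) = 0"
        using above i by (intro sum.neutral) auto
      moreover have "(\<Sum>j\<in>{1..p}. c j * u j $ r)
        = (\<Sum>j\<in>{1..k}. c j * u j $ r) + x r + (\<Sum>j\<in>{i + 2..p}. c j * u j $ r)"
        unfolding split x_def using k(3) by (subst sum.union_disjoint; auto)+
      ultimately show ?thesis using comb[OF that] by simp
    qed
    have W: "in_W k (\<lambda>r. of_real (x r))"
    proof (rule in_W_cong)
      show "in_W k (\<lambda>r. of_real (c i) * of_real (u i $ r) + of_real (c (i + 1)) * of_real (u (i + 1) $ r))"
        using i k p by (intro in_W_lincomb u_in_W) auto
    qed (simp add: x_def)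
    have V: "in_V k (\<lambda>r. of_real (x r))"
    proof (rule in_V_cong)
      have "in_V k (\<lambda>r. - of_real (c j) * of_real (u j $ r))" if "j \<in> {1..k}" for j
        using in_V_lincomb[OF u_in_V u_in_V, of j k j "- of_real (c j)" 0] that k by simp
      then show "in_V k (\<lambda>r. \<Sum>j\<in>{1..k}. - of_real (c j) * of_real (u j $ r))"
        by (intro in_V_sum) auto
    qed (simp add: x sum_negf)
    have "x r = 0" if "r < n" for r
      using V_W_disjoint[OF V W k(1,4) that] by simp
    then have "c i = 0 \<and> c (i + 1) = 0"
      using i p indpt[of i "i + 1"] by (intro u_pair_indpt) (auto simp: x_def)
    then show False using m(2) i(4) by auto
  qed
qed

section \<open>Eigenvalues and the sign variations of eigenvectors\<close>

lemma lam_mono: "1 \<le> i \<Longrightarrow> i \<le> j \<Longrightarrow> j \<le> n \<Longrightarrow> cmod (lam j) \<le> cmod (lam i)"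
  using decreasing[of "i - 1" "j - 1"] by simp

text \<open>An odd \<open>k\<close> with \<open>i \<le> k < j\<close> would put a strict drop in
  between; only an even \<open>i\<close> with its successor leaves no room for one.\<close>

lemma lam_strict:
  assumes "1 \<le> i" "i < j" "j \<le> n" "cmod (lam i) = cmod (lam j)"
  shows "even i \<and> j = i + 1"
proof -
  have no_gap: False if "odd k" "i \<le> k" "k < j" for k
  proof -
    have "cmod (lam j) \<le> cmod (lam (k + 1))" using lam_mono[of "k + 1" j] that assms by simp
    also have "\<dots> < cmod (lam k)" using lam_gap[of k] that assms by simp
    also have "\<dots> \<le> cmod (lam i)" using lam_mono[of i k] that assms by simp
    finally show False using assms(4) by simp
  qed
  have "even i" using no_gap[of i] assms by auto
  then have "odd (i + 1)" by simp
  then have "\<not> i + 1 < j" using no_gap[of "i + 1"] by auto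
  then show ?thesis using \<open>even i\<close> assms(2) by simp
qed

lemma simple_leading: "card {i \<in> {1..n}. lam i = lam 1} = 1"
proof -
  have "i = 1" if "i \<in> {1..n}" "lam i = lam 1" for i
    using lam_strict[of 1 i] that by (cases "i = 1") auto
  then have "{i \<in> {1..n}. lam i = lam 1} = {1}" using n by auto
  then show ?thesis by simp
qed

lemma multiplicity_le: "card {i \<in> {1..n}. lam i = \<mu>} \<le> 2"
proof (cases "{i \<in> {1..n}. lam i = \<mu>} = {}")
  case False
  define N where "N = {i \<in> {1..n}. lam i = \<mu>}"
  define m where "m = Min N"
  have N: "finite N" "N \<noteq> {}" using False by (auto simp: N_def)
  have m: "m \<in> N" unfolding m_def by (rule Min_in[OF N])
  have "N \<subseteq> {m, m + 1}"
  proof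
    fix i assume i: "i \<in> N"
    then have "m \<le> i" unfolding m_def by (intro Min_le N)
    then show "i \<in> {m, m + 1}"
      using lam_strict[of m i] i m by (cases "m = i") (auto simp: N_def)
  qed
  then have "card N \<le> card {m, m + 1}" by (intro card_mono) auto
  then show ?thesis by (simp add: N_def)
qed (simp only: card.empty)

lemma eps_sq: "odd k \<Longrightarrow> k \<le> n \<Longrightarrow> eps k * eps k = 1"
  using eps[of k] by auto

lemma leading_real: "lam 1 \<in> \<real> \<and> eps 1 * Re (lam 1) > 0"
proof -
  obtain \<rho> where \<rho>: "\<rho> > 0" "lam 1 = of_real (eps 1 * \<rho>)"
    using leading_prod[of 1] n by (auto simp: lessThan_Suc)
  have "eps 1 * Re (lam 1) = eps 1 * eps 1 * \<rho>" unfolding \<rho>(2) by simp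
  also have "\<dots> = \<rho>" using eps_sq[of 1] n by simp
  finally have "eps 1 * Re (lam 1) = \<rho>" .
  moreover have "lam 1 \<in> \<real>" unfolding \<rho>(2) by simp
  ultimately show ?thesis using \<rho>(1) by simp
qed

text \<open>The products of the first \<open>k + 1\<close> and of the first \<open>k - 1\<close>
  eigenvalues are positive multiples of \<open>eps (k + 1)\<close> and \<open>eps (k - 1)\<close>;
  \<open>lam k * lam (k + 1)\<close> is their quotient.\<close>

lemma pair_product:
  assumes "even k" "2 \<le> k" "k \<le> n - 1"
  shows "lam k * lam (k + 1) \<in> \<real> \<and> eps (k - 1) * eps (k + 1) * Re (lam k * lam (k + 1)) > 0"
proof -
  have k: "odd (k - 1)" "odd (k + 1)" "k - 1 \<le> n" "k + 1 \<le> n" using assms by auto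
  obtain \<rho> where \<rho>: "\<rho> > 0" "(\<Prod>j<k - 1. lam (Suc j)) = of_real (eps (k - 1) * \<rho>)"
    using leading_prod[OF k(1,3)] by blast
  obtain \<sigma> where \<sigma>: "\<sigma> > 0" "(\<Prod>j<k + 1. lam (Suc j)) = of_real (eps (k + 1) * \<sigma>)"
    using leading_prod[OF k(2,4)] by blast
  define x where "x = lam k * lam (k + 1)"
  obtain m where m: "k = Suc m" using assms(2) by (cases k) auto
  have "(\<Prod>j<k + 1. lam (Suc j)) = (\<Prod>j<k - 1. lam (Suc j)) * x"
    unfolding m x_def by (simp add: mult_ac)
  then have eq: "of_real (eps (k + 1) * \<sigma>) = of_real (eps (k - 1) * \<rho>) * x"
    unfolding \<rho>(2) \<sigma>(2) .
  have e: "eps (k - 1) \<in> {-1, 1}" "eps (k + 1) \<in> {-1, 1}" using eps k by auto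
  define y where "y = eps (k + 1) * \<sigma> / (eps (k - 1) * \<rho>)"
  have "x = of_real y" using eq \<rho>(1) e(1) by (auto simp: y_def field_simps)
  moreover have "eps (k - 1) * eps (k + 1) * y > 0"
    using e \<rho>(1) \<sigma>(1) by (auto simp: y_def)
  ultimately show ?thesis unfolding x_def[symmetric] by simp
qed

text \<open>The determinant replaces the longer leading product: \<open>lam n\<close> is its
  quotient by the product of the first \<open>n - 1\<close> eigenvalues, and \<open>n - 1\<close> is
  odd.\<close>

lemma last_real:
  assumes "even n" and det: "of_real d = (\<Prod>i<n. lam (Suc i))" "d \<noteq> 0"
  shows "lam n \<in> \<real> \<and> eps (n - 1) * d * Re (lam n) > 0"
proof -
  have k: "odd (n - 1)" "n - 1 \<le> n" using assms(1) n by auto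
  obtain \<rho> where \<rho>: "\<rho> > 0" "(\<Prod>j<n - 1. lam (Suc j)) = of_real (eps (n - 1) * \<rho>)"
    using leading_prod[OF k] by blast
  obtain m where m: "n = Suc m" using n by (cases n) auto
  have "of_real d = (\<Prod>j<n - 1. lam (Suc j)) * lam n"
    unfolding det(1) m by simp
  then have eq: "of_real d = of_real (eps (n - 1) * \<rho>) * lam n" unfolding \<rho>(2) .
  have e: "eps (n - 1) \<in> {-1, 1}" using eps k by auto
  define y where "y = d / (eps (n - 1) * \<rho>)"
  have y: "lam n = of_real y" using eq \<rho>(1) e by (auto simp: y_def field_simps)
  have "d * d > 0" using det(2) not_real_square_gt_zero[of d] by blast
  then have "eps (n - 1) * d * y > 0"
    using e \<rho>(1) by (auto simp: y_def)
  then show ?thesis unfolding y by simp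
qed

text \<open>Membership in \<open>in_V k\<close> for \<open>k = 2 * i + 1\<close> bounds the weak
  variations by \<open>k - 1\<close>.\<close>

lemma s_plus_real:
  assumes "2 * i + 1 \<le> n" "real_vec (v (2 * i + 1))"
  shows "s_plus (Re_vec (v (2 * i + 1))) \<le> 2 * i"
proof -
  have i: "2 * i + 1 \<in> {1..n}" using assms by simp
  have "in_V (2 * i + 1) (\<lambda>r. complex_of_real (Re_vec (v (2 * i + 1)) $ r))"
    by (rule in_V_cong[OF _ v_in_V[OF i]])
      (use assms(1) real_eq[OF assms(2) carrier[OF i]] in simp_all)
  from s_plus_V[OF this _ assms(1) Re_vec_nonzero[OF i assms(2)]] show ?thesis by simp
qed

text \<open>The largest odd \<open>k\<close> below position \<open>2 * i\<close> is
  \<open>2 * i - 1\<close>, and membership in \<open>in_W k\<close> forces \<open>k\<close> strong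
  variations.\<close>

lemma s_minus_real:
  assumes "1 \<le> i" "2 * i \<le> n" "real_vec (v (2 * i))"
  shows "2 * i - 1 \<le> s_minus (Re_vec (v (2 * i)))"
proof -
  have i: "2 * i \<in> {1..n}" and k: "odd (2 * i - 1)" "2 * i - 1 < 2 * i" "2 * i - 1 \<le> n"
    using assms by auto
  have "in_W (2 * i - 1) (\<lambda>r. complex_of_real (Re_vec (v (2 * i)) $ r))"
    by (rule in_W_cong[OF _ v_in_W[OF i k(2,1)]])
      (use real_eq[OF assms(3) carrier[OF i]] in simp)
  from s_minus_W[OF this k(1,3) Re_vec_nonzero[OF i assms(3)]] show ?thesis .
qed

lemma s_plus_pair:
  assumes "1 \<le> i" "2 * i + 1 \<le> n" "conj_pair (v (2 * i)) (v (2 * i + 1))" "matching c1 c2"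
  shows "s_plus (real_comb c1 (v (2 * i)) c2 (v (2 * i + 1))) \<le> 2 * i"
proof -
  have i: "2 * i \<in> {1..n}" "2 * i + 1 \<in> {1..n}" using assms by auto
  have "in_V (2 * i + 1) (\<lambda>r. of_real (real_comb c1 (v (2 * i)) c2 (v (2 * i + 1)) $ r))"
    using assms by (intro real_comb_in_V[OF i assms(3,4)]) auto
  from s_plus_V[OF this _ assms(2) real_comb_nonzero[OF i(1) assms(3,4)]] show ?thesis by simp
qed

lemma s_minus_pair:
  assumes "1 \<le> i" "2 * i + 1 \<le> n" "conj_pair (v (2 * i)) (v (2 * i + 1))" "matching c1 c2"
  shows "2 * i - 1 \<le> s_minus (real_comb c1 (v (2 * i)) c2 (v (2 * i + 1)))"
proof -
  have i: "2 * i \<in> {1..n}" "2 * i + 1 \<in> {1..n}"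
    and k: "odd (2 * i - 1)" "2 * i - 1 < 2 * i" "2 * i - 1 \<le> n" using assms by auto
  have "in_W (2 * i - 1) (\<lambda>r. of_real (real_comb c1 (v (2 * i)) c2 (v (2 * i + 1)) $ r))"
    by (rule real_comb_in_W[OF i assms(3,4) k(2,1)])
  from s_minus_W[OF this k(1,3) real_comb_nonzero[OF i(1) assms(3,4)]] show ?thesis .
qed

lemma realify_indpt:
  assumes p: "odd p" "p \<le> n"
    and indpt: "\<And>i j. \<lbrakk>1 \<le> i; i < j; j \<le> n; lam i = lam j\<rbrakk> \<Longrightarrow> lin_indpt_family n [v i, v j]"
  shows "lin_indpt_family n (take p (realify (map v [1..<n + 1])))"
proof -
  define ws where "ws = take p (realify (map v [1..<n + 1]))"
  have "take p [1..<n + 1] = [1..<p + 1]"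
    using p(2) take_upt[of 1 p "n + 1"] by (simp add: add.commute del: upt_Suc)
  then have ws: "ws = map u [1..<p + 1]"
    unfolding ws_def realify_all take_map by (rule arg_cong)
  have len: "length ws = p" by (simp add: ws del: upt_Suc)
  have nth: "ws ! i = u (Suc i)" if "i < p" for i
    using that by (simp add: ws del: upt_Suc)
  have "lin_indpt_family n ws"
  proof (rule lin_indpt_familyI)
    show "set ws \<subseteq> carrier_vec n" using u_carrier p(2) by (auto simp: ws simp del: upt_Suc)
  next
    fix c j assume comb: "\<And>r. r < n \<Longrightarrow> (\<Sum>i<length ws. c i * ws ! i $ r) = 0" and j: "j < length ws"
    have j: "j < p" using j len by simp
    have "(\<Sum>i\<in>{1..p}. c (i - 1) * u i $ r) = 0" if "r < n" for r
    proof -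
      have "(\<Sum>i\<in>{1..p}. c (i - 1) * u i $ r) = (\<Sum>i<p. c i * u (Suc i) $ r)"
        using sum.shift_bounds_Suc_ivl[of "\<lambda>i. c (i - 1) * u i $ r" 0 p]
        by (simp add: atLeastLessThanSuc_atLeastAtMost lessThan_atLeast0)
      also have "\<dots> = (\<Sum>i<length ws. c i * ws ! i $ r)"
        by (simp add: len nth)
      finally show ?thesis using comb[OF that] by simp
    qed
    then have "c (Suc j - 1) = 0"
      using j by (intro u_indpt[OF p indpt, of "\<lambda>i. c (i - 1)"]) auto
    then show "c j = 0" by simp
  qed
  then show ?thesis by (simp add: ws_def)
qed

end

theorem theorem3:
  fixes A :: "real mat" and n :: nat and eps :: "nat \<Rightarrow> real"
    and lam :: "nat \<Rightarrow> complex" and v :: "nat \<Rightarrow> complex vec"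
  assumes n_pos: "n \<ge> 1"
    and A_carrier: "A \<in> carrier_mat n n"
    and A_nonsing: "det A \<noteq> 0"
    and A_SSR: "\<And>k. k \<in> {1..n} \<Longrightarrow> odd k \<Longrightarrow> SSR k A"
    and eps: "\<And>k. k \<in> {1..n} \<Longrightarrow> odd k \<Longrightarrow>
                eps k \<in> {-1, 1} \<and> (\<forall>m \<in> minors k A. sgn m = eps k)"
    and eigenvalues: "char_poly (complex_mat A) = (\<Prod>i = 1..n. [:- lam i, 1:])"
    and ordered: "\<And>i j. 1 \<le> i \<Longrightarrow> i \<le> j \<Longrightarrow> j \<le> n \<Longrightarrow> cmod (lam i) \<ge> cmod (lam j)"
    and last_pos: "cmod (lam n) > 0"
    and lam_pairs: "\<And>i. i \<in> {1..n} \<Longrightarrow>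
           lam i \<in> \<real> \<or> (i < n \<and> lam (i + 1) = cnj (lam i)) \<or> (1 < i \<and> lam i = cnj (lam (i - 1)))"
    and eigenvectors: "\<And>i. i \<in> {1..n} \<Longrightarrow> eigenvector (complex_mat A) (v i) (lam i)"
    and not_imaginary: "\<And>i. i \<in> {1..n} \<Longrightarrow> Re_vec (v i) \<noteq> 0\<^sub>v n"
    and v_pairs: "\<And>i. i \<in> {1..n} \<Longrightarrow>
           real_vec (v i) \<or> (i < n \<and> conj_pair (v i) (v (i + 1))) \<or> (1 < i \<and> conj_pair (v (i - 1)) (v i))"
    and Re_Im_indpt: "\<And>i. i \<in> {1..n} \<Longrightarrow> \<not> real_vec (v i) \<Longrightarrow>
           lin_indpt_family n [Re_vec (v i), Im_vec (v i)]"
  shows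
    "(Polynomial.order (lam 1) (char_poly (complex_mat A)) = 1 \<and> lam 1 \<in> \<real> \<and> eps 1 * Re (lam 1) > 0) \<and>
     ((\<forall>\<mu>. eigenvalue (complex_mat A) \<mu> \<longrightarrow> Polynomial.order \<mu> (char_poly (complex_mat A)) \<le> 2) \<and>
      (\<forall>j. 1 \<le> j \<and> j < n \<longrightarrow>
         (if odd j then cmod (lam j) > cmod (lam (j + 1)) else cmod (lam j) \<ge> cmod (lam (j + 1))))) \<and>
     (\<forall>k. even k \<and> 2 \<le> k \<and> k \<le> n - 1 \<longrightarrow>
         lam k * lam (k + 1) \<in> \<real> \<and> eps (k - 1) * eps (k + 1) * Re (lam k * lam (k + 1)) > 0) \<and>
     (even n \<longrightarrow> lam n \<in> \<real> \<and> eps (n - 1) * det A * Re (lam n) > 0) \<and>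
     (\<forall>i. 2 * i + 1 \<le> n \<and> real_vec (v (2 * i + 1)) \<longrightarrow> s_plus (Re_vec (v (2 * i + 1))) \<le> 2 * i) \<and>
     (\<forall>i c1 c2. 1 \<le> i \<and> 2 * i + 1 \<le> n \<and> conj_pair (v (2 * i)) (v (2 * i + 1)) \<and> matching c1 c2 \<longrightarrow>
         s_plus (real_comb c1 (v (2 * i)) c2 (v (2 * i + 1))) \<le> 2 * i) \<and>
     (\<forall>i. 1 \<le> i \<and> 2 * i \<le> n \<and> real_vec (v (2 * i)) \<longrightarrow> s_minus (Re_vec (v (2 * i))) \<ge> 2 * i - 1) \<and>
     (\<forall>i c1 c2. 1 \<le> i \<and> 2 * i + 1 \<le> n \<and> conj_pair (v (2 * i)) (v (2 * i + 1)) \<and> matching c1 c2 \<longrightarrow>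
         s_minus (real_comb c1 (v (2 * i)) c2 (v (2 * i + 1))) \<ge> 2 * i - 1) \<and>
     ((\<forall>i j. 1 \<le> i \<and> i < j \<and> j \<le> n \<and> lam i = lam j \<longrightarrow> lin_indpt_family n [v i, v j]) \<longrightarrow>
         lin_indpt_family n (take (Max {p. odd p \<and> p \<le> n}) (realify (map v [1..<n + 1]))))"
proof -
  let ?X = "complex_mat A"
  define a where "a = (\<lambda>i j. A $$ (i, j))"
  have X: "?X \<in> carrier_mat n n" using A_carrier by simp
  have dims: "dim_row A = n" "dim_col A = n" using A_carrier by auto
  obtain P P' B where P: "schur_basis n (\<lambda>i j. ?X $$ (i, j)) P P' B (\<lambda>i. lam (Suc i))"
    using schur_basis_exists(1)[OF X eigenvalues] by blast
  have XT: "transpose_mat ?X \<in> carrier_mat n n" using X by simp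
  \<comment> \<open>The transpose has the same characteristic polynomial, so both triangularisations
    carry the eigenvalues in the same order and their dominant subspaces of odd dimension belong to
    the same eigenvalues.\<close>
  have "char_poly (transpose_mat ?X) = (\<Prod>i = 1..n. [:- lam i, 1:])"
    using eigenvalues X by simp
  then obtain Q Q' B' where
    Q: "schur_basis n (\<lambda>i j. transpose_mat ?X $$ (i, j)) Q Q' B' (\<lambda>i. lam (Suc i))"
    using schur_basis_exists(1)[OF XT] by blast
  have P1: "schur_basis n (\<lambda>i j. complex_of_real (a i j)) P P' B (\<lambda>i. lam (Suc i))"
    using dims by (intro schur_basis_cong[OF P]) (simp add: a_def)
  have Q1: "schur_basis n (\<lambda>i j. complex_of_real (a j i)) Q Q' B' (\<lambda>i. lam (Suc i))"
    using dims by (intro schur_basis_cong[OF Q]) (simp add: a_def)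
  have eps': "eps k \<in> {-1, 1}" if "odd k" "k \<le> n" for k
    using eps[of k] that by (cases k) auto
  have definite: "eps k * minor a I J > 0" if k: "odd k" "k \<le> n" and IJ: "I \<in> ksets n k" "J \<in> ksets n k" for k I J
  proof -
    have "det (submatrix A I J) \<in> minors k A"
      unfolding minors_def using ksetsD(1,2)[OF IJ(1)] ksetsD(1,2)[OF IJ(2)] dims
      by (intro CollectI exI[of _ I] exI[of _ J]) auto
    then have "minor a I J \<in> minors k A"
      using submatrix_minor[of I A J] ksetsD(1)[OF IJ(1)] ksetsD(1)[OF IJ(2)] dims by (simp add: a_def)
    then have sgn: "sgn (minor a I J) = eps k" using eps[of k] k by (cases k) auto
    then have "minor a I J \<noteq> 0" using eps'[OF k] by auto
    then show ?thesis unfolding sgn[symmetric] by (auto simp: sgn_if)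
  qed
  have eigen: "v i \<in> carrier_vec n" "v i \<noteq> 0\<^sub>v n"
    "r < n \<Longrightarrow> (\<Sum>j<n. complex_of_real (a r j) * v i $ j) = lam i * v i $ r" if "i \<in> {1..n}" for i r
  proof -
    have ev: "v i \<in> carrier_vec n" "v i \<noteq> 0\<^sub>v n" "?X *\<^sub>v v i = lam i \<cdot>\<^sub>v v i"
      using eigenvectors[OF that] dims by (auto simp: eigenvector_def)
    then show "v i \<in> carrier_vec n" "v i \<noteq> 0\<^sub>v n" by auto
    assume r: "r < n"
    have "(?X *\<^sub>v v i) $ r = (\<Sum>j<n. complex_of_real (a r j) * v i $ j)"
      using r ev(1) dims by (simp add: scalar_prod_def lessThan_atLeast0 a_def)
    then show "(\<Sum>j<n. complex_of_real (a r j) * v i $ j) = lam i * v i $ r"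
      using r ev by simp
  qed
  interpret odd_sign_regular n a P P' B Q Q' B' "\<lambda>i. lam (Suc i)" eps
    by (intro odd_sign_regular.intro P1 Q1 odd_sign_regular_axioms.intro)
      (use n_pos eps' definite ordered in auto)
  interpret sign_regular_eigenvectors n a P P' B Q Q' B' lam eps v
    by unfold_locales (use eigen v_pairs Re_Im_indpt in auto)
  have order: "Polynomial.order \<mu> (char_poly ?X) = card {i \<in> {1..n}. lam i = \<mu>}" for \<mu>
    unfolding eigenvalues by (rule order_prod_linear) simp
  have det: "complex_of_real (det A) = (\<Prod>i<n. lam (Suc i))"
    using schur_basis_exists(2)[OF X eigenvalues] by (simp add: of_real_hom.hom_det)
  define p where "p = Max {p. odd p \<and> p \<le> n}"
  \<comment> \<open>The number 1 shows that the set is nonempty, so its maximum is a member.\<close>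
  have "p \<in> {p. odd p \<and> p \<le> n}"
    unfolding p_def using n_pos by (intro Max_in) (auto intro: exI[of _ 1])
  then have p: "odd p" "p \<le> n" by auto
  show ?thesis
    unfolding p_def[symmetric]
  proof (intro conjI allI impI)
    show "Polynomial.order (lam 1) (char_poly ?X) = 1" unfolding order by (rule simple_leading)
    show "lam 1 \<in> \<real>" "eps 1 * Re (lam 1) > 0" using leading_real by auto
    show "Polynomial.order \<mu> (char_poly ?X) \<le> 2" for \<mu> unfolding order by (rule multiplicity_le)
    show "if odd j then cmod (lam j) > cmod (lam (j + 1)) else cmod (lam j) \<ge> cmod (lam (j + 1))"
      if "1 \<le> j \<and> j < n" for j using lam_gap[of j] ordered[of j "j + 1"] that by auto
    show "lam k * lam (k + 1) \<in> \<real>" "eps (k - 1) * eps (k + 1) * Re (lam k * lam (k + 1)) > 0"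
      if "even k \<and> 2 \<le> k \<and> k \<le> n - 1" for k using pair_product[of k] that by auto
    show "lam n \<in> \<real>" "eps (n - 1) * det A * Re (lam n) > 0" if "even n"
      using last_real[OF that det A_nonsing] by auto
    show "s_plus (Re_vec (v (2 * i + 1))) \<le> 2 * i" if "2 * i + 1 \<le> n \<and> real_vec (v (2 * i + 1))" for i
      using s_plus_real that by blast
    show "s_plus (real_comb c1 (v (2 * i)) c2 (v (2 * i + 1))) \<le> 2 * i"
      if "1 \<le> i \<and> 2 * i + 1 \<le> n \<and> conj_pair (v (2 * i)) (v (2 * i + 1)) \<and> matching c1 c2" for i c1 c2
      using s_plus_pair that by blast
    show "2 * i - 1 \<le> s_minus (Re_vec (v (2 * i)))" if "1 \<le> i \<and> 2 * i \<le> n \<and> real_vec (v (2 * i))" for i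
      using s_minus_real that by blast
    show "2 * i - 1 \<le> s_minus (real_comb c1 (v (2 * i)) c2 (v (2 * i + 1)))"
      if "1 \<le> i \<and> 2 * i + 1 \<le> n \<and> conj_pair (v (2 * i)) (v (2 * i + 1)) \<and> matching c1 c2" for i c1 c2
      using s_minus_pair that by blast
    show "lin_indpt_family n (take p (realify (map v [1..<n + 1])))"
      if "\<forall>i j. 1 \<le> i \<and> i < j \<and> j \<le> n \<and> lam i = lam j \<longrightarrow> lin_indpt_family n [v i, v j]"
      using that by (intro realify_indpt p) auto
  qed
qed

end
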